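(* Let $H$ be a separable Hilbert space, $-\infty<a<b<\infty$, and let $A_1,A_2$ be linear selfadjoint operators in $H$ with $A_1\le 0$ and $A_2\ge 0$. Assume $$(-A_1)^{1/2}\,W_2^1(H,(-\infty,a))\subset W_2^1(H,(-\infty,a)),\qquad A_2^{1/2}\,W_2^1(H,(b,\infty))\subset W_2^1(H,(b,\infty)).$$ Let $L_0=L_{10}\oplus L_{20}$ be the minimal operator generated in $L_2=L_2(H,(-\infty,a))\oplus L_2(H,(b,\infty))$ by the differential expression $l(u)=(u_1'+A_1u_1,\;u_2'+A_2u_2)$, $u=(u_1,u_2)$. Then each normal extension $\tilde L$ of $L_0$ in $L_2$ is generated by the differential expression $l(\cdot)$ and the boundary condition $$u_2(b)=W u_1(a),\qquad u_1(a)\in\ker(-A_1)^{1/2},\qquad u_2(b)\in\ker A_2^{1/2},$$ where $W:H\to H$ is a unitary operator. Moreover, the unitary operator $W$ in $H$ is determined by the extension $\tilde L$, i.e. $\tilde L=L_W$, and vice versa (the extension is determined by $W$).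
   Context: Minimal and maximal operators. $L_{10}$ (resp. $L_{20}$) is the minimal operator generated by $l_1(u_1)=u_1'+A_1u_1$ in $L_2(H,(-\infty,a))$ (resp. by $l_2(u_2)=u_2'+A_2u_2$ in $L_2(H,(b,\infty))$), that is, the closure of the differential expression restricted to finite sums $\sum_j\varphi_j(t)f_j$ with $\varphi_j\in C_0^\infty$ of the open interval and $f_j\in D(A_k)$. Similarly $L_{k0}^+$, $k=1,2$, is the minimal operator generated by the formally adjoint expression $l_k^+(v_k)=-v_k'+A_kv_k$. The maximal operators are $L_k=(L_{k0}^+)^*$ and $L_k^+=L_{k0}^*$. Put $L_0=L_{10}\oplus L_{20}$ and $L=L_1\oplus L_2$; then $L_0\subset L$. Normal operators. A densely defined closed operator $N$ in a Hilbert space is formally normal if $D(N)\subset D(N^* )$ and $\|Nf\|=\|N^*f\|$ for all $f\in D(N)$. A formally normal operator $N$ is normal if $D(N)=D(N^* )$. A normal extension of $L_0$ is a normal operator $\tilde L$ in $L_2$ with $L_0\subset\tilde L$. Notation. $W_2^1(H,I)$ is the Sobolev space of $H$-valued functions on the interval $I$ that belong to $L_2(H,I)$ together with their first derivative. For a nonnegative selfadjoint operator $B$ in $H$, the inclusion $B\,W_2^1(H,I)\subset W_2^1(H,I)$ means that for every $u\in W_2^1(H,I)$ the function $t\mapsto Bu(t)$ is defined (almost everywhere) and belongs to $W_2^1(H,I)$. For a unitary $W$ in $H$, $L_W$ denotes the operator generated by $l(\cdot)$ and the boundary condition in the claim, i.e. the restriction of $L$ to those $u=(u_1,u_2)\in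 D(L)$ which satisfy that boundary condition. *)

theory Defs
  imports "HOL-Analysis.Analysis"
begin

section \<open>Complex inner product spaces\<close>

text \<open>
  The norm and the topology come from the real inner product, the real part of \<open>cinner\<close>, which
  is linear in the first and conjugate linear in the second argument.
\<close>

class complex_inner = real_inner +
  fixes scaleC :: "complex \<Rightarrow> 'a \<Rightarrow> 'a"  (infixr \<open>*\<^sub>C\<close> 75)
    and cinner :: "'a \<Rightarrow> 'a \<Rightarrow> complex"
  assumes scaleC_add_right: "c *\<^sub>C (x + y) = c *\<^sub>C x + c *\<^sub>C y"
    and scaleC_add_left: "(c + d) *\<^sub>C x = c *\<^sub>C x + d *\<^sub>C x"
    and scaleC_scaleC: "c *\<^sub>C d *\<^sub>C x = (c * d) *\<^sub>C x"
    and scaleR_scaleC: "r *\<^sub>R x = complex_of_real r *\<^sub>C x"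
    and cinner_commute: "cinner x y = cnj (cinner y x)"
    and cinner_add_left: "cinner (x + y) z = cinner x z + cinner y z"
    and cinner_scaleC_left: "cinner (c *\<^sub>C x) y = c * cinner x y"
    and Re_cinner: "Re (cinner x y) = inner x y"

instantiation complex :: complex_inner
begin
definition scaleC_complex :: "complex \<Rightarrow> complex \<Rightarrow> complex" where
  "scaleC_complex c x = c * x"
definition cinner_complex :: "complex \<Rightarrow> complex \<Rightarrow> complex" where
  "cinner_complex x y = x * cnj y"
instance
  by standard
    (auto simp: scaleC_complex_def cinner_complex_def algebra_simps scaleR_conv_of_real
      inner_complex_def)
end

instantiation prod :: (complex_inner, complex_inner) complex_inner
begin
definition scaleC_prod :: "complex \<Rightarrow> 'a \<times> 'b \<Rightarrow> 'a \<times> 'b" where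
  "scaleC_prod c x = (c *\<^sub>C fst x, c *\<^sub>C snd x)"
definition cinner_prod :: "'a \<times> 'b \<Rightarrow> 'a \<times> 'b \<Rightarrow> complex" where
  "cinner_prod x y = cinner (fst x) (fst y) + cinner (snd x) (snd y)"
instance
proof
  fix x y :: "'a \<times> 'b"
  show "cinner x y = cnj (cinner y x)"
    unfolding cinner_prod_def complex_cnj_add by (metis cinner_commute)
qed (auto simp: scaleC_prod_def cinner_prod_def scaleC_add_right scaleC_add_left scaleC_scaleC
      scaleR_scaleC cinner_add_left cinner_scaleC_left Re_cinner algebra_simps inner_prod_def
      scaleR_prod_def)
end

lemma inner_scaleC_scaleC:
  fixes x y :: "'a::complex_inner"
  shows "inner (c *\<^sub>C x) (c *\<^sub>C y) = (cmod c)\<^sup>2 * inner x y"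
proof -
  have "cinner (c *\<^sub>C x) (c *\<^sub>C y) = c * cnj (c * cinner y x)"
    by (metis cinner_scaleC_left cinner_commute)
  also have "\<dots> = complex_of_real ((cmod c)\<^sup>2) * cinner x y"
    by (simp add: complex_norm_square cinner_commute[of x y] del: of_real_power)
  finally have "Re (cinner (c *\<^sub>C x) (c *\<^sub>C y)) = (cmod c)\<^sup>2 * Re (cinner x y)"
    by (metis Re_complex_of_real Im_complex_of_real times_complex.simps(1) mult_zero_left diff_zero)
  then show ?thesis by (simp add: Re_cinner)
qed

lemma norm_scaleC: "norm (c *\<^sub>C x) = cmod c * norm (x :: 'a::complex_inner)"
  by (simp add: norm_eq_sqrt_inner inner_scaleC_scaleC real_sqrt_mult)

lemma bounded_linear_scaleC: "bounded_linear (\<lambda>x :: 'a::complex_inner. c *\<^sub>C x)"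
proof (rule bounded_linear_intro[where K = "cmod c"])
  show "c *\<^sub>C (r *\<^sub>R x) = r *\<^sub>R (c *\<^sub>C x)" for r and x :: 'a
    by (simp add: scaleR_scaleC scaleC_scaleC mult.commute)
qed (auto simp: scaleC_add_right norm_scaleC mult.commute)

lemma cinner_conv_inner:
  fixes x y :: "'a::complex_inner"
  shows "cinner x y = Complex (inner x y) (inner ((- \<i>) *\<^sub>C x) y)"
  by (rule complex_eqI) (simp_all add: Re_cinner[symmetric] cinner_scaleC_left)

lemma cinner_conv_inner':
  fixes x y :: "'a::complex_inner"
  shows "cinner x y = of_real (inner x y) + \<i> * of_real (inner ((- \<i>) *\<^sub>C x) y)"
  by (simp add: cinner_conv_inner complex_eq_iff)

lemma norm_cinner_le: "cmod (cinner x y) \<le> 2 * (norm x * norm (y :: 'a::complex_inner))"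
proof -
  have "cmod (cinner x y) \<le> \<bar>inner x y\<bar> + \<bar>inner ((- \<i>) *\<^sub>C x) y\<bar>"
    using cmod_le[of "cinner x y"] by (simp add: cinner_conv_inner)
  then show ?thesis
    using Cauchy_Schwarz_ineq2[of x y] Cauchy_Schwarz_ineq2[of "(- \<i>) *\<^sub>C x" y]
    by (simp add: norm_scaleC)
qed

section \<open>The space of square integrable functions on the line\<close>

definition square_integrable :: "(real \<Rightarrow> 'h::{complex_inner, second_countable_topology}) \<Rightarrow> bool"
  where "square_integrable f \<longleftrightarrow>
    f \<in> borel_measurable lborel \<and> integrable lborel (\<lambda>t. (norm (f t))\<^sup>2)"

lemma square_integrable_zero: "square_integrable (\<lambda>_. 0)"
  by (simp add: square_integrable_def)

lemma square_integrable_scaleC: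
  assumes "square_integrable f" shows "square_integrable (\<lambda>t. c *\<^sub>C f t)"
  using assms borel_measurable_continuous_onI[OF bounded_linear.continuous_on[OF
        bounded_linear_scaleC[of c] continuous_on_id]]
  by (auto simp: square_integrable_def norm_scaleC power_mult_distrib
      intro: measurable_compose)

lemma square_integrable_scaleR:
  "square_integrable f \<Longrightarrow> square_integrable (\<lambda>t. r *\<^sub>R f t)"
  by (simp add: scaleR_scaleC square_integrable_scaleC)

lemma square_integrable_minus: "square_integrable f \<Longrightarrow> square_integrable (\<lambda>t. - f t)"
  by (simp add: square_integrable_def)

lemma square_integrable_norm_mult:
  assumes f: "square_integrable f" and g: "square_integrable g"
  shows "integrable lborel (\<lambda>t. norm (f t) * norm (g t))"
proof (rule Bochner_Integration.integrable_bound)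
  show "integrable lborel (\<lambda>t. (norm (f t))\<^sup>2 + (norm (g t))\<^sup>2)"
    using f g by (auto simp: square_integrable_def)
  show "(\<lambda>t. norm (f t) * norm (g t)) \<in> borel_measurable lborel"
    using f g by (auto simp: square_integrable_def)
  have "norm (f t) * norm (g t) \<le> (norm (f t))\<^sup>2 + (norm (g t))\<^sup>2" for t
  proof -
    have "2 * (norm (f t) * norm (g t)) \<le> (norm (f t))\<^sup>2 + (norm (g t))\<^sup>2"
      using sum_squares_bound[of "norm (f t)" "norm (g t)"] by (simp add: mult.assoc)
    moreover have "0 \<le> norm (f t) * norm (g t)" by simp
    ultimately show ?thesis by linarith
  qed
  then show "AE t in lborel.
      norm (norm (f t) * norm (g t)) \<le> norm ((norm (f t))\<^sup>2 + (norm (g t))\<^sup>2)"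
    by simp
qed

lemma square_integrable_add:
  assumes f: "square_integrable f" and g: "square_integrable g"
  shows "square_integrable (\<lambda>t. f t + g t)"
  unfolding square_integrable_def
proof
  show m: "(\<lambda>t. f t + g t) \<in> borel_measurable lborel"
    using f g by (auto simp: square_integrable_def)
  have "(norm (f t + g t))\<^sup>2 \<le> (norm (f t) + norm (g t))\<^sup>2" for t
    by (simp add: norm_triangle_ineq power_mono)
  then have "(norm (f t + g t))\<^sup>2
      \<le> (norm (f t))\<^sup>2 + (norm (g t))\<^sup>2 + 2 * (norm (f t) * norm (g t))" for t
    by (simp add: power2_sum mult.assoc)
  then have "AE t in lborel. norm ((norm (f t + g t))\<^sup>2)
      \<le> norm ((norm (f t))\<^sup>2 + (norm (g t))\<^sup>2 + 2 * (norm (f t) * norm (g t)))"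
    by simp
  moreover have "integrable lborel
      (\<lambda>t. (norm (f t))\<^sup>2 + (norm (g t))\<^sup>2 + 2 * (norm (f t) * norm (g t)))"
    using f g square_integrable_norm_mult[OF f g]
    by (intro Bochner_Integration.integrable_add integrable_mult_right)
      (auto simp: square_integrable_def)
  moreover have "(\<lambda>t. (norm (f t + g t))\<^sup>2) \<in> borel_measurable lborel"
    using m by simp
  ultimately show "integrable lborel (\<lambda>t. (norm (f t + g t))\<^sup>2)"
    by (metis (no_types) Bochner_Integration.integrable_bound)
qed

lemma square_integrable_diff:
  "square_integrable f \<Longrightarrow> square_integrable g \<Longrightarrow> square_integrable (\<lambda>t. f t - g t)"
  using square_integrable_add[of f "\<lambda>t. - g t"] square_integrable_minus[of g] by simp

lemma integrable_inner_square_integrable: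
  assumes f: "square_integrable f" and g: "square_integrable g"
  shows "integrable lborel (\<lambda>t. inner (f t) (g t))"
proof (rule Bochner_Integration.integrable_bound[OF square_integrable_norm_mult[OF f g]])
  show "(\<lambda>t. inner (f t) (g t)) \<in> borel_measurable lborel"
    using f g by (auto simp: square_integrable_def)
qed (simp add: Cauchy_Schwarz_ineq2)

lemma integrable_cinner_square_integrable:
  assumes f: "square_integrable f" and g: "square_integrable g"
  shows "integrable lborel (\<lambda>t. cinner (f t) (g t))"
  unfolding cinner_conv_inner'
  by (intro Bochner_Integration.integrable_add integrable_mult_right integrable_of_real
      integrable_inner_square_integrable square_integrable_scaleC f g)

definition L2_rel ::
  "(real \<Rightarrow> 'h::{complex_inner, second_countable_topology}) \<Rightarrow> (real \<Rightarrow> 'h) \<Rightarrow> bool" where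
  "L2_rel f g \<longleftrightarrow> square_integrable f \<and> square_integrable g \<and> (AE t in lborel. f t = g t)"

quotient_type (overloaded) 'h L2 =
  "real \<Rightarrow> 'h::{complex_inner, second_countable_topology}" / partial: L2_rel
proof (rule part_equivpI)
  show "\<exists>f. L2_rel f f"
    by (rule exI[of _ "\<lambda>_. 0"]) (simp add: L2_rel_def square_integrable_zero)
  show "symp L2_rel"
    by (rule sympI) (auto simp: L2_rel_def)
  show "transp L2_rel"
    by (rule transpI) (auto simp: L2_rel_def)
qed

instantiation L2 :: ("{complex_inner, second_countable_topology}") real_vector
begin

lift_definition zero_L2 :: "'a L2" is "\<lambda>_. 0"
  by (simp add: L2_rel_def square_integrable_zero)
lift_definition plus_L2 :: "'a L2 \<Rightarrow> 'a L2 \<Rightarrow> 'a L2" is "\<lambda>f g t. f t + g t"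
  by (auto simp: L2_rel_def square_integrable_add)
lift_definition minus_L2 :: "'a L2 \<Rightarrow> 'a L2 \<Rightarrow> 'a L2" is "\<lambda>f g t. f t - g t"
  by (auto simp: L2_rel_def square_integrable_diff)
lift_definition uminus_L2 :: "'a L2 \<Rightarrow> 'a L2" is "\<lambda>f t. - f t"
  by (auto simp: L2_rel_def square_integrable_minus)
lift_definition scaleR_L2 :: "real \<Rightarrow> 'a L2 \<Rightarrow> 'a L2" is "\<lambda>r f t. r *\<^sub>R f t"
  by (auto simp: L2_rel_def square_integrable_scaleR)

instance
proof
  fix x y z :: "'a L2" and r s :: real
  show "x + y + z = x + (y + z)"
    by transfer (auto simp: L2_rel_def add.assoc intro!: square_integrable_add)
  show "x + y = y + x"
    by transfer (auto simp: L2_rel_def add.commute intro!: square_integrable_add)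
  show "0 + x = x"
    by transfer (auto simp: L2_rel_def)
  show "- x + x = 0"
    by transfer (auto simp: L2_rel_def square_integrable_zero)
  show "x - y = x + - y"
    by transfer (auto simp: L2_rel_def square_integrable_diff)
  show "r *\<^sub>R (x + y) = r *\<^sub>R x + r *\<^sub>R y"
    by transfer (auto simp: L2_rel_def scaleR_add_right
        intro!: square_integrable_add square_integrable_scaleR)
  show "(r + s) *\<^sub>R x = r *\<^sub>R x + s *\<^sub>R x"
    by transfer (auto simp: L2_rel_def scaleR_add_left
        intro!: square_integrable_add square_integrable_scaleR)
  show "r *\<^sub>R s *\<^sub>R x = (r * s) *\<^sub>R x"
    by transfer (auto simp: L2_rel_def intro!: square_integrable_scaleR)
  show "1 *\<^sub>R x = x"
    by transfer (auto simp: L2_rel_def)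
qed

end

instantiation L2 :: ("{complex_inner, second_countable_topology}") complex_inner
begin

lift_definition scaleC_L2 :: "complex \<Rightarrow> 'a L2 \<Rightarrow> 'a L2" is "\<lambda>c f t. c *\<^sub>C f t"
  by (auto simp: L2_rel_def square_integrable_scaleC)
lift_definition inner_L2 :: "'a L2 \<Rightarrow> 'a L2 \<Rightarrow> real" is
  "\<lambda>f g. integral\<^sup>L lborel (\<lambda>t. inner (f t) (g t))"
  by (rule integral_cong_AE)
    (auto simp: L2_rel_def square_integrable_def)
lift_definition cinner_L2 :: "'a L2 \<Rightarrow> 'a L2 \<Rightarrow> complex" is
  "\<lambda>f g. integral\<^sup>L lborel (\<lambda>t. cinner (f t) (g t))"
  by (rule integral_cong_AE)
    (auto simp only: L2_rel_def
      intro: borel_measurable_integrable integrable_cinner_square_integrable)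

definition norm_L2 :: "'a L2 \<Rightarrow> real" where "norm_L2 x = sqrt (inner x x)"
definition sgn_L2 :: "'a L2 \<Rightarrow> 'a L2" where "sgn_L2 x = x /\<^sub>R norm x"
definition dist_L2 :: "'a L2 \<Rightarrow> 'a L2 \<Rightarrow> real" where "dist_L2 x y = norm (x - y)"
definition uniformity_L2 :: "('a L2 \<times> 'a L2) filter" where
  "uniformity_L2 = (INF e\<in>{0<..}. principal {(x, y). dist x y < e})"
definition open_L2 :: "'a L2 set \<Rightarrow> bool" where
  "open_L2 U = (\<forall>x\<in>U. \<forall>\<^sub>F (x', y) in uniformity. x' = x \<longrightarrow> y \<in> U)"

instance
proof
  fix x y z :: "'a L2" and r :: real and c d :: complex
  show "dist x y = norm (x - y)" by (rule dist_L2_def)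
  show "sgn x = x /\<^sub>R norm x" by (rule sgn_L2_def)
  show "(uniformity :: ('a L2 \<times> 'a L2) filter)
      = (INF e\<in>{0<..}. principal {(x, y). dist x y < e})"
    by (rule uniformity_L2_def)
  show "open U = (\<forall>x\<in>U. \<forall>\<^sub>F (x', y) in uniformity. x' = x \<longrightarrow> y \<in> U)"
    for U :: "'a L2 set" by (rule open_L2_def)
  show "inner x y = inner y x"
    by transfer (simp add: inner_commute)
  show "inner (x + y) z = inner x z + inner y z"
    by transfer (simp add: L2_rel_def inner_add_left integrable_inner_square_integrable)
  show "inner (r *\<^sub>R x) y = r * inner x y"
    by transfer simp
  show "0 \<le> inner x x"
    by transfer simp
  show "inner x x = 0 \<longleftrightarrow> x = 0"
  proof transfer
    fix f :: "real \<Rightarrow> 'a" assume "L2_rel f f"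
    then have f: "square_integrable f" by (simp add: L2_rel_def)
    have "(integral\<^sup>L lborel (\<lambda>t. inner (f t) (f t)) = 0) \<longleftrightarrow> (AE t in lborel. inner (f t) (f t) = 0)"
      by (rule integral_nonneg_eq_0_iff_AE[OF integrable_inner_square_integrable[OF f f]]) simp
    then show "(integral\<^sup>L lborel (\<lambda>t. inner (f t) (f t)) = 0) = L2_rel f (\<lambda>_. 0)"
      using f by (simp add: L2_rel_def square_integrable_zero)
  qed
  show "norm x = sqrt (inner x x)" by (rule norm_L2_def)
  show "c *\<^sub>C (x + y) = c *\<^sub>C x + c *\<^sub>C y"
    by transfer (auto simp: L2_rel_def scaleC_add_right
        intro!: square_integrable_add square_integrable_scaleC)
  show "(c + d) *\<^sub>C x = c *\<^sub>C x + d *\<^sub>C x"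
    by transfer (auto simp: L2_rel_def scaleC_add_left
        intro!: square_integrable_add square_integrable_scaleC)
  show "c *\<^sub>C d *\<^sub>C x = (c * d) *\<^sub>C x"
    by transfer (auto simp: L2_rel_def scaleC_scaleC intro!: square_integrable_scaleC)
  show "r *\<^sub>R x = complex_of_real r *\<^sub>C x"
    by transfer (auto simp: L2_rel_def scaleR_scaleC intro!: square_integrable_scaleC)
  show "cinner x y = cnj (cinner y x)"
  proof transfer
    fix f g :: "real \<Rightarrow> 'a"
    have "(\<lambda>t. cinner (f t) (g t)) = (\<lambda>t. cnj (cinner (g t) (f t)))"
      by (rule ext) (rule cinner_commute)
    then show "integral\<^sup>L lborel (\<lambda>t. cinner (f t) (g t))
        = cnj (integral\<^sup>L lborel (\<lambda>t. cinner (g t) (f t)))"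
      by simp
  qed
  show "cinner (x + y) z = cinner x z + cinner y z"
    by transfer (simp add: L2_rel_def cinner_add_left integrable_cinner_square_integrable)
  show "cinner (c *\<^sub>C x) y = c * cinner x y"
    by transfer (simp add: cinner_scaleC_left)
  show "Re (cinner x y) = inner x y"
  proof transfer
    fix f g :: "real \<Rightarrow> 'a" assume "L2_rel f f" "L2_rel g g"
    then have "integrable lborel (\<lambda>t. cinner (f t) (g t))"
      by (simp add: L2_rel_def integrable_cinner_square_integrable)
    from integral_Re[OF this]
    show "Re (integral\<^sup>L lborel (\<lambda>t. cinner (f t) (g t))) = integral\<^sup>L lborel (\<lambda>t. inner (f t) (g t))"
      by (simp add: Re_cinner)
  qed
qed

end

text \<open>
  \<open>L\<^sub>2(H, I)\<close> is realised inside \<open>L\<^sub>2(H, \<real>)\<close> by extending functions by zero.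
\<close>

definition L2_on :: "real set \<Rightarrow> 'h::{complex_inner, second_countable_topology} L2 set" where
  "L2_on I = {u. AE t in lborel. t \<notin> I \<longrightarrow> rep_L2 u t = 0}"


section \<open>Operators in a Hilbert space\<close>

text \<open>
  An operator is identified with its graph. The first argument \<open>X\<close> of the notions below is the
  Hilbert space in which the operator acts, a complex subspace of the ambient type.
\<close>

definition complex_subspace :: "'x::complex_inner set \<Rightarrow> bool" where
  "complex_subspace S \<longleftrightarrow>
    0 \<in> S \<and> (\<forall>x\<in>S. \<forall>y\<in>S. x + y \<in> S) \<and> (\<forall>c. \<forall>x\<in>S. c *\<^sub>C x \<in> S)"

definition linear_operator :: "'x::complex_inner set \<Rightarrow> ('x \<times> 'x) set \<Rightarrow> bool" where
  "linear_operator X T \<longleftrightarrow> T \<subseteq> X \<times> X \<and> complex_subspace T \<and> single_valued T"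

definition densely_defined :: "'x::complex_inner set \<Rightarrow> ('x \<times> 'x) set \<Rightarrow> bool" where
  "densely_defined X T \<longleftrightarrow> X \<subseteq> closure (Domain T)"

definition adjoint_op :: "'x::complex_inner set \<Rightarrow> ('x \<times> 'x) set \<Rightarrow> ('x \<times> 'x) set" where
  "adjoint_op X T = {(v, w). v \<in> X \<and> w \<in> X \<and> (\<forall>(u, z) \<in> T. cinner z v = cinner u w)}"

definition selfadjoint :: "'x::complex_inner set \<Rightarrow> ('x \<times> 'x) set \<Rightarrow> bool" where
  "selfadjoint X T \<longleftrightarrow> linear_operator X T \<and> densely_defined X T \<and> adjoint_op X T = T"

definition formally_normal :: "'x::complex_inner set \<Rightarrow> ('x \<times> 'x) set \<Rightarrow> bool" where
  "formally_normal X N \<longleftrightarrow>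
    linear_operator X N \<and> densely_defined X N \<and> closed N \<and>
    Domain N \<subseteq> Domain (adjoint_op X N) \<and>
    (\<forall>f g h. (f, g) \<in> N \<and> (f, h) \<in> adjoint_op X N \<longrightarrow> norm g = norm h)"

definition normal_op :: "'x::complex_inner set \<Rightarrow> ('x \<times> 'x) set \<Rightarrow> bool" where
  "normal_op X N \<longleftrightarrow> formally_normal X N \<and> Domain N = Domain (adjoint_op X N)"

definition normal_extension ::
  "'x::complex_inner set \<Rightarrow> ('x \<times> 'x) set \<Rightarrow> ('x \<times> 'x) set \<Rightarrow> bool" where
  "normal_extension X T N \<longleftrightarrow> normal_op X N \<and> T \<subseteq> N"

text \<open>For a selfadjoint \<open>T\<close> the form \<open>\<langle>T x, x\<rangle>\<close> is real, so \<open>Re\<close> loses nothing.\<close>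

definition nonneg_op :: "('x::complex_inner \<times> 'x) set \<Rightarrow> bool" where
  "nonneg_op T \<longleftrightarrow> (\<forall>(x, y) \<in> T. 0 \<le> Re (cinner y x))"

definition nonpos_op :: "('x::complex_inner \<times> 'x) set \<Rightarrow> bool" where
  "nonpos_op T \<longleftrightarrow> (\<forall>(x, y) \<in> T. Re (cinner y x) \<le> 0)"

definition neg_op :: "('x::complex_inner \<times> 'x) set \<Rightarrow> ('x \<times> 'x) set" where
  "neg_op T = {(x, - y) | x y. (x, y) \<in> T}"

definition ker_op :: "('x::complex_inner \<times> 'x) set \<Rightarrow> 'x set" where
  "ker_op T = {x. (x, 0) \<in> T}"

text \<open>
  \<open>is_sqrt_op X S B\<close> says \<open>S = B\<^sup>1\<^sup>/\<^sup>2\<close>. Every nonnegative selfadjoint \<open>B\<close> in a Hilbert space has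
  exactly one nonnegative selfadjoint square root; \<open>S O S\<close> is the operator \<open>x \<mapsto> S (S x)\<close> on its
  natural domain.
\<close>

definition is_sqrt_op ::
  "'x::complex_inner set \<Rightarrow> ('x \<times> 'x) set \<Rightarrow> ('x \<times> 'x) set \<Rightarrow> bool" where
  "is_sqrt_op X S B \<longleftrightarrow> selfadjoint X S \<and> nonneg_op S \<and> S O S = B"

definition unitary_op :: "('h::complex_inner \<Rightarrow> 'h) \<Rightarrow> bool" where
  "unitary_op W \<longleftrightarrow>
    (\<forall>x y. W (x + y) = W x + W y) \<and> (\<forall>c x. W (c *\<^sub>C x) = c *\<^sub>C W x) \<and>
    (\<forall>x y. cinner (W x) (W y) = cinner x y) \<and> surj W"

definition direct_sum_op :: "('x \<times> 'x) set \<Rightarrow> ('y \<times> 'y) set \<Rightarrow> (('x \<times> 'y) \<times> ('x \<times> 'y)) set" where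
  "direct_sum_op T1 T2 = {((u1, u2), (w1, w2)) | u1 u2 w1 w2. (u1, w1) \<in> T1 \<and> (u2, w2) \<in> T2}"


section \<open>Test functions and the Sobolev space\<close>

definition smooth :: "(real \<Rightarrow> complex) \<Rightarrow> bool" where
  "smooth \<phi> \<longleftrightarrow> (\<exists>D :: nat \<Rightarrow> real \<Rightarrow> complex. D 0 = \<phi> \<and>
    (\<forall>n t. (D n has_vector_derivative D (Suc n) t) (at t)))"

definition test_functions :: "real set \<Rightarrow> (real \<Rightarrow> complex) set" where
  "test_functions I =
    {\<phi>. smooth \<phi> \<and> compact (closure {t. \<phi> t \<noteq> 0}) \<and> closure {t. \<phi> t \<noteq> 0} \<subseteq> I}"

abbreviation vderiv :: "(real \<Rightarrow> complex) \<Rightarrow> real \<Rightarrow> complex" where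
  "vderiv \<phi> t \<equiv> vector_derivative \<phi> (at t)"

definition weak_derivative ::
  "real set \<Rightarrow> 'h::{complex_inner, banach, second_countable_topology} L2 \<Rightarrow> 'h L2 \<Rightarrow> bool" where
  "weak_derivative I u v \<longleftrightarrow> (\<forall>\<phi> \<in> test_functions I.
    integral\<^sup>L lborel (\<lambda>t. vderiv \<phi> t *\<^sub>C rep_L2 u t) = - integral\<^sup>L lborel (\<lambda>t. \<phi> t *\<^sub>C rep_L2 v t))"

definition W21 :: "real set \<Rightarrow> 'h::{complex_inner, banach, second_countable_topology} L2 set" where
  "W21 I = {u \<in> L2_on I. \<exists>v \<in> L2_on I. weak_derivative I u v}"

text \<open>The inclusion \<open>B W\<^sub>2\<^sup>1(H, I) \<subseteq> W\<^sub>2\<^sup>1(H, I)\<close>, with \<open>B\<close> acting pointwise almost everywhere.\<close>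

definition preserves_W21 ::
  "('h::{complex_inner, banach, second_countable_topology} \<times> 'h) set \<Rightarrow> real set \<Rightarrow> bool" where
  "preserves_W21 B I \<longleftrightarrow>
    (\<forall>u \<in> W21 I. \<exists>w \<in> W21 I. AE t in lborel. t \<in> I \<longrightarrow> (rep_L2 u t, rep_L2 w t) \<in> B)"

text \<open>
  \<open>x\<close> is the value at the point \<open>c\<close> of \<open>closure I\<close> of the representative of \<open>u\<close> that is continuous
  on \<open>closure I\<close>. For an interval \<open>I\<close> of positive length there is at most one such \<open>x\<close>.
\<close>

definition has_boundary_value ::
  "real set \<Rightarrow> 'h::{complex_inner, second_countable_topology} L2 \<Rightarrow> real \<Rightarrow> 'h \<Rightarrow> bool" where
  "has_boundary_value I u c x \<longleftrightarrow> (\<exists>f. continuous_on (closure I) f \<and> f c = x \<and>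
    (AE t in lborel. t \<in> I \<longrightarrow> rep_L2 u t = f t))"


section \<open>Minimal and maximal operators\<close>

text \<open>
  The sign \<open>s\<close> treats \<open>u' + A u\<close> (\<open>s = 1\<close>) and the formally adjoint expression \<open>- v' + A v\<close>
  (\<open>s = -1\<close>) together. In \<open>pre_minimal\<close> the vectors \<open>g j\<close> are the values \<open>A (f j)\<close>.
\<close>

definition pre_minimal ::
  "real \<Rightarrow> real set \<Rightarrow> ('h::{complex_inner, second_countable_topology} \<times> 'h) set
    \<Rightarrow> ('h L2 \<times> 'h L2) set" where
  "pre_minimal s I A =
    {(abs_L2 (\<lambda>t. \<Sum>j<n. \<phi> j t *\<^sub>C f j),
      abs_L2 (\<lambda>t. \<Sum>j<n. s *\<^sub>R (vderiv (\<phi> j) t *\<^sub>C f j) + \<phi> j t *\<^sub>C g j))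
     | (n :: nat) \<phi> f g. \<forall>j<n. \<phi> j \<in> test_functions I \<and> (f j, g j) \<in> A}"

definition minimal_op ::
  "real set \<Rightarrow> ('h::{complex_inner, second_countable_topology} \<times> 'h) set \<Rightarrow> ('h L2 \<times> 'h L2) set" where
  "minimal_op I A = closure (pre_minimal 1 I A)"

definition minimal_adj_op ::
  "real set \<Rightarrow> ('h::{complex_inner, second_countable_topology} \<times> 'h) set \<Rightarrow> ('h L2 \<times> 'h L2) set" where
  "minimal_adj_op I A = closure (pre_minimal (-1) I A)"

definition maximal_op ::
  "real set \<Rightarrow> ('h::{complex_inner, second_countable_topology} \<times> 'h) set \<Rightarrow> ('h L2 \<times> 'h L2) set" where
  "maximal_op I A = adjoint_op (L2_on I) (minimal_adj_op I A)"

definition L2_sum ::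
  "real \<Rightarrow> real \<Rightarrow> ('h::{complex_inner, second_countable_topology} L2 \<times> 'h L2) set" where
  "L2_sum a b = L2_on {..<a} \<times> L2_on {b<..}"

definition L_min ::
  "real \<Rightarrow> real \<Rightarrow> ('h::{complex_inner, second_countable_topology} \<times> 'h) set \<Rightarrow> ('h \<times> 'h) set
    \<Rightarrow> (('h L2 \<times> 'h L2) \<times> ('h L2 \<times> 'h L2)) set" where
  "L_min a b A1 A2 = direct_sum_op (minimal_op {..<a} A1) (minimal_op {b<..} A2)"

definition L_max ::
  "real \<Rightarrow> real \<Rightarrow> ('h::{complex_inner, second_countable_topology} \<times> 'h) set \<Rightarrow> ('h \<times> 'h) set
    \<Rightarrow> (('h L2 \<times> 'h L2) \<times> ('h L2 \<times> 'h L2)) set" where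
  "L_max a b A1 A2 = direct_sum_op (maximal_op {..<a} A1) (maximal_op {b<..} A2)"

text \<open>
  The restriction of \<open>L\<close> to the boundary condition given by \<open>W\<close>. Here \<open>S1\<close> and \<open>S2\<close> stand for the
  square roots of \<open>- A1\<close> and \<open>A2\<close>. Membership requires the two boundary values to exist.
\<close>

definition L_W ::
  "real \<Rightarrow> real \<Rightarrow> ('h::{complex_inner, second_countable_topology} \<times> 'h) set \<Rightarrow> ('h \<times> 'h) set
    \<Rightarrow> ('h \<times> 'h) set \<Rightarrow> ('h \<times> 'h) set \<Rightarrow> ('h \<Rightarrow> 'h)
    \<Rightarrow> (('h L2 \<times> 'h L2) \<times> ('h L2 \<times> 'h L2)) set" where
  "L_W a b A1 A2 S1 S2 W =
    {((u1, u2), w) | u1 u2 w. ((u1, u2), w) \<in> L_max a b A1 A2 \<and>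
      (\<exists>x y. has_boundary_value {..<a} u1 a x \<and> has_boundary_value {b<..} u2 b y \<and>
        y = W x \<and> x \<in> ker_op S1 \<and> y \<in> ker_op S2)}"

end

theory Submission
  imports Defs
begin

text \<open>
  The inclusion hypotheses, applied to functions \<open>\<phi> \<otimes> x\<close> with a scalar cutoff \<open>\<phi>\<close>, show that the two square
  roots are everywhere defined. Hence so are \<open>A\<^sub>1\<close> and \<open>A\<^sub>2\<close>, and a symmetric everywhere defined
  operator in a Hilbert space is bounded (\<open>symmetric_imp_bounded_linear\<close>). With bounded \<open>A\<close> the maximal
  operator is completely explicit: \<open>u\<close> lies in its domain iff \<open>u \<in> W\<^sub>2\<^sup>1\<close>, and then it acts as
  \<open>u' + A u\<close> (\<open>maximal_op_iff\<close>). Elements of \<open>W\<^sub>2\<^sup>1\<close> are indefinite integrals of their weak derivatives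
  (\<open>weak_derivative_primitive\<close>), so they have boundary values and satisfy Green's formula, which on
  \<open>(-\<infinity>, a)\<close> and \<open>(b, \<infinity>)\<close> together reads

    \<open>\<langle>u', v\<rangle> + \<langle>u, v'\<rangle> = \<langle>u\<^sub>1(a), v\<^sub>1(a)\<rangle> - \<langle>u\<^sub>2(b), v\<^sub>2(b)\<rangle>\<close>.

  Let \<open>N\<close> be a normal extension. From \<open>L\<^sub>0 \<subseteq> N\<close> the adjoint \<open>N\<^sup>*\<close> is a restriction of the formally adjoint
  maximal operator; since test functions belong to \<open>D(N) = D(N\<^sup>*)\<close>, the adjoint also extends \<open>L\<^sub>0\<^sup>+\<close>, and
  therefore \<open>N \<subseteq> L\<close> (\<open>N_maximal\<close>). So \<open>N u = u' + A u\<close> and \<open>N\<^sup>* u = - u' + A u\<close> on one common domain.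
  Let \<open>G \<subseteq> H \<times> H\<close> be the set of all pairs \<open>(u\<^sub>1(a), u\<^sub>2(b))\<close> with \<open>u \<in> D(N)\<close>. Two facts determine it.

  \<^item> By Green's formula \<open>v\<close> belongs to \<open>D(N\<^sup>*)\<close> iff its boundary pair is orthogonal to \<open>G\<close> for the
    indefinite form \<open>\<langle>x, x'\<rangle> - \<langle>y, y'\<rangle>\<close>. As \<open>D(N) = D(N\<^sup>*)\<close>, the space \<open>G\<close> is its own orthogonal
    companion for this form. Such a space is the graph of a unitary operator \<open>W\<close>
    (\<open>neutral_relation_unitary\<close>), and \<open>u \<in> D(N)\<close> iff \<open>u\<^sub>2(b) = W u\<^sub>1(a)\<close>.
  \<^item> The equality \<open>\<parallel>N u\<parallel> = \<parallel>N\<^sup>* u\<parallel>\<close> says that \<open>u'\<close> and \<open>A u\<close> are orthogonal in the real inner product, and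
    Green's formula applied to \<open>u\<close> and \<open>A u\<close> turns this into \<open>\<langle>A\<^sub>1 x, x\<rangle> = \<langle>A\<^sub>2 y, y\<rangle>\<close> for \<open>(x, y) \<in> G\<close>
    (\<open>boundary_energy\<close>). The left side is nonpositive and the right side nonnegative, so both vanish,
    which places \<open>x\<close> and \<open>y\<close> in the kernels of the square roots.

  Since \<open>G\<close> is the graph of an operator defined on all of \<open>H\<close>, every \<open>x \<in> H\<close> is the value \<open>u\<^sub>1(a)\<close> of some
  \<open>u \<in> D(N)\<close>, and \<open>W x\<close> can be read off as \<open>u\<^sub>2(b)\<close>; this is why \<open>N\<close> determines \<open>W\<close>.
\<close>

section \<open>Smooth functions of compact support\<close>

text \<open>
  Smoothness asks for a whole tower of derivatives. Choosing a derivative inside \<open>C\<close> for each member of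
  \<open>C\<close> and iterating this choice builds the tower, so closure properties of smooth functions reduce to
  exhibiting a family that is closed under one differentiation.
\<close>

lemma smooth_closed_family:
  assumes "\<phi> \<in> C" and step: "\<And>g. g \<in> C \<Longrightarrow> \<exists>g'\<in>C. \<forall>t. (g has_vector_derivative g' t) (at t)"
  shows "smooth \<phi>"
proof -
  obtain d where d: "\<And>g. g \<in> C \<Longrightarrow> d g \<in> C \<and> (\<forall>t. (g has_vector_derivative d g t) (at t))"
    using step by metis
  have inC: "(d ^^ n) \<phi> \<in> C" for n
    by (induction n) (use assms d in auto)
  show ?thesis
    unfolding smooth_def
    by (rule exI[of _ "\<lambda>n. (d ^^ n) \<phi>"]) (use inC d in auto)
qed

lemma smooth_derivative:
  assumes "smooth \<phi>"
  obtains \<phi>' where "smooth \<phi>'" "\<And>t. (\<phi> has_vector_derivative \<phi>' t) (at t)"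
proof -
  obtain D where D: "D 0 = \<phi>" "\<And>n t. (D n has_vector_derivative D (Suc n) t) (at t)"
    using assms unfolding smooth_def by blast
  have "smooth (D 1)"
    unfolding smooth_def by (rule exI[of _ "\<lambda>n. D (Suc n)"]) (use D in auto)
  then show ?thesis using that[of "D 1"] D(2)[of 0] D(1) by auto
qed

lemma smooth_antiderivative:
  assumes "smooth \<theta>" "\<And>t. (\<phi> has_vector_derivative \<theta> t) (at t)"
  shows "smooth \<phi>"
proof (rule smooth_closed_family[where C = "insert \<phi> (Collect smooth)"])
  fix g assume "g \<in> insert \<phi> (Collect smooth)"
  then show "\<exists>g'\<in>insert \<phi> (Collect smooth). \<forall>t. (g has_vector_derivative g' t) (at t)"
  proof
    assume "g \<in> Collect smooth"
    then show ?thesis using smooth_derivative[of g] by auto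
  qed (use assms in auto)
qed simp

lemma smooth_continuous: "smooth \<phi> \<Longrightarrow> continuous_on S \<phi>"
  using smooth_derivative[of \<phi>] has_vector_derivative_continuous
  by (metis continuous_at_imp_continuous_on)

text \<open>
  The derivative of a product is a sum of two products, so the products of smooth functions become
  closed under differentiation once finite sums are added.
\<close>

inductive_set product_sums :: "(real \<Rightarrow> complex) set" where
  product: "smooth f \<Longrightarrow> smooth g \<Longrightarrow> (\<lambda>t. f t * g t) \<in> product_sums"
| sum: "u \<in> product_sums \<Longrightarrow> v \<in> product_sums \<Longrightarrow> (\<lambda>t. u t + v t) \<in> product_sums"

lemma smooth_product_sums: "u \<in> product_sums \<Longrightarrow> smooth u"
proof (erule smooth_closed_family)
  fix g assume "g \<in> product_sums"
  then show "\<exists>g'\<in>product_sums. \<forall>t. (g has_vector_derivative g' t) (at t)"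
  proof induction
    case (product f g)
    obtain f' where f': "smooth f'" "\<And>t. (f has_vector_derivative f' t) (at t)"
      using smooth_derivative[OF product(1)] by metis
    obtain g' where g': "smooth g'" "\<And>t. (g has_vector_derivative g' t) (at t)"
      using smooth_derivative[OF product(2)] by metis
    show ?case
      by (rule bexI[of _ "\<lambda>t. f t * g' t + f' t * g t"])
        (use f' g' product in \<open>auto intro!: product_sums.intros has_vector_derivative_mult\<close>)
  next
    case (sum u v)
    then obtain u' v' where "u' \<in> product_sums" "v' \<in> product_sums"
      "\<And>t. (u has_vector_derivative u' t) (at t)" "\<And>t. (v has_vector_derivative v' t) (at t)"
      by metis
    then show ?case
      by (intro bexI[of _ "\<lambda>t. u' t + v' t"])
        (auto intro: product_sums.intros has_vector_derivative_add)
  qed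
qed

lemma smooth_const: "smooth (\<lambda>_. c)"
  by (rule smooth_closed_family[where C = "range (\<lambda>c _. c)"]) (auto intro!: exI[of _ 0])

lemma smooth_mult: "smooth f \<Longrightarrow> smooth g \<Longrightarrow> smooth (\<lambda>t. f t * g t)"
  by (simp add: product_sums.product smooth_product_sums)

lemma smooth_add: 
  assumes "smooth f" "smooth g" shows "smooth (\<lambda>t. f t + g t)"
proof -
  have "(\<lambda>t. f t * 1 + g t * 1) \<in> product_sums"
    by (intro product_sums.intros smooth_const assms)
  from smooth_product_sums[OF this] show ?thesis by simp
qed

lemma smooth_affine:
  assumes "smooth f" shows "smooth (\<lambda>t. f (c * t + d))"
proof (rule smooth_closed_family[where C = "{\<lambda>t. of_real k * g (c * t + d) | k g. smooth g}"])
  show "(\<lambda>t. f (c * t + d)) \<in> {\<lambda>t. of_real k * g (c * t + d) | k g. smooth g}"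
    using assms by (intro CollectI exI[of _ 1] exI[of _ f]) auto
  fix h assume "h \<in> {\<lambda>t. of_real k * g (c * t + d) | k g. smooth g}"
  then obtain k g where h: "h = (\<lambda>t. of_real k * g (c * t + d))" "smooth g" by auto
  then obtain g' where g': "smooth g'" "\<And>t. (g has_vector_derivative g' t) (at t)"
    using smooth_derivative[of g] by metis
  have "(h has_vector_derivative of_real (k * c) * g' (c * t + d)) (at t)" for t
  proof -
    have "((\<lambda>t. g (c * t + d)) has_vector_derivative c *\<^sub>R g' (c * t + d)) (at t)"
    proof -
      have "((\<lambda>t. c * t + d) has_vector_derivative c) (at t)"
        unfolding has_real_derivative_iff_has_vector_derivative[symmetric]
        by (auto intro!: derivative_eq_intros)
      from vector_diff_chain_at[OF this g'(2)] show ?thesis by (simp add: o_def)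
    qed
    from has_vector_derivative_mult_right[OF this, of "of_real k"] show ?thesis
      unfolding h by (simp add: scaleR_conv_of_real mult.assoc)
  qed
  then show "\<exists>g'\<in>{\<lambda>t. of_real k * g (c * t + d) | k g. smooth g}.
      \<forall>t. (h has_vector_derivative g' t) (at t)"
    using g'(1) by (intro bexI[of _ "\<lambda>t. of_real (k * c) * g' (c * t + d)"] CollectI) blast+
qed

lemma smooth_cnj:
  assumes "smooth f" shows "smooth (\<lambda>t. cnj (f t))"
proof (rule smooth_closed_family[where C = "{\<lambda>t. cnj (g t) | g. smooth g}"])
  fix h assume "h \<in> {\<lambda>t. cnj (g t) | g. smooth g}"
  then show "\<exists>g'\<in>{\<lambda>t. cnj (g t) | g. smooth g}. \<forall>t. (h has_vector_derivative g' t) (at t)"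
    using smooth_derivative has_vector_derivative_cnj by (clarsimp) (metis)
qed (use assms in auto)

text \<open>
  The \<open>n\<close>-th derivative of \<open>exp (- 1 / t)\<close> on \<open>t > 0\<close> is this polynomial at \<open>1 / t\<close> times \<open>exp (- 1 / t)\<close>.
\<close>

fun flat_poly :: "nat \<Rightarrow> real poly" where
  "flat_poly 0 = 1"
| "flat_poly (Suc n) = [:0, 0, 1:] * (flat_poly n - pderiv (flat_poly n))"

definition flat_fun :: "real poly \<Rightarrow> real \<Rightarrow> real" where
  "flat_fun p t = (if t > 0 then poly p (1 / t) * exp (- (1 / t)) else 0)"

lemma poly_times_exp_minus_tendsto_0: "((\<lambda>x. poly p x * exp (- x)) \<longlongrightarrow> (0::real)) at_top"
proof -
  have "((\<lambda>x. \<Sum>i\<le>degree p. coeff p i * (x ^ i / exp x)) \<longlongrightarrow> (\<Sum>i\<le>degree p. coeff p i * 0)) at_top"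
    by (intro tendsto_intros tendsto_power_div_exp_0)
  then show ?thesis
    by (simp add: poly_altdef sum_distrib_right exp_minus field_simps sum_divide_distrib)
qed

lemma flat_fun_tendsto_0: "(flat_fun p \<longlongrightarrow> 0) (at 0)"
proof (rule filterlim_split_at)
  show "(flat_fun p \<longlongrightarrow> 0) (at_left 0)"
    by (rule Lim_transform_eventually[OF tendsto_const])
      (auto simp: flat_fun_def eventually_at_filter)
  have "((\<lambda>t. poly p (inverse t) * exp (- (inverse t))) \<longlongrightarrow> 0) (at_right (0::real))"
    by (rule filterlim_compose[OF poly_times_exp_minus_tendsto_0 filterlim_inverse_at_top_right])
  then show "(flat_fun p \<longlongrightarrow> 0) (at_right 0)"
    by (rule Lim_transform_eventually)
      (auto simp: flat_fun_def eventually_at_filter field_simps)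
qed

text \<open>
  Away from the origin this is the chain rule. At the origin the difference quotient of \<open>flat_fun p\<close> is
  \<open>flat_fun\<close> of the polynomial \<open>x * p\<close>, which tends to zero because the exponential beats any power.
\<close>

lemma flat_fun_deriv:
  "(flat_fun p has_real_derivative flat_fun ([:0, 0, 1:] * (p - pderiv p)) t) (at t)"
proof (cases t "0::real" rule: linorder_cases)
  case less
  have "((\<lambda>_. 0) has_real_derivative flat_fun ([:0, 0, 1:] * (p - pderiv p)) t) (at t)"
    using less by (simp add: flat_fun_def)
  then show ?thesis
    by (rule has_field_derivative_transform_within_open[where S = "{..<0}"])
      (use less in \<open>auto simp: flat_fun_def\<close>)
next
  case equal
  have "((\<lambda>h. flat_fun ([:0, 1:] * p) h) \<longlongrightarrow> 0) (at 0)"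
    by (rule flat_fun_tendsto_0)
  then have "((\<lambda>h. (flat_fun p (0 + h) - flat_fun p 0) / h) \<longlongrightarrow> 0) (at 0)"
    by (rule Lim_transform_eventually)
      (auto simp: flat_fun_def eventually_at_filter field_simps)
  then show ?thesis
    using equal by (simp add: DERIV_def flat_fun_def)
next
  case greater
  have "((\<lambda>t. poly p (1 / t) * exp (- (1 / t))) has_real_derivative
      flat_fun ([:0, 0, 1:] * (p - pderiv p)) t) (at t)"
    using greater
    by (auto intro!: derivative_eq_intros DERIV_chain'[OF _ poly_DERIV]
      simp: flat_fun_def power2_eq_square field_simps)
  then show ?thesis
    by (rule has_field_derivative_transform_within_open[where S = "{0<..}"])
      (use greater in \<open>auto simp: flat_fun_def\<close>)
qed

lemma smooth_flat: "smooth (\<lambda>t. of_real (flat_fun 1 t))"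
  unfolding smooth_def
proof (intro exI[of _ "\<lambda>n t. of_real (flat_fun (flat_poly n) t)"] conjI allI)
  fix n t
  show "((\<lambda>t. of_real (flat_fun (flat_poly n) t)) has_vector_derivative
      complex_of_real (flat_fun (flat_poly (Suc n)) t)) (at t)"
    using flat_fun_deriv[of "flat_poly n" t] 
    by (auto simp: has_real_derivative_iff_has_vector_derivative intro!: has_vector_derivative_of_real)
qed simp

text \<open>
  Rescaling both factors by \<open>n\<close> makes them converge to the indicators of half-lines, whence the bumps
  converge to the indicator of the interval while staying between 0 and 1.
\<close>

definition bump :: "real \<Rightarrow> real \<Rightarrow> nat \<Rightarrow> real \<Rightarrow> real" where
  "bump p q n t = flat_fun 1 (real (Suc n) * (t - p)) * flat_fun 1 (real (Suc n) * (q - t))"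

lemma bump_pos: "p < t \<Longrightarrow> t < q \<Longrightarrow> 0 < bump p q n t"
  by (simp add: bump_def flat_fun_def)

lemma bump_outside: "t \<le> p \<or> q \<le> t \<Longrightarrow> bump p q n t = 0"
  by (auto simp: bump_def flat_fun_def zero_less_mult_iff)

lemma bump_nonneg: "0 \<le> bump p q n t"
  by (simp add: bump_def flat_fun_def)

lemma bump_le_1: "bump p q n t \<le> 1"
  unfolding bump_def flat_fun_def by (auto intro!: mult_le_one)

lemma smooth_bump: "smooth (\<lambda>t. of_real (bump p q n t))"
  using smooth_mult[OF smooth_affine[OF smooth_flat, of "real (Suc n)" "- (real (Suc n) * p)"]
      smooth_affine[OF smooth_flat, of "- real (Suc n)" "real (Suc n) * q"]]
  unfolding bump_def by (simp add: algebra_simps)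

lemma flat_tendsto_1:
  assumes "x > 0" shows "(\<lambda>n. flat_fun 1 (real (Suc n) * x)) \<longlonglongrightarrow> 1"
proof -
  have "(\<lambda>n. exp (- (inverse (Suc n) / x))) \<longlonglongrightarrow> exp (- (0 / x))"
    by (intro tendsto_intros LIMSEQ_inverse_real_of_nat) (use assms in auto)
  then show ?thesis using assms by (simp add: flat_fun_def field_simps add_pos_nonneg)
qed

lemma bump_tendsto_indicator: "(\<lambda>n. bump p q n t) \<longlonglongrightarrow> indicat_real {p<..<q} t"
proof (cases "p < t \<and> t < q")
  case True
  then have "(\<lambda>n. bump p q n t) \<longlonglongrightarrow> 1 * 1"
    unfolding bump_def by (intro tendsto_mult flat_tendsto_1) auto
  then show ?thesis using True by simp
next
  case False
  then show ?thesis by (auto simp: bump_outside)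
qed

lemma test_functionI:
  assumes "smooth \<phi>" "\<And>t. t \<notin> {p..q} \<Longrightarrow> \<phi> t = 0" "{p..q} \<subseteq> I"
  shows "\<phi> \<in> test_functions I"
proof -
  have "{t. \<phi> t \<noteq> 0} \<subseteq> {p..q}" using assms(2) by blast
  then have "closure {t. \<phi> t \<noteq> 0} \<subseteq> {p..q}"
    by (rule closure_minimal) simp
  moreover from this have "compact (closure {t. \<phi> t \<noteq> 0})"
    by (meson closed_closure compact_Icc compact_Int_closed inf.absorb_iff2 compact_closure bounded_subset compact_imp_bounded closure_subset order_trans)
  ultimately show ?thesis using assms by (auto simp: test_functions_def)
qed

lemma bump_test_function: "{p..q} \<subseteq> I \<Longrightarrow> (\<lambda>t. of_real (bump p q n t)) \<in> test_functions I"
  by (rule test_functionI[OF smooth_bump]) (auto intro!: bump_outside)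

section \<open>The fundamental lemma of the calculus of variations\<close>

lemma scaleC_of_real: "of_real r *\<^sub>C x = r *\<^sub>R x"
  by (simp add: scaleR_scaleC)

lemma scaleC_zero_left: "0 *\<^sub>C x = 0"
  using scaleC_of_real[of 0 x] by simp

text \<open>
  Bumps approximate indicators, so by dominated convergence the integral of \<open>h\<close> over every interval
  inside \<open>I\<close> vanishes. Intervals generate the Borel sets and are closed under intersection; hence the
  integrals over all Borel subsets of such an interval vanish, and \<open>h\<close> is zero there.
\<close>

lemma fundamental_lemma:
  fixes h :: "real \<Rightarrow> 'h::{complex_inner, banach, second_countable_topology}"
  assumes "open I"
    and loc: "\<And>p q. {p..q} \<subseteq> I \<Longrightarrow> set_integrable lborel {p..q} h"
    and orth: "\<And>\<phi>. \<phi> \<in> test_functions I \<Longrightarrow> (LINT t|lborel. \<phi> t *\<^sub>C h t) = 0"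
  shows "AE t in lborel. t \<in> I \<longrightarrow> h t = 0"
proof -
  have interval: "(LINT t:{p<..<q}|lborel. h t) = 0" if "{p..q} \<subseteq> I" for p q
  proof -
    have int: "integrable lborel (\<lambda>t. indicat_real {p..q} t *\<^sub>R h t)"
      using loc[OF that] by (simp add: set_integrable_def)
    have "(\<lambda>n. LINT t|lborel. bump p q n t *\<^sub>R (indicat_real {p..q} t *\<^sub>R h t))
        \<longlonglongrightarrow> (LINT t|lborel. indicat_real {p<..<q} t *\<^sub>R (indicat_real {p..q} t *\<^sub>R h t))"
    proof (rule integral_dominated_convergence)
      show "integrable lborel (\<lambda>t. norm (indicat_real {p..q} t *\<^sub>R h t))"
        using int by (rule integrable_norm)
      show "AE t in lborel. (\<lambda>n. bump p q n t *\<^sub>R (indicat_real {p..q} t *\<^sub>R h t))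
          \<longlonglongrightarrow> indicat_real {p<..<q} t *\<^sub>R (indicat_real {p..q} t *\<^sub>R h t)"
        by (intro AE_I2 tendsto_scaleR bump_tendsto_indicator tendsto_const)
      show "AE t in lborel. norm (bump p q n t *\<^sub>R (indicat_real {p..q} t *\<^sub>R h t))
          \<le> norm (indicat_real {p..q} t *\<^sub>R h t)" for n
        by (intro AE_I2) (simp add: bump_nonneg bump_le_1 mult_left_le_one_le mult.assoc)
      have "continuous_on UNIV (\<lambda>t. Re (of_real (bump p q n t)))" for n
        by (intro continuous_intros smooth_continuous smooth_bump)
      then have "bump p q n \<in> borel_measurable lborel" for n
        by (simp add: borel_measurable_continuous_onI)
      then show "(\<lambda>t. bump p q n t *\<^sub>R (indicat_real {p..q} t *\<^sub>R h t)) \<in> borel_measurable lborel" for n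
        by (intro borel_measurable_scaleR borel_measurable_integrable[OF int])
      show "(\<lambda>t. indicat_real {p<..<q} t *\<^sub>R (indicat_real {p..q} t *\<^sub>R h t)) \<in> borel_measurable lborel"
        by (intro borel_measurable_scaleR borel_measurable_integrable[OF int]) simp
    qed
    moreover have "(LINT t|lborel. bump p q n t *\<^sub>R (indicat_real {p..q} t *\<^sub>R h t)) = 0" for n
    proof -
      have "(LINT t|lborel. bump p q n t *\<^sub>R (indicat_real {p..q} t *\<^sub>R h t))
          = (LINT t|lborel. of_real (bump p q n t) *\<^sub>C h t)"
      proof (intro Bochner_Integration.integral_cong refl)
        fix t
        show "bump p q n t *\<^sub>R (indicat_real {p..q} t *\<^sub>R h t) = of_real (bump p q n t) *\<^sub>C h t"
        proof (cases "t \<in> {p..q}")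
          case True
          then show ?thesis by (simp add: scaleC_of_real)
        next
          case False
          then have "bump p q n t = 0" by (intro bump_outside) auto
          then show ?thesis by (simp add: scaleC_zero_left)
        qed
      qed
      then show ?thesis using orth[OF bump_test_function[OF that]] by simp
    qed
    ultimately have "(LINT t|lborel. indicat_real {p<..<q} t *\<^sub>R (indicat_real {p..q} t *\<^sub>R h t)) = 0"
      by (simp only: LIMSEQ_const_iff)
    also have "(LINT t|lborel. indicat_real {p<..<q} t *\<^sub>R (indicat_real {p..q} t *\<^sub>R h t))
        = (LINT t:{p<..<q}|lborel. h t)"
      unfolding set_lebesgue_integral_def
      by (intro Bochner_Integration.integral_cong) (auto simp: indicator_def)
    finally show ?thesis .
  qed
  (* Dynkin's argument inside one compact interval of I *)
  have ae: "AE t in lborel. t \<in> {p<..<q} \<longrightarrow> h t = 0" if pq: "{p..q} \<subseteq> I" for p q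
  proof -
    define k where "k = (\<lambda>t. indicat_real {p<..<q} t *\<^sub>R h t)"
    have "set_integrable lborel {p<..<q} h"
      by (rule set_integrable_subset[OF loc[OF pq]]) auto
    then have int: "integrable lborel k" by (simp add: k_def set_integrable_def)
    have intA: "set_integrable lborel A k" if "A \<in> sets lborel" for A
      using int that by (simp add: set_integrable_def integrable_mult_indicator)
    have total: "(LINT t|lborel. k t) = 0"
      using interval[OF pq] by (simp add: k_def set_lebesgue_integral_def)
    have "(LINT t:A|lborel. k t) = 0" if A: "A \<in> sets lborel" for A
    proof -
      let ?G = "range (\<lambda>(a, b). {a<..<b::real})"
      have "sets (borel :: real measure) = sigma_sets UNIV ?G"
      proof -
        have eq: "(\<lambda>(a, b). box a b) = (\<lambda>(a, b). {a<..<b::real})" by (auto simp: box_real)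
        show ?thesis
          by (subst borel_eq_box, unfold eq) (rule sets_measure_of, simp)
      qed
      then have borel_eq: "sets lborel = sigma_sets UNIV ?G" by (simp only: sets_lborel)
      have stable: "Int_stable ?G"
      proof (rule Int_stableI)
        fix X Y assume "X \<in> ?G" "Y \<in> ?G"
        then obtain a b c d where "X = {a<..<c}" "Y = {b<..<d}" by auto
        then have "X \<inter> Y = (\<lambda>(a, b). {a<..<b}) (max a b, min c d)"
          by (simp add: Int_greaterThanLessThan)
        then show "X \<inter> Y \<in> ?G" by (rule range_eqI)
      qed
      have closed: "?G \<subseteq> Pow UNIV" by simp
      have "A \<in> sigma_sets UNIV ?G" using A unfolding borel_eq .
      then show ?thesis
      proof (induction rule: sigma_sets_induct_disjoint[OF stable closed, consumes 1, case_names basic empty compl union])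
        case (basic A)
        then obtain a b where A: "A = {a<..<b}" by auto
        have "(LINT t:A|lborel. k t) = (LINT t:{max a p<..<min b q}|lborel. h t)"
          unfolding set_lebesgue_integral_def k_def A
          by (intro Bochner_Integration.integral_cong) (auto simp: indicator_def)
        also have "\<dots> = 0"
          using pq by (intro interval order_trans[OF _ pq]) simp
        finally show ?case .
      next
        case empty
        show ?case by (simp add: set_lebesgue_integral_def)
      next
        case (compl A)
        have A: "A \<in> sets lborel" using compl(1) unfolding borel_eq .
        have "(LINT t:UNIV - A|lborel. k t) = (LINT t|lborel. k t - indicat_real A t *\<^sub>R k t)"
          unfolding set_lebesgue_integral_def
          by (intro Bochner_Integration.integral_cong) (auto simp: indicator_def)
        also have "\<dots> = (LINT t|lborel. k t) - (LINT t:A|lborel. k t)"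
          unfolding set_lebesgue_integral_def
          by (rule Bochner_Integration.integral_diff[OF int integrable_mult_indicator[OF A int]])
        finally show ?case using compl(2) total by simp
      next
        case (union F)
        have F: "F i \<in> sets lborel" for i using union(2) unfolding borel_eq by blast
        have disj: "F i \<inter> F j = {}" if "i \<noteq> j" for i j
          using union(1) that by (auto simp: disjoint_family_on_def)
        have "(\<Union>i. F i) \<in> sets lborel" using F by (intro sets.countable_UN) auto
        from lebesgue_integral_countable_add[of F lborel k, OF F disj intA[OF this]] union(3)
        show ?case by simp
      qed
    qed
    then have "AE t in lborel. k t = 0"
      by (rule sigma_finite_measure.density_zero[OF sigma_finite_lborel int])
    then show ?thesis by eventually_elim (auto simp: k_def)
  qed
  (* countably many rational intervals cover the open set I *)
  have "AE t in lborel. \<forall>p\<in>\<rat>. \<forall>q\<in>\<rat>. {p..q} \<subseteq> I \<longrightarrow> t \<in> {p<..<q} \<longrightarrow> h t = 0"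
    unfolding AE_ball_countable[OF countable_rat]
  proof (intro ballI)
    show "AE t in lborel. {p..q} \<subseteq> I \<longrightarrow> t \<in> {p<..<q} \<longrightarrow> h t = 0" for p q
      using ae[of p q] by (cases "{p..q} \<subseteq> I") simp_all
  qed
  then show ?thesis
  proof eventually_elim
    case (elim t)
    show ?case
    proof
      assume "t \<in> I"
      then obtain e where e: "e > 0" "cball t e \<subseteq> I"
        using \<open>open I\<close> open_contains_cball by blast
      obtain p where p: "p \<in> \<rat>" "t - e < p" "p < t"
        using Rats_dense_in_real[of "t - e" t] e by auto
      obtain q where q: "q \<in> \<rat>" "t < q" "q < t + e"
        using Rats_dense_in_real[of t "t + e"] e by auto
      have "{p..q} \<subseteq> cball t e" using p(2) q(3) by (auto simp: cball_eq_atLeastAtMost)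
      then have "{p..q} \<subseteq> I" using e(2) by (rule order_trans)
      then show "h t = 0" using elim[rule_format, OF p(1) q(1)] p(3) q(2) by simp
    qed
  qed
qed

section \<open>Bilinear maps and integrability\<close>

lemma bounded_bilinear_scaleC: "bounded_bilinear (\<lambda>c (x :: 'a::complex_inner). c *\<^sub>C x)"
proof
  show "\<exists>K. \<forall>a b. norm (a *\<^sub>C (b :: 'a)) \<le> norm a * norm b * K"
    by (rule exI[of _ 1]) (simp add: norm_scaleC)
qed (simp_all add: scaleC_add_left scaleC_add_right scaleR_scaleC[where 'a = 'a] scaleC_scaleC
    scaleR_conv_of_real mult.commute)

lemma bounded_bilinear_cinner: "bounded_bilinear (cinner :: 'a::complex_inner \<Rightarrow> 'a \<Rightarrow> complex)"
proof
  have add_right: "cinner x (y + z) = cinner x y + cinner x z" for x y z :: 'a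
    by (metis cinner_commute cinner_add_left complex_cnj_add)
  show "cinner x (y + z) = cinner x y + cinner x z" for x y z :: 'a by (rule add_right)
  show "cinner (r *\<^sub>R x) y = r *\<^sub>R cinner x y" for r and x y :: 'a
    by (simp add: scaleR_scaleC cinner_scaleC_left scaleC_complex_def)
  show "cinner x (r *\<^sub>R y) = r *\<^sub>R cinner x y" for r and x y :: 'a
  proof -
    have "cinner x (r *\<^sub>R y) = cnj (of_real r * cinner y x)"
      by (subst cinner_commute) (simp add: scaleR_scaleC cinner_scaleC_left)
    also have "\<dots> = of_real r * cinner x y"
      by (subst (2) cinner_commute) simp
    finally show ?thesis by (simp add: scaleR_conv_of_real)
  qed
  show "\<exists>K. \<forall>a b. norm (cinner a (b :: 'a)) \<le> norm a * norm b * K"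
    by (rule exI[of _ 2]) (use norm_cinner_le in \<open>auto simp: mult_ac\<close>)
qed (rule cinner_add_left)

lemma measurable_bilinear:
  fixes B :: "'a::{real_normed_vector, second_countable_topology} \<Rightarrow> 'b::{real_normed_vector, second_countable_topology}
    \<Rightarrow> 'c::real_normed_vector"
  assumes "bounded_bilinear B" "f \<in> borel_measurable M" "g \<in> borel_measurable M"
  shows "(\<lambda>x. B (f x) (g x)) \<in> borel_measurable M"
  by (rule borel_measurable_continuous_Pair[OF assms(2,3)])
    (intro bounded_bilinear.continuous_on[OF assms(1)] continuous_intros)

text \<open>
  A continuous factor is bounded on a compact interval.
\<close>

lemma set_integrable_bilinear:
  fixes B :: "'a::{real_normed_vector, second_countable_topology} \<Rightarrow> 'b::{banach, second_countable_topology}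
    \<Rightarrow> 'c::{banach, second_countable_topology}" and f :: "real \<Rightarrow> 'a"
  assumes B: "bounded_bilinear B" and f: "continuous_on {p..q} f" and g: "set_integrable lborel {p..q} g"
  shows "set_integrable lborel {p..q} (\<lambda>t. B (f t) (g t))"
proof -
  let ?f = "\<lambda>t. indicat_real {p..q} t *\<^sub>R f t" and ?g = "\<lambda>t. indicat_real {p..q} t *\<^sub>R g t"
  obtain K where K: "K \<ge> 0" "\<And>x y. norm (B x y) \<le> norm x * norm y * K"
    using bounded_bilinear.nonneg_bounded[OF B] by blast
  obtain C where "\<forall>x\<in>f ` {p..q}. norm x \<le> C"
    using compact_imp_bounded[OF compact_continuous_image[OF f compact_Icc]]
    unfolding bounded_iff by metis
  then have C: "\<And>t. t \<in> {p..q} \<Longrightarrow> norm (f t) \<le> C" by simp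
  have eq: "B (?f t) (?g t) = indicat_real {p..q} t *\<^sub>R B (f t) (g t)" for t
    by (simp add: indicator_def bounded_bilinear.zero_left[OF B])
  have int: "integrable lborel ?g" using g by (simp add: set_integrable_def)
  have "integrable lborel (\<lambda>t. B (?f t) (?g t))"
  proof (rule Bochner_Integration.integrable_bound)
    show "integrable lborel (\<lambda>t. (\<bar>C\<bar> * K) *\<^sub>R ?g t)"
      using int by (rule integrable_scaleR_right)
    have "?f \<in> borel_measurable borel"
      by (rule borel_measurable_continuous_on_indicator[OF _ f]) simp
    then show "(\<lambda>t. B (?f t) (?g t)) \<in> borel_measurable lborel"
      using borel_measurable_integrable[OF int] by (intro measurable_bilinear[OF B]) auto
    have "norm (B (?f t) (?g t)) \<le> norm ((\<bar>C\<bar> * K) *\<^sub>R ?g t)" for t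
    proof (cases "t \<in> {p..q}")
      case True
      have "norm (B (f t) (g t)) \<le> norm (f t) * norm (g t) * K" by (rule K)
      also have "\<dots> \<le> \<bar>C\<bar> * norm (g t) * K"
        using C[OF True] K(1) by (intro mult_right_mono) auto
      finally show ?thesis using True K(1) by (simp add: abs_mult mult_ac)
    qed (simp add: bounded_bilinear.zero_left[OF B])
    then show "AE t in lborel. norm (B (?f t) (?g t)) \<le> norm ((\<bar>C\<bar> * K) *\<^sub>R ?g t)"
      by simp
  qed
  then show ?thesis unfolding eq set_integrable_def .
qed

lemma integrable_of_set_integrable:
  assumes "set_integrable M A f" "\<And>t. t \<notin> A \<Longrightarrow> f t = 0"
  shows "integrable M f"
proof -
  have "(\<lambda>t. indicat_real A t *\<^sub>R f t) = f" using assms(2) by (auto simp: indicator_def fun_eq_iff)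
  then show ?thesis using assms(1) by (simp add: set_integrable_def)
qed

section \<open>The lemma of du Bois-Reymond\<close>

text \<open>
  On an interval \<open>I\<close> the compact support of a test function can be enclosed, together with any prescribed
  compact interval, in one compact interval inside \<open>I\<close>.
\<close>

lemma test_function_support:
  assumes "\<phi> \<in> test_functions I" "is_interval I" "{p..q} \<subseteq> I" "p \<le> q"
  obtains P Q where "P \<le> p" "q \<le> Q" "{P..Q} \<subseteq> I" "\<And>t. t \<notin> {P..Q} \<Longrightarrow> \<phi> t = 0"
proof -
  let ?K = "closure {t. \<phi> t \<noteq> 0} \<union> {p, q}"
  have K: "compact ?K" "?K \<subseteq> I" "?K \<noteq> {}"
    using assms by (auto simp: test_functions_def intro!: compact_Un)
  obtain P where P: "P \<in> ?K" "\<And>t. t \<in> ?K \<Longrightarrow> P \<le> t"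
    using compact_attains_inf[OF K(1,3)] by blast
  obtain Q where Q: "Q \<in> ?K" "\<And>t. t \<in> ?K \<Longrightarrow> t \<le> Q"
    using compact_attains_sup[OF K(1,3)] by blast
  show ?thesis
  proof (rule that)
    show "{P..Q} \<subseteq> I"
    proof
      have "P \<in> I" "Q \<in> I" using P(1) Q(1) K(2) by blast+
      moreover fix t assume "t \<in> {P..Q}"
      ultimately show "t \<in> I" using assms(2) unfolding is_interval_1 atLeastAtMost_iff by blast
    qed
    fix t assume "t \<notin> {P..Q}"
    then have "t \<notin> ?K" using P(2)[of t] Q(2)[of t] unfolding atLeastAtMost_iff by blast
    then show "\<phi> t = 0" using closure_subset[of "{t. \<phi> t \<noteq> 0}"] by auto
  qed (use P(2) Q(2) in auto)
qed

lemma test_function_smooth: "\<phi> \<in> test_functions I \<Longrightarrow> smooth \<phi>"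
  by (simp add: test_functions_def)

lemma smooth_vderiv:
  assumes "smooth \<phi>"
  shows "smooth (vderiv \<phi>)" "(\<phi> has_vector_derivative vderiv \<phi> t) (at t)"
proof -
  obtain \<phi>' where \<phi>': "smooth \<phi>'" "\<And>t. (\<phi> has_vector_derivative \<phi>' t) (at t)"
    using smooth_derivative[OF assms] by metis
  then have "vderiv \<phi> = \<phi>'" by (simp add: vector_derivative_at fun_eq_iff)
  then show "smooth (vderiv \<phi>)" "(\<phi> has_vector_derivative vderiv \<phi> t) (at t)"
    using \<phi>' by auto
qed

text \<open>
  An antiderivative is constant to the left and to the right of the support of \<open>\<psi>\<close>; normalised to vanish
  on the left, its value on the right is the integral of \<open>\<psi>\<close>, which is zero.
\<close>

lemma antiderivative_test_function:
  assumes \<psi>: "smooth \<psi>" and supp: "\<And>t. t \<notin> {P..Q} \<Longrightarrow> \<psi> t = 0" "P \<le> Q" "{P..Q} \<subseteq> I"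
    and mean: "(LINT t|lborel. \<psi> t) = 0"
  obtains \<phi> where "\<phi> \<in> test_functions I" "\<And>t. (\<phi> has_vector_derivative \<psi> t) (at t)"
proof -
  have "\<exists>F. \<forall>t::real. - \<infinity> < ereal t \<longrightarrow> ereal t < \<infinity> \<longrightarrow> (F has_vector_derivative \<psi> t) (at t)"
    by (rule einterval_antiderivative)
      (use smooth_continuous[OF \<psi>, of UNIV] in \<open>auto simp: continuous_on_eq_continuous_at\<close>)
  then obtain F where F: "\<And>t. (F has_vector_derivative \<psi> t) (at t)" by auto
  define \<phi> where "\<phi> = (\<lambda>t. F t - F P)"
  have \<phi>': "(\<phi> has_vector_derivative \<psi> t) (at t)" for t
    unfolding \<phi>_def using has_vector_derivative_diff[OF F has_vector_derivative_const] by simp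
  have const: "F s = F t" if "convex S" "s \<in> S" "t \<in> S" "\<And>r. r \<in> S \<Longrightarrow> \<psi> r = 0" for S s t
  proof -
    have "(F has_vector_derivative 0) (at r within S)" if "r \<in> S" for r
      using has_vector_derivative_at_within[OF F[of r]] \<open>r \<in> S \<Longrightarrow> \<psi> r = 0\<close> that by simp
    then show ?thesis
      using has_vector_derivative_zero_constant[OF that(1), of F] that(2,3) by metis
  qed
  have cont: "continuous_on UNIV \<psi>" by (rule smooth_continuous[OF \<psi>])
  have \<psi>_P: "\<psi> P = 0" and \<psi>_Q: "\<psi> Q = 0"
  proof -
    have "\<psi> t = 0" if "t \<in> closure (- {P..Q})" for t
      by (rule continuous_constant_on_closure[OF continuous_on_subset[OF cont] _ that]) (use supp in auto)
    moreover have "closure (- {P..Q}) = - {P<..<Q}"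
      by (simp add: closure_complement interior_atLeastAtMost_real)
    ultimately show "\<psi> P = 0" "\<psi> Q = 0" by auto
  qed
  have "\<phi> t = 0" if "t \<le> P" for t
  proof -
    have "\<psi> r = 0" if "r \<in> {..P}" for r
      using supp(1)[of r] \<psi>_P that by (cases "r = P") auto
    then show ?thesis using const[of "{..P}" t P] that by (simp add: \<phi>_def)
  qed
  moreover have "\<phi> t = 0" if "t \<ge> Q" for t
  proof -
    have "(LINT x|lborel. indicat_real {P..Q} x *\<^sub>R \<psi> x) = F Q - F P"
      by (rule integral_FTC_atLeastAtMost)
        (use F supp continuous_on_subset[OF cont] in \<open>auto intro: has_vector_derivative_at_within\<close>)
    moreover have "(\<lambda>x. indicat_real {P..Q} x *\<^sub>R \<psi> x) = \<psi>"
      using supp(1) by (auto simp: indicator_def fun_eq_iff)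
    ultimately have "F Q = F P" using mean by simp
    moreover have "\<psi> r = 0" if "r \<in> {Q..}" for r
      using supp(1)[of r] \<psi>_Q that by (cases "r = Q") auto
    then have "F t = F Q" using const[of "{Q..}" t Q] that by simp
    ultimately show ?thesis by (simp add: \<phi>_def)
  qed
  ultimately have "\<phi> \<in> test_functions I"
    by (intro test_functionI[OF smooth_antiderivative[OF \<psi> \<phi>'] _ supp(3)]) auto
  then show ?thesis using that \<phi>' by blast
qed

text \<open>
  Fix a bump \<open>\<beta>\<close> with integral \<open>m\<close>. For a test function \<open>\<theta>\<close> the combination \<open>\<theta> - (\<integral>\<theta> / m) \<beta>\<close> has integral
  zero, so it is the derivative of a test function and is annihilated by \<open>h\<close>. This says that \<open>h\<close> has the
  same integral against \<open>\<theta>\<close> as the constant \<open>c = (\<integral>\<beta> h) / m\<close>, and the fundamental lemma applies to \<open>h - c\<close>.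
\<close>

lemma du_Bois_Reymond:
  fixes h :: "real \<Rightarrow> 'h::{complex_inner, banach, second_countable_topology}"
  assumes I: "open I" "is_interval I" "I \<noteq> {}"
    and loc: "\<And>p q. {p..q} \<subseteq> I \<Longrightarrow> set_integrable lborel {p..q} h"
    and orth: "\<And>\<phi>. \<phi> \<in> test_functions I \<Longrightarrow> (LINT t|lborel. vderiv \<phi> t *\<^sub>C h t) = 0"
  obtains c where "AE t in lborel. t \<in> I \<longrightarrow> h t = c"
proof -
  obtain x where "x \<in> I" using I(3) by blast
  then obtain e where e: "e > 0" "cball x e \<subseteq> I"
    using I(1) unfolding open_contains_cball by blast
  define p q where "p = x - e" and "q = x + e"
  then have pq: "p < q" "{p..q} \<subseteq> I"
    using e by (simp_all add: cball_eq_atLeastAtMost)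
  define \<beta> where "\<beta> = (\<lambda>t. complex_of_real (bump p q 0 t))"
  have \<beta>: "smooth \<beta>" "\<beta> \<in> test_functions I" "\<And>t. t \<notin> {p..q} \<Longrightarrow> \<beta> t = 0"
    unfolding \<beta>_def
    by (rule smooth_bump, rule bump_test_function[OF pq(2)], simp only: of_real_eq_0_iff,
        rule bump_outside, auto)
  have intB: "integrable lborel (\<lambda>t. \<theta> t *\<^sub>C g t)"
    if "smooth \<theta>" "\<And>t. t \<notin> {P..Q} \<Longrightarrow> \<theta> t = 0" "set_integrable lborel {P..Q} g"
    for \<theta> P Q and g :: "real \<Rightarrow> 'b::{complex_inner, banach, second_countable_topology}"
    by (rule integrable_of_set_integrable[OF
          set_integrable_bilinear[OF bounded_bilinear_scaleC smooth_continuous[OF that(1)] that(3)]])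
      (use that(2) in \<open>auto simp: bounded_bilinear.zero_left[OF bounded_bilinear_scaleC]\<close>)
  have int1: "integrable lborel \<theta>" if "smooth \<theta>" "\<And>t. t \<notin> {P..Q} \<Longrightarrow> \<theta> t = 0" for \<theta> P Q
    using borel_integrable_compact[of "{P..Q}" \<theta>] smooth_continuous[OF that(1)]
    by (intro integrable_of_set_integrable[where A = "{P..Q}"]) (use that(2) in \<open>auto simp: set_integrable_def\<close>)
  define m where "m = (LINT t|lborel. \<beta> t)"
  have m: "m \<noteq> 0"
  proof
    assume "m = 0"
    have int: "integrable lborel (\<lambda>t. bump p q 0 t)"
      using integrable_Re[OF int1[OF \<beta>(1,3)]] by (simp add: \<beta>_def)
    have "(LINT t|lborel. bump p q 0 t) = Re m"
      unfolding m_def using integral_Re[OF int1[OF \<beta>(1,3)]] by (simp add: \<beta>_def)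
    then have "AE t in lborel. bump p q 0 t = 0"
      using integral_nonneg_eq_0_iff_AE[OF int] \<open>m = 0\<close> by (simp add: bump_nonneg)
    then have "AE t in lborel. t \<notin> {p<..<q}"
    proof eventually_elim
      case (elim t)
      then show ?case using bump_pos[of p t q 0] by auto
    qed
    then have "{p<..<q} \<in> null_sets lborel"
      by (subst (asm) AE_iff_null_sets[symmetric]) auto
    then show False using pq by (auto simp: null_sets_def)
  qed
  define c where "c = (1 / m) *\<^sub>C (LINT t|lborel. \<beta> t *\<^sub>C h t)"
  have "AE t in lborel. t \<in> I \<longrightarrow> h t - c = 0"
  proof (rule fundamental_lemma[OF I(1)])
    fix P Q assume "{P..Q} \<subseteq> I"
    then show "set_integrable lborel {P..Q} (\<lambda>t. h t - c)"
      by (intro set_integral_diff loc borel_integrable_atLeastAtMost') auto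
  next
    fix \<theta> assume \<theta>: "\<theta> \<in> test_functions I"
    obtain P Q where PQ: "P \<le> p" "q \<le> Q" "{P..Q} \<subseteq> I" "\<And>t. t \<notin> {P..Q} \<Longrightarrow> \<theta> t = 0"
      using test_function_support[OF \<theta> I(2) pq(2)] pq(1) by (metis less_imp_le)
    have \<theta>_smooth: "smooth \<theta>" using \<theta> by (rule test_function_smooth)
    have \<beta>': "\<beta> t = 0" if "t \<notin> {P..Q}" for t using \<beta>(3) PQ(1,2) that by auto
    define n where "n = (LINT t|lborel. \<theta> t) / m"
    define \<psi> where "\<psi> = (\<lambda>t. \<theta> t + (- n) * \<beta> t)"
    have \<psi>: "smooth \<psi>" unfolding \<psi>_def by (intro smooth_add smooth_mult smooth_const \<theta>_smooth \<beta>(1))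
    have "(LINT t|lborel. \<psi> t) = (LINT t|lborel. \<theta> t) + (- n) * m"
      unfolding \<psi>_def m_def using int1[OF \<theta>_smooth PQ(4)] int1[OF \<beta>(1) \<beta>'] by simp
    also have "\<dots> = 0" using m by (simp add: n_def)
    finally have mean: "(LINT t|lborel. \<psi> t) = 0" .
    have "\<psi> t = 0" if "t \<notin> {P..Q}" for t
      using PQ(4)[OF that] \<beta>'[OF that] by (simp add: \<psi>_def)
    moreover have "P \<le> Q" using PQ pq by linarith
    ultimately obtain \<phi> where \<phi>: "\<phi> \<in> test_functions I"
      "\<And>t. (\<phi> has_vector_derivative \<psi> t) (at t)"
      using antiderivative_test_function[OF \<psi> _ _ PQ(3) mean] by blast
    have int\<theta>: "integrable lborel (\<lambda>t. \<theta> t *\<^sub>C h t)" and int\<beta>: "integrable lborel (\<lambda>t. \<beta> t *\<^sub>C h t)"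
      using intB[OF \<theta>_smooth PQ(4) loc[OF PQ(3)]] intB[OF \<beta>(1) \<beta>' loc[OF PQ(3)]] by auto
    have "0 = (LINT t|lborel. \<psi> t *\<^sub>C h t)"
      using orth[OF \<phi>(1)] by (simp only: vector_derivative_at[OF \<phi>(2)])
    also have "\<dots> = (LINT t|lborel. \<theta> t *\<^sub>C h t + (- n) *\<^sub>C (\<beta> t *\<^sub>C h t))"
      unfolding \<psi>_def scaleC_add_left scaleC_scaleC ..
    also have "\<dots> = (LINT t|lborel. \<theta> t *\<^sub>C h t) + (- n) *\<^sub>C (LINT t|lborel. \<beta> t *\<^sub>C h t)"
      using int\<theta> int\<beta>
      by (simp add: integral_bounded_linear[OF bounded_linear_scaleC]
          integrable_bounded_linear[OF bounded_linear_scaleC])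
    also have "(- n) *\<^sub>C (LINT t|lborel. \<beta> t *\<^sub>C h t) = - ((LINT t|lborel. \<theta> t) *\<^sub>C c)"
      by (simp add: n_def c_def scaleC_scaleC bounded_bilinear.minus_left[OF bounded_bilinear_scaleC])
    finally have eq: "(LINT t|lborel. \<theta> t *\<^sub>C h t) = (LINT t|lborel. \<theta> t) *\<^sub>C c" by simp
    have bl: "bounded_linear (\<lambda>z. z *\<^sub>C c)"
      by (rule bounded_bilinear.bounded_linear_left[OF bounded_bilinear_scaleC])
    have "(LINT t|lborel. \<theta> t *\<^sub>C (h t - c))
        = (LINT t|lborel. \<theta> t *\<^sub>C h t - \<theta> t *\<^sub>C c)"
      by (simp add: bounded_bilinear.diff_right[OF bounded_bilinear_scaleC])
    also have "\<dots> = (LINT t|lborel. \<theta> t *\<^sub>C h t) - (LINT t|lborel. \<theta> t *\<^sub>C c)"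
      using int\<theta> integrable_bounded_linear[OF bl int1[OF \<theta>_smooth PQ(4)]] by simp
    also have "(LINT t|lborel. \<theta> t *\<^sub>C c) = (LINT t|lborel. \<theta> t) *\<^sub>C c"
      by (rule integral_bounded_linear[OF bl int1[OF \<theta>_smooth PQ(4)]])
    finally show "(LINT t|lborel. \<theta> t *\<^sub>C (h t - c)) = 0" using eq by simp
  qed
  then show ?thesis by (intro that[of c]) auto
qed

section \<open>Indefinite Lebesgue integrals of vector-valued functions\<close>

text \<open>
  The integral formulation of local absolute continuity: \<open>F\<close> is an indefinite integral of \<open>f\<close>. It avoids
  pointwise derivatives, which need not exist everywhere, and it is stable under changing \<open>f\<close> on null sets.
\<close>

definition primitive :: "(real \<Rightarrow> 'a::{banach, second_countable_topology}) \<Rightarrow> (real \<Rightarrow> 'a) \<Rightarrow> bool" where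
  "primitive F f \<longleftrightarrow> (\<forall>s t. s \<le> t \<longrightarrow>
    set_integrable lborel {s..t} f \<and> (LINT r:{s..t}|lborel. f r) = F t - F s)"

lemma primitiveD:
  assumes "primitive F f"
  shows "set_integrable lborel {s..t} f" "s \<le> t \<Longrightarrow> (LINT r:{s..t}|lborel. f r) = F t - F s"
  using assms by (auto simp: primitive_def) (cases "s \<le> t"; simp)

lemma LINT_Icc_split:
  fixes f :: "real \<Rightarrow> 'a::{banach, second_countable_topology}"
  assumes "set_integrable lborel {s..t} f" "s \<le> m" "m \<le> t"
  shows "(LINT r:{s..t}|lborel. f r) = (LINT r:{s..m}|lborel. f r) + (LINT r:{m..t}|lborel. f r)"
proof -
  have "(LINT r:{s..m} \<union> {m..t}|lborel. f r) = (LINT r:{s..m}|lborel. f r) + (LINT r:{m..t}|lborel. f r)"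
  proof (rule set_integral_Un_AE)
    show "AE x in lborel. \<not> (x \<in> {s..m} \<and> x \<in> {m..t})"
      using AE_lborel_singleton[of m] by eventually_elim auto
  qed (use assms in \<open>auto intro: set_integrable_subset\<close>)
  moreover have "{s..m} \<union> {m..t} = {s..t}" using assms by auto
  ultimately show ?thesis by simp
qed

lemma primitive_exists:
  fixes f :: "real \<Rightarrow> 'a::{banach, second_countable_topology}"
  assumes loc: "\<And>s t. set_integrable lborel {s..t} f"
  obtains F where "primitive F f"
proof
  define F where "F = (\<lambda>t. if 0 \<le> t then LINT r:{0..t}|lborel. f r else - (LINT r:{t..0}|lborel. f r))"
  show "primitive F f"
    unfolding primitive_def
  proof (intro allI impI conjI loc)
    fix s t :: real assume "s \<le> t"
    then consider "0 \<le> s" | "s < 0" "0 \<le> t" | "t < 0" by linarith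
    then show "(LINT r:{s..t}|lborel. f r) = F t - F s"
    proof cases
      case 1
      then show ?thesis using LINT_Icc_split[OF loc, of 0 s t] \<open>s \<le> t\<close> by (simp add: F_def)
    next
      case 2
      then show ?thesis using LINT_Icc_split[OF loc, of s 0 t] by (simp add: F_def)
    next
      case 3
      then show ?thesis using LINT_Icc_split[OF loc, of s t 0] \<open>s \<le> t\<close> by (simp add: F_def)
    qed
  qed
qed

lemma primitive_continuous:
  fixes F :: "real \<Rightarrow> 'a::{banach, second_countable_topology}"
  assumes "primitive F f"
  shows "continuous_on S F"
proof -
  have "isCont F t" for t
    unfolding continuous_at_sequentially o_def
  proof (intro allI impI)
    fix X :: "nat \<Rightarrow> real" assume X: "X \<longlonglongrightarrow> t"
    define c d where "c = t - 1" and "d = t + 1"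
    have ev: "\<forall>\<^sub>F n in sequentially. c < X n \<and> X n < d"
      using order_tendstoD[OF X] by (auto simp: c_def d_def intro: eventually_conj)
    have F: "F r = F c + (LINT x|lborel. indicat_real {c..r} x *\<^sub>R f x)" if "c \<le> r" for r
      using primitiveD(2)[OF assms that] by (simp add: set_lebesgue_integral_def)
    have int: "integrable lborel (\<lambda>x. indicat_real {c..r} x *\<^sub>R f x)" for r
      using primitiveD(1)[OF assms, of c r] by (simp add: set_integrable_def)
    have "(\<lambda>n. LINT x|lborel. indicat_real {c..min d (X n)} x *\<^sub>R f x)
        \<longlonglongrightarrow> (LINT x|lborel. indicat_real {c..t} x *\<^sub>R f x)"
    proof (rule integral_dominated_convergence)
      show "integrable lborel (\<lambda>x. norm (indicat_real {c..d} x *\<^sub>R f x))"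
        using int by (rule integrable_norm)
      show "AE x in lborel. (\<lambda>n. indicat_real {c..min d (X n)} x *\<^sub>R f x) \<longlonglongrightarrow> indicat_real {c..t} x *\<^sub>R f x"
        using AE_lborel_singleton[of t]
      proof eventually_elim
        case (elim x)
        have "\<forall>\<^sub>F n in sequentially. indicat_real {c..min d (X n)} x = indicat_real {c..t} x"
        proof (cases "x < t")
          case True
          have "\<forall>\<^sub>F n in sequentially. x < X n" using order_tendstoD(1)[OF X True] .
          then show ?thesis using ev by eventually_elim (use True in \<open>auto simp: indicator_def d_def\<close>)
        next
          case False
          then have "t < x" using elim by simp
          then have "\<forall>\<^sub>F n in sequentially. X n < x" using order_tendstoD(2)[OF X] by blast
          then show ?thesis using ev by eventually_elim (use \<open>t < x\<close> in \<open>auto simp: indicator_def d_def\<close>)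
        qed
        then have "\<forall>\<^sub>F n in sequentially. indicat_real {c..t} x *\<^sub>R f x = indicat_real {c..min d (X n)} x *\<^sub>R f x"
          by eventually_elim simp
        then show ?case by (rule Lim_transform_eventually[OF tendsto_const])
      qed
      show "AE x in lborel. norm (indicat_real {c..min d (X n)} x *\<^sub>R f x)
          \<le> norm (indicat_real {c..d} x *\<^sub>R f x)" for n
        by (intro AE_I2) (auto simp: indicator_def)
    qed (use int in \<open>auto intro: borel_measurable_integrable\<close>)
    moreover have "F t = F c + (LINT x|lborel. indicat_real {c..t} x *\<^sub>R f x)"
      by (rule F) (simp add: c_def)
    ultimately have "(\<lambda>n. F c + (LINT x|lborel. indicat_real {c..min d (X n)} x *\<^sub>R f x)) \<longlonglongrightarrow> F t"
      by (simp only: tendsto_add[OF tendsto_const])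
    moreover have "\<forall>\<^sub>F n in sequentially. F c + (LINT x|lborel. indicat_real {c..min d (X n)} x *\<^sub>R f x) = F (X n)"
      using ev by eventually_elim (simp add: F[symmetric])
    ultimately show "(\<lambda>n. F (X n)) \<longlonglongrightarrow> F t" by (rule Lim_transform_eventually)
  qed
  then show ?thesis by (simp add: continuous_at_imp_continuous_on)
qed

lemma primitive_bounded_linear:
  assumes T: "bounded_linear T" and F: "primitive F f"
  shows "primitive (\<lambda>t. T (F t)) (\<lambda>t. T (f t))"
  unfolding primitive_def
proof (intro allI impI conjI)
  fix s t :: real assume "s \<le> t"
  interpret T: bounded_linear T by (rule T)
  have int: "integrable lborel (\<lambda>r. indicat_real {s..t} r *\<^sub>R f r)"
    using primitiveD(1)[OF F, of s t] by (simp add: set_integrable_def)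
  show "set_integrable lborel {s..t} (\<lambda>t. T (f t))"
    using integrable_bounded_linear[OF T int] by (simp add: set_integrable_def T.scaleR)
  show "(LINT r:{s..t}|lborel. T (f r)) = T (F t) - T (F s)"
    using integral_bounded_linear[OF T int] primitiveD(2)[OF F \<open>s \<le> t\<close>]
    by (simp add: set_lebesgue_integral_def T.scaleR T.diff)
qed

lemma primitive_add:
  assumes "primitive F f" "primitive G g"
  shows "primitive (\<lambda>t. F t + G t) (\<lambda>t. f t + g t)"
  using assms unfolding primitive_def by (auto simp: set_integral_add)

lemma primitive_sum:
  assumes "\<And>j. j < (n::nat) \<Longrightarrow> primitive (F j) (f j)"
  shows "primitive (\<lambda>t. \<Sum>j<n. F j t) (\<lambda>t. \<Sum>j<n. f j t)"
  using assms
proof (induction n)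
  case 0
  show ?case by (simp add: primitive_def set_integrable_def set_lebesgue_integral_def)
next
  case (Suc n)
  then show ?case by (auto intro!: primitive_add)
qed

lemma primitive_of_vector_derivative:
  fixes F :: "real \<Rightarrow> 'a::euclidean_space"
  assumes "\<And>t. (F has_vector_derivative f t) (at t)" "continuous_on UNIV f"
  shows "primitive F f"
  unfolding primitive_def
proof (intro allI impI conjI)
  fix s t :: real assume "s \<le> t"
  have f: "continuous_on {s..t} f" using assms(2) by (rule continuous_on_subset) simp
  show "set_integrable lborel {s..t} f" by (rule borel_integrable_atLeastAtMost'[OF f])
  show "(LINT r:{s..t}|lborel. f r) = F t - F s"
    unfolding set_lebesgue_integral_def
    by (rule integral_FTC_atLeastAtMost[OF \<open>s \<le> t\<close> has_vector_derivative_at_within[OF assms(1)] f])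
qed

lemma integrable_bilinear_product:
  fixes B :: "'a::{banach, second_countable_topology} \<Rightarrow> 'b::{banach, second_countable_topology}
    \<Rightarrow> 'c::{banach, second_countable_topology}" and f :: "real \<Rightarrow> 'a" and g :: "real \<Rightarrow> 'b"
  assumes B: "bounded_bilinear B" and f: "integrable lborel f" and g: "integrable lborel g"
  shows "integrable (lborel \<Otimes>\<^sub>M lborel) (\<lambda>(r, x). B (f r) (g x))"
proof (rule lborel_pair.Fubini_integrable)
  note [measurable] = borel_measurable_integrable[OF f] borel_measurable_integrable[OF g]
  obtain K where K: "K \<ge> 0" "\<And>x y. norm (B x y) \<le> norm x * norm y * K"
    using bounded_bilinear.nonneg_bounded[OF B] by blast
  have "(\<lambda>z. f (fst z)) \<in> borel_measurable (lborel \<Otimes>\<^sub>M lborel)"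
    "(\<lambda>z. g (snd z)) \<in> borel_measurable (lborel \<Otimes>\<^sub>M lborel)" by measurable
  from measurable_bilinear[OF B this]
  show meas: "(\<lambda>(r, x). B (f r) (g x)) \<in> borel_measurable (lborel \<Otimes>\<^sub>M lborel)"
    by (simp add: case_prod_unfold)
  have int2: "integrable lborel (\<lambda>x. B (f r) (g x))" for r
    by (rule integrable_bounded_linear[OF bounded_bilinear.bounded_linear_right[OF B] g])
  then show "AE r in lborel. integrable lborel (\<lambda>x. case (r, x) of (r, x) \<Rightarrow> B (f r) (g x))"
    by simp
  show "integrable lborel (\<lambda>r. LINT x|lborel. norm (case (r, x) of (r, x) \<Rightarrow> B (f r) (g x)))"
  proof (rule Bochner_Integration.integrable_bound)
    show "integrable lborel (\<lambda>r. norm (f r) * ((LINT x|lborel. norm (g x)) * K))"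
      using f by auto
    show "(\<lambda>r. LINT x|lborel. norm (case (r, x) of (r, x) \<Rightarrow> B (f r) (g x))) \<in> borel_measurable lborel"
      using meas by (intro lborel.borel_measurable_lebesgue_integral) (simp add: case_prod_unfold)
    show "AE r in lborel. norm (LINT x|lborel. norm (case (r, x) of (r, x) \<Rightarrow> B (f r) (g x)))
        \<le> norm (norm (f r) * ((LINT x|lborel. norm (g x)) * K))"
    proof (intro AE_I2)
      fix r
      have "(LINT x|lborel. norm (B (f r) (g x))) \<le> (LINT x|lborel. norm (f r) * norm (g x) * K)"
        using int2[of r] g K(2) by (intro integral_mono) auto
      also have "\<dots> = norm (f r) * ((LINT x|lborel. norm (g x)) * K)" by simp
      finally show "norm (LINT x|lborel. norm (case (r, x) of (r, x) \<Rightarrow> B (f r) (g x)))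
        \<le> norm (norm (f r) * ((LINT x|lborel. norm (g x)) * K))"
        using K(1) by (simp add: integral_nonneg_AE)
    qed
  qed
qed

text \<open>
  The product rule, by Fubini: the double integral of \<open>B (f r) (g x)\<close> over the square \<open>{s..t} \<times> {s..t}\<close> is
  \<open>B (F t - F s) (G t - G s)\<close>, and splitting the square along the diagonal gives the integrals of
  \<open>B (f r) (G r - G s)\<close> and \<open>B (F x - F s) (g x)\<close>.
\<close>

lemma primitive_bilinear:
  fixes B :: "'a::{banach, second_countable_topology} \<Rightarrow> 'b::{banach, second_countable_topology}
    \<Rightarrow> 'c::{banach, second_countable_topology}"
  assumes B: "bounded_bilinear B" and F: "primitive F f" and G: "primitive G g"
  shows "primitive (\<lambda>t. B (F t) (G t)) (\<lambda>t. B (f t) (G t) + B (F t) (g t))"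
  unfolding primitive_def
proof (intro allI impI)
  fix s t :: real assume st: "s \<le> t"
  interpret B: bounded_bilinear B by (rule B)
  have i1: "set_integrable lborel {s..t} (\<lambda>r. B (f r) (G r))"
    by (rule set_integrable_bilinear[OF bounded_bilinear.flip[OF B] primitive_continuous[OF G]
          primitiveD(1)[OF F]])
  have i2: "set_integrable lborel {s..t} (\<lambda>r. B (F r) (g r))"
    by (rule set_integrable_bilinear[OF B primitive_continuous[OF F] primitiveD(1)[OF G]])
  define f' g' where "f' = (\<lambda>r. indicat_real {s..t} r *\<^sub>R f r)"
    and "g' = (\<lambda>r. indicat_real {s..t} r *\<^sub>R g r)"
  have f': "integrable lborel f'" and g': "integrable lborel g'"
    using primitiveD(1)[OF F, of s t] primitiveD(1)[OF G, of s t]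
    by (simp_all add: f'_def g'_def set_integrable_def)
  define H where "H = (\<lambda>(r, x). B (f' r) (g' x))"
  (* the parts of H below and above the diagonal *)
  define H1 where "H1 = (\<lambda>z. indicat_real {z. snd z < fst z} z *\<^sub>R H z)"
  define H2 where "H2 = (\<lambda>z. indicat_real {z. fst z \<le> snd z} z *\<^sub>R H z)"
  have H: "integrable (lborel \<Otimes>\<^sub>M lborel) H"
    unfolding H_def by (rule integrable_bilinear_product[OF B f' g'])
  have sets: "{z. snd z < fst z} \<in> sets (lborel \<Otimes>\<^sub>M (lborel :: real measure))"
    "{z. fst z \<le> snd z} \<in> sets (lborel \<Otimes>\<^sub>M (lborel :: real measure))"
  proof -
    have "open {z :: real \<times> real. snd z < fst z}"
      by (intro open_Collect_less continuous_on_fst continuous_on_snd continuous_on_id)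
    then show "{z. snd z < fst z} \<in> sets (lborel \<Otimes>\<^sub>M (lborel :: real measure))"
      unfolding lborel_prod sets_lborel by (rule borel_open)
    have "closed {z :: real \<times> real. fst z \<le> snd z}"
      by (intro closed_Collect_le continuous_on_fst continuous_on_snd continuous_on_id)
    then show "{z. fst z \<le> snd z} \<in> sets (lborel \<Otimes>\<^sub>M (lborel :: real measure))"
      unfolding lborel_prod sets_lborel by (rule borel_closed)
  qed
  have H1: "integrable (lborel \<Otimes>\<^sub>M lborel) H1" and H2: "integrable (lborel \<Otimes>\<^sub>M lborel) H2"
    unfolding H1_def H2_def using sets H by (auto intro: integrable_mult_indicator)
  have G_eq: "(LINT x|lborel. H1 (r, x)) = B (f' r) (G r) - B (f' r) (G s)" for r
  proof (cases "r \<in> {s..t}")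
    case True
    have "(LINT x|lborel. H1 (r, x)) = (LINT x|lborel. B (f' r) (indicat_real {s..r} x *\<^sub>R g x))"
    proof (rule integral_cong_AE)
      show "AE x in lborel. H1 (r, x) = B (f' r) (indicat_real {s..r} x *\<^sub>R g x)"
        using AE_lborel_singleton[of r]
        by eventually_elim (use True in \<open>auto simp: H1_def H_def g'_def indicator_def B.zero_right\<close>)
      have int: "integrable lborel (\<lambda>x. indicat_real {s..r} x *\<^sub>R g x)"
        using primitiveD(1)[OF G, of s r] by (simp add: set_integrable_def)
      show "(\<lambda>x. B (f' r) (indicat_real {s..r} x *\<^sub>R g x)) \<in> borel_measurable lborel"
        using integrable_bounded_linear[OF B.bounded_linear_right int] by (rule borel_measurable_integrable)
      show "(\<lambda>x. H1 (r, x)) \<in> borel_measurable lborel"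
        using measurable_compose[OF measurable_Pair1' borel_measurable_integrable[OF H1], of r] by simp
    qed
    also have "\<dots> = B (f' r) (LINT x|lborel. indicat_real {s..r} x *\<^sub>R g x)"
      using primitiveD(1)[OF G, of s r]
      by (intro integral_bounded_linear[OF B.bounded_linear_right]) (simp add: set_integrable_def)
    also have "(LINT x|lborel. indicat_real {s..r} x *\<^sub>R g x) = G r - G s"
      using primitiveD(2)[OF G, of s r] True by (simp add: set_lebesgue_integral_def)
    finally show ?thesis by (simp add: B.diff_right)
  next
    case False
    then have "f' r = 0" by (simp add: f'_def)
    then show ?thesis by (simp add: H1_def H_def B.zero_left)
  qed
  have F_eq: "(LINT r|lborel. H2 (r, x)) = B (F x) (g' x) - B (F s) (g' x)" for x
  proof (cases "x \<in> {s..t}")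
    case True
    have "(LINT r|lborel. H2 (r, x)) = (LINT r|lborel. B (indicat_real {s..x} r *\<^sub>R f r) (g' x))"
      by (intro Bochner_Integration.integral_cong refl)
        (use True in \<open>auto simp: H2_def H_def f'_def indicator_def B.zero_left\<close>)
    also have "\<dots> = B (LINT r|lborel. indicat_real {s..x} r *\<^sub>R f r) (g' x)"
      using primitiveD(1)[OF F, of s x]
      by (intro integral_bounded_linear[OF B.bounded_linear_left]) (simp add: set_integrable_def)
    also have "(LINT r|lborel. indicat_real {s..x} r *\<^sub>R f r) = F x - F s"
      using primitiveD(2)[OF F, of s x] True by (simp add: set_lebesgue_integral_def)
    finally show ?thesis by (simp add: B.diff_left)
  next
    case False
    then have "g' x = 0" by (simp add: g'_def)
    then show ?thesis by (simp add: H2_def H_def B.zero_right)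
  qed
  have totF: "(LINT r|lborel. f' r) = F t - F s" and totG: "(LINT r|lborel. g' r) = G t - G s"
    using primitiveD(2)[OF F st] primitiveD(2)[OF G st]
    by (simp_all add: f'_def g'_def set_lebesgue_integral_def)
  have i1': "integrable lborel (\<lambda>r. B (f' r) (G r))" and i2': "integrable lborel (\<lambda>r. B (F r) (g' r))"
    using i1 i2 by (simp_all add: f'_def g'_def set_integrable_def B.scaleR_left B.scaleR_right)
  have "integral\<^sup>L (lborel \<Otimes>\<^sub>M lborel) H1 = (LINT r|lborel. B (f' r) (G r) - B (f' r) (G s))"
    using lborel_pair.integral_fst'[OF H1] by (simp add: G_eq)
  also have "\<dots> = (LINT r|lborel. B (f' r) (G r)) - B (F t - F s) (G s)"
    using i1' integrable_bounded_linear[OF B.bounded_linear_left f', of "G s"]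
      integral_bounded_linear[OF B.bounded_linear_left f', of "G s"] totF by simp
  finally have e1: "integral\<^sup>L (lborel \<Otimes>\<^sub>M lborel) H1 = (LINT r|lborel. B (f' r) (G r)) - B (F t - F s) (G s)" .
  have "integral\<^sup>L (lborel \<Otimes>\<^sub>M lborel) H2 = (LINT x|lborel. LINT r|lborel. H2 (r, x))"
    using lborel_pair.integral_snd[of "\<lambda>r x. H2 (r, x)"] H2 by simp
  also have "\<dots> = (LINT x|lborel. B (F x) (g' x) - B (F s) (g' x))"
    by (simp add: F_eq)
  also have "\<dots> = (LINT r|lborel. B (F r) (g' r)) - B (F s) (G t - G s)"
    using i2' integrable_bounded_linear[OF B.bounded_linear_right g', of "F s"]
      integral_bounded_linear[OF B.bounded_linear_right g', of "F s"] totG by simp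
  finally have e2: "integral\<^sup>L (lborel \<Otimes>\<^sub>M lborel) H2 = (LINT r|lborel. B (F r) (g' r)) - B (F s) (G t - G s)" .
  have "H = (\<lambda>z. H1 z + H2 z)" by (auto simp: H1_def H2_def indicator_def fun_eq_iff)
  then have "integral\<^sup>L (lborel \<Otimes>\<^sub>M lborel) H
      = integral\<^sup>L (lborel \<Otimes>\<^sub>M lborel) H1 + integral\<^sup>L (lborel \<Otimes>\<^sub>M lborel) H2"
    using H1 H2 by simp
  moreover have "integral\<^sup>L (lborel \<Otimes>\<^sub>M lborel) H = B (F t - F s) (G t - G s)"
  proof -
    have "integral\<^sup>L (lborel \<Otimes>\<^sub>M lborel) H = (LINT r|lborel. LINT x|lborel. B (f' r) (g' x))"
      using lborel_pair.integral_fst'[OF H] by (simp add: H_def)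
    also have "\<dots> = (LINT r|lborel. B (f' r) (G t - G s))"
      using integral_bounded_linear[OF B.bounded_linear_right g'] totG by simp
    also have "\<dots> = B (F t - F s) (G t - G s)"
      using integral_bounded_linear[OF B.bounded_linear_left f'] totF by simp
    finally show ?thesis .
  qed
  ultimately have "(LINT r|lborel. B (f' r) (G r)) + (LINT r|lborel. B (F r) (g' r))
      = B (F t) (G t) - B (F s) (G s)"
    using e1 e2 by (simp add: B.diff_left B.diff_right algebra_simps)
  moreover have "(LINT r:{s..t}|lborel. B (f r) (G r)) = (LINT r|lborel. B (f' r) (G r))"
    "(LINT r:{s..t}|lborel. B (F r) (g r)) = (LINT r|lborel. B (F r) (g' r))"
    by (simp_all add: set_lebesgue_integral_def f'_def g'_def B.scaleR_left B.scaleR_right)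
  ultimately show "set_integrable lborel {s..t} (\<lambda>t. B (f t) (G t) + B (F t) (g t)) \<and>
      (LINT r:{s..t}|lborel. B (f r) (G r) + B (F r) (g r)) = B (F t) (G t) - B (F s) (G s)"
    using i1 i2 by (simp add: set_integral_add)
qed

lemma primitive_compact_support:
  assumes F: "primitive F f" and supp: "\<And>t. t \<notin> {P..Q} \<Longrightarrow> F t = 0" "\<And>t. t \<notin> {P..Q} \<Longrightarrow> f t = 0"
  shows "integrable lborel f" "(LINT t|lborel. f t) = 0"
proof -
  (* one unit beyond the support, so that F vanishes at both ends *)
  let ?P = "min P Q - 1" and ?Q = "max P Q + 1"
  have zero: "f t = 0" if "t \<notin> {?P..?Q}" for t using supp(2)[of t] that by force
  then have eq: "(\<lambda>t. indicat_real {?P..?Q} t *\<^sub>R f t) = f"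
    by (auto simp: indicator_def fun_eq_iff)
  show "integrable lborel f"
    by (rule integrable_of_set_integrable[OF primitiveD(1)[OF F] zero])
  have "?P \<le> ?Q" "?P \<notin> {P..Q}" "?Q \<notin> {P..Q}" by auto
  then show "(LINT t|lborel. f t) = 0"
    using primitiveD(2)[OF F, of ?P ?Q] supp(1)[of ?P] supp(1)[of ?Q]
    by (simp add: set_lebesgue_integral_def eq del: atLeastAtMost_iff)
qed

section \<open>Indefinite integrals on half-lines\<close>

text \<open>
  A nonzero limit would bound \<open>\<bar>F\<bar>\<close> from below by a positive constant on a set of infinite measure.
\<close>

lemma primitive_zero_limit:
  fixes F :: "real \<Rightarrow> real"
  assumes lim: "(F \<longlongrightarrow> l) at_top" and int: "set_integrable lborel {b..} F"
  shows "l = 0"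
proof (rule ccontr)
  assume "l \<noteq> 0"
  then have "\<forall>\<^sub>F t in at_top. \<bar>l\<bar> / 2 < \<bar>F t\<bar>"
    by (intro order_tendstoD(1)[OF tendsto_rabs[OF lim]]) simp
  then obtain N where N: "\<And>t. t \<ge> N \<Longrightarrow> \<bar>l\<bar> / 2 < \<bar>F t\<bar>"
    by (auto simp: eventually_at_top_linorder)
  let ?A = "{max N b..}"
  have "integrable lborel (\<lambda>t. indicat_real ?A t *\<^sub>R (\<bar>l\<bar> / 2))"
  proof (rule Bochner_Integration.integrable_bound)
    show "integrable lborel (\<lambda>t. indicat_real {b..} t *\<^sub>R F t)"
      using int by (simp add: set_integrable_def)
    show "AE t in lborel. norm (indicat_real ?A t *\<^sub>R (\<bar>l\<bar> / 2)) \<le> norm (indicat_real {b..} t *\<^sub>R F t)"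
    proof (intro AE_I2)
      fix t
      show "norm (indicat_real ?A t *\<^sub>R (\<bar>l\<bar> / 2)) \<le> norm (indicat_real {b..} t *\<^sub>R F t)"
        using N[of t] by (cases "t \<in> ?A") (simp_all add: less_imp_le)
    qed
  qed simp
  then have "integrable lborel (\<lambda>t. (2 / \<bar>l\<bar>) *\<^sub>R (indicat_real ?A t *\<^sub>R (\<bar>l\<bar> / 2)))"
    by (rule integrable_scaleR_right)
  moreover have "(2 / \<bar>l\<bar>) *\<^sub>R (indicat_real ?A t *\<^sub>R (\<bar>l\<bar> / 2)) = indicat_real ?A t" for t
    using \<open>l \<noteq> 0\<close> by simp
  ultimately have "integrable lborel (indicat_real ?A)" by (simp only:)
  then have "emeasure lborel ?A < \<infinity>" by (simp add: integrable_indicator_iff)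
  then obtain c where c: "0 \<le> c" "emeasure lborel ?A = ennreal c"
    by (auto simp: less_top_ennreal)
  obtain n :: nat where "c < n" using reals_Archimedean2 by blast
  have "emeasure lborel {max N b..max N b + real n} \<le> emeasure lborel ?A"
    by (intro emeasure_mono) auto
  then have "ennreal (real n) \<le> ennreal c" using c(2) by simp
  then show False using \<open>c < n\<close> c(1) by simp
qed

text \<open>
  Integrability of \<open>f\<close> gives \<open>F\<close> a limit at infinity, and integrability of \<open>F\<close> forces this limit to be zero.
\<close>

lemma LINT_right_halfline:
  fixes F :: "real \<Rightarrow> real"
  assumes F: "primitive F f" and iF: "set_integrable lborel {b..} F" and if': "set_integrable lborel {b..} f"
  shows "(LINT t:{b..}|lborel. f t) = - F b"
proof -
  have "((\<lambda>t. LINT r:{b..t}|lborel. f r) \<longlongrightarrow> (LINT r:{b..}|lborel. f r)) at_top"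
    by (rule tendsto_set_lebesgue_integral_at_top[OF _ if']) simp
  then have "((\<lambda>t. F b + (LINT r:{b..t}|lborel. f r)) \<longlongrightarrow> F b + (LINT r:{b..}|lborel. f r)) at_top"
    by (intro tendsto_intros)
  moreover have "\<forall>\<^sub>F t in at_top. F b + (LINT r:{b..t}|lborel. f r) = F t"
    using eventually_ge_at_top[of b] by eventually_elim (simp add: primitiveD(2)[OF F])
  ultimately have "(F \<longlongrightarrow> F b + (LINT r:{b..}|lborel. f r)) at_top"
    by (rule Lim_transform_eventually)
  from primitive_zero_limit[OF this iF] show ?thesis by simp
qed

lemma LINT_left_halfline:
  fixes F :: "real \<Rightarrow> real"
  assumes F: "primitive F f" and iF: "set_integrable lborel {..a} F" and if': "set_integrable lborel {..a} f"
  shows "(LINT t:{..a}|lborel. f t) = F a"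
proof -
  have "((\<lambda>t. LINT r:{t..a}|lborel. f r) \<longlongrightarrow> (LINT r:{..a}|lborel. f r)) at_bot"
    by (rule tendsto_set_lebesgue_integral_at_bot[OF _ if']) simp
  then have "((\<lambda>t. F a - (LINT r:{t..a}|lborel. f r)) \<longlongrightarrow> F a - (LINT r:{..a}|lborel. f r)) at_bot"
    by (intro tendsto_intros)
  moreover have "\<forall>\<^sub>F t in at_bot. F a - (LINT r:{t..a}|lborel. f r) = F t"
    using eventually_le_at_bot[of a] by eventually_elim (simp add: primitiveD(2)[OF F])
  ultimately have "(F \<longlongrightarrow> F a - (LINT r:{..a}|lborel. f r)) at_bot"
    by (rule Lim_transform_eventually)
  then have "((\<lambda>t. F (- t)) \<longlongrightarrow> F a - (LINT r:{..a}|lborel. f r)) at_top"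
    by (rule filterlim_compose[OF _ filterlim_uminus_at_bot_at_top])
  moreover have "set_integrable lborel {- a..} (\<lambda>t. F (- t))"
  proof -
    have "integrable lborel (\<lambda>t. indicat_real {..a} (0 + (-1) * t) *\<^sub>R F (0 + (-1) * t))"
      using iF unfolding set_integrable_def
      by (subst lborel_integrable_real_affine_iff[of "-1" "\<lambda>t. indicat_real {..a} t *\<^sub>R F t" 0]) simp_all
    moreover have "indicat_real {..a} (- t) = indicat_real {- a..} t" for t
      by (auto simp: indicator_def)
    ultimately show ?thesis by (simp add: set_integrable_def)
  qed
  ultimately show ?thesis using primitive_zero_limit by fastforce
qed

section \<open>Representatives of square integrable functions\<close>

lemma rep_L2_square_integrable: "square_integrable (rep_L2 u)"
  using Quotient_rep_reflp[OF Quotient_L2, of u] by (simp add: L2_rel_def)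

lemma rep_abs_L2:
  assumes "square_integrable f" shows "AE t in lborel. rep_L2 (abs_L2 f) t = f t"
  using Quotient_rep_abs[OF Quotient_L2, of f] assms by (simp add: L2_rel_def)

lemma L2_eqI: "(AE t in lborel. rep_L2 u t = rep_L2 v t) \<Longrightarrow> u = v"
  using Quotient_rel_rep[OF Quotient_L2, of u v] rep_L2_square_integrable[of u] rep_L2_square_integrable[of v]
  by (simp add: L2_rel_def)

lemma inner_L2_integral: "inner u v = (LINT t|lborel. inner (rep_L2 u t) (rep_L2 v t))"
  by (simp add: inner_L2_def)

lemma cinner_L2_integral: "cinner u v = (LINT t|lborel. cinner (rep_L2 u t) (rep_L2 v t))"
  by (simp add: cinner_L2_def)

lemma rep_L2_diff: "AE t in lborel. rep_L2 (u - v) t = rep_L2 u t - rep_L2 v t"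
  using rep_abs_L2[OF square_integrable_diff[OF rep_L2_square_integrable[of u] rep_L2_square_integrable[of v]]]
  by (simp add: minus_L2_def)

lemma rep_L2_scaleC: "AE t in lborel. rep_L2 (c *\<^sub>C u) t = c *\<^sub>C rep_L2 u t"
  using rep_abs_L2[OF square_integrable_scaleC[OF rep_L2_square_integrable[of u], of c]]
  by (simp add: scaleC_L2_def)

lemma rep_L2_scaleR: "AE t in lborel. rep_L2 (r *\<^sub>R u) t = r *\<^sub>R rep_L2 u t"
  using rep_abs_L2[OF square_integrable_scaleR[OF rep_L2_square_integrable[of u], of r]]
  by (simp add: scaleR_L2_def)

lemma rep_L2_zero: "AE t in lborel. rep_L2 0 t = 0"
  using rep_abs_L2[OF square_integrable_zero] by (simp add: zero_L2_def)

lemma L2_on_zero: "(0 :: 'h::{complex_inner, second_countable_topology} L2) \<in> L2_on I"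
  unfolding L2_on_def mem_Collect_eq using rep_L2_zero[where 'a = 'h] by eventually_elim simp

lemma L2_on_diff:
  assumes "u \<in> L2_on I" "v \<in> L2_on I" shows "u - v \<in> L2_on I"
  using assms rep_L2_diff[of u v] unfolding L2_on_def mem_Collect_eq by eventually_elim auto

lemma L2_on_scaleR:
  assumes "u \<in> L2_on I" shows "r *\<^sub>R u \<in> L2_on I"
  using assms rep_L2_scaleR[of r u] unfolding L2_on_def mem_Collect_eq by eventually_elim auto

lemma rep_L2_set_integrable:
  fixes u :: "'h::{complex_inner, banach, second_countable_topology} L2"
  shows "set_integrable lborel {s..t} (rep_L2 u)"
proof -
  have u: "rep_L2 u \<in> borel_measurable lborel" "integrable lborel (\<lambda>t. (norm (rep_L2 u t))\<^sup>2)"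
    using rep_L2_square_integrable[of u] by (simp_all add: square_integrable_def)
  have int: "integrable lborel (\<lambda>r. indicat_real {s..t} r *\<^sub>R 1 + (norm (rep_L2 u r))\<^sup>2)"
    by (intro Bochner_Integration.integrable_add u(2))
      (simp add: integrable_indicator_iff emeasure_lborel_Icc_eq)
  show ?thesis
    unfolding set_integrable_def
  proof (rule Bochner_Integration.integrable_bound[OF int])
    show "(\<lambda>r. indicat_real {s..t} r *\<^sub>R rep_L2 u r) \<in> borel_measurable lborel"
      using u(1) by (intro borel_measurable_scaleR) auto
    have "x \<le> 1 + x\<^sup>2" if "0 \<le> x" for x :: real
      using sum_squares_bound[of x 1] that by simp
    then show "AE r in lborel. norm (indicat_real {s..t} r *\<^sub>R rep_L2 u r)
        \<le> norm (indicat_real {s..t} r *\<^sub>R 1 + (norm (rep_L2 u r))\<^sup>2)"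
      by (intro AE_I2) (simp add: indicator_def)
  qed
qed

section \<open>Weak derivatives\<close>

lemma test_function_bounded_support:
  assumes "\<phi> \<in> test_functions I"
  obtains P Q where "\<And>t. t \<notin> {P..Q} \<Longrightarrow> \<phi> t = 0" "\<And>t. t \<notin> {P..Q} \<Longrightarrow> vderiv \<phi> t = 0"
proof -
  obtain P Q where PQ: "P \<le> 0" "0 \<le> Q" "\<And>t. t \<notin> {P..Q} \<Longrightarrow> \<phi> t = 0"
    using test_function_support[of \<phi> UNIV 0 0] assms by (auto simp: test_functions_def)
  have "vderiv \<phi> t = 0" if t: "t \<notin> {P..Q}" for t
  proof -
    have "(\<phi> has_vector_derivative 0) (at t)"
      by (rule has_vector_derivative_transform_within_open[where f = "\<lambda>_. 0" and S = "- {P..Q}"])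
        (use t PQ(3) in auto)
    then show ?thesis by (rule vector_derivative_at)
  qed
  then show ?thesis using that PQ(3) by blast
qed

lemma test_function_outside: "\<phi> \<in> test_functions I \<Longrightarrow> t \<notin> I \<Longrightarrow> \<phi> t = 0"
  using closure_subset[of "{t. \<phi> t \<noteq> 0}"] by (auto simp: test_functions_def)

lemma test_function_vderiv_outside:
  assumes \<phi>: "\<phi> \<in> test_functions I" and t: "t \<notin> I"
  shows "vderiv \<phi> t = 0"
proof -
  let ?S = "- closure {t. \<phi> t \<noteq> 0}"
  have "t \<in> ?S" using assms by (auto simp: test_functions_def)
  have "(\<phi> has_vector_derivative 0) (at t)"
  proof (rule has_vector_derivative_transform_within_open[where f = "\<lambda>_. 0"])
    show "open ?S" by auto
    show "t \<in> ?S" by fact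
    show "0 = \<phi> r" if "r \<in> ?S" for r
      using that closure_subset[of "{t. \<phi> t \<noteq> 0}"] by auto
  qed simp
  then show ?thesis by (rule vector_derivative_at)
qed

lemma primitive_smooth: "smooth \<phi> \<Longrightarrow> primitive \<phi> (vderiv \<phi>)"
  by (intro primitive_of_vector_derivative smooth_vderiv(2) smooth_continuous smooth_vderiv(1))

lemma integrable_test_scaleC:
  fixes f :: "real \<Rightarrow> 'h::{complex_inner, banach, second_countable_topology}"
  assumes \<phi>: "\<phi> \<in> test_functions I" and f: "\<And>s t. set_integrable lborel {s..t} f"
  shows "integrable lborel (\<lambda>t. \<phi> t *\<^sub>C f t)" "integrable lborel (\<lambda>t. vderiv \<phi> t *\<^sub>C f t)"
proof -
  obtain P Q where PQ: "\<And>t. t \<notin> {P..Q} \<Longrightarrow> \<phi> t = 0" "\<And>t. t \<notin> {P..Q} \<Longrightarrow> vderiv \<phi> t = 0"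
    using test_function_bounded_support[OF \<phi>] by metis
  note sm = test_function_smooth[OF \<phi>]
  note cont = smooth_continuous[OF sm] smooth_continuous[OF smooth_vderiv(1)[OF sm]]
  show "integrable lborel (\<lambda>t. \<phi> t *\<^sub>C f t)"
    by (rule integrable_of_set_integrable[OF
          set_integrable_bilinear[OF bounded_bilinear_scaleC cont(1) f, of P Q]])
      (simp add: PQ scaleC_zero_left del: atLeastAtMost_iff)
  show "integrable lborel (\<lambda>t. vderiv \<phi> t *\<^sub>C f t)"
    by (rule integrable_of_set_integrable[OF
          set_integrable_bilinear[OF bounded_bilinear_scaleC cont(2) f, of P Q]])
      (simp add: PQ scaleC_zero_left del: atLeastAtMost_iff)
qed

lemma test_function_by_parts:
  fixes F :: "real \<Rightarrow> 'h::{complex_inner, banach, second_countable_topology}"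
  assumes \<phi>: "\<phi> \<in> test_functions I" and F: "primitive F f"
  shows "(LINT t|lborel. vderiv \<phi> t *\<^sub>C F t) = - (LINT t|lborel. \<phi> t *\<^sub>C f t)"
proof -
  obtain P Q where PQ: "\<And>t. t \<notin> {P..Q} \<Longrightarrow> \<phi> t = 0" "\<And>t. t \<notin> {P..Q} \<Longrightarrow> vderiv \<phi> t = 0"
    using test_function_bounded_support[OF \<phi>] by metis
  have "primitive (\<lambda>t. \<phi> t *\<^sub>C F t) (\<lambda>t. vderiv \<phi> t *\<^sub>C F t + \<phi> t *\<^sub>C f t)"
    by (rule primitive_bilinear[OF bounded_bilinear_scaleC
          primitive_smooth[OF test_function_smooth[OF \<phi>]] F])
  then have "(LINT t|lborel. vderiv \<phi> t *\<^sub>C F t + \<phi> t *\<^sub>C f t) = 0"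
    by (rule primitive_compact_support(2)[of _ _ P Q]) (simp_all add: PQ scaleC_zero_left del: atLeastAtMost_iff)
  moreover have "integrable lborel (\<lambda>t. vderiv \<phi> t *\<^sub>C F t)"
    by (rule integrable_test_scaleC(2)[OF \<phi>])
      (intro borel_integrable_atLeastAtMost' primitive_continuous[OF F])
  moreover have "integrable lborel (\<lambda>t. \<phi> t *\<^sub>C f t)"
    by (rule integrable_test_scaleC(1)[OF \<phi> primitiveD(1)[OF F]])
  ultimately show ?thesis by (simp add: eq_neg_iff_add_eq_0)
qed

text \<open>
  The relation underlying \<open>W21\<close>, with the derivative as an explicit argument.
\<close>

definition has_weak_derivative ::
  "real set \<Rightarrow> 'h::{complex_inner, banach, second_countable_topology} L2 \<Rightarrow> 'h L2 \<Rightarrow> bool" where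
  "has_weak_derivative I u g \<longleftrightarrow> u \<in> L2_on I \<and> g \<in> L2_on I \<and> weak_derivative I u g"

lemma integral_test_cong:
  fixes f g :: "real \<Rightarrow> 'h::{complex_inner, banach, second_countable_topology}"
  assumes \<phi>: "\<phi> \<in> test_functions I" and ae: "AE t in lborel. t \<in> I \<longrightarrow> f t = g t"
    and int: "\<And>s t. set_integrable lborel {s..t} f" "\<And>s t. set_integrable lborel {s..t} g"
  shows "(LINT t|lborel. \<phi> t *\<^sub>C f t) = (LINT t|lborel. \<phi> t *\<^sub>C g t)"
    "(LINT t|lborel. vderiv \<phi> t *\<^sub>C f t) = (LINT t|lborel. vderiv \<phi> t *\<^sub>C g t)"
proof -
  note i1 = integrable_test_scaleC[OF \<phi> int(1)] and i2 = integrable_test_scaleC[OF \<phi> int(2)]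
  have "AE t in lborel. \<phi> t *\<^sub>C f t = \<phi> t *\<^sub>C g t"
    using ae by eventually_elim (metis test_function_outside[OF \<phi>] scaleC_zero_left)
  then show "(LINT t|lborel. \<phi> t *\<^sub>C f t) = (LINT t|lborel. \<phi> t *\<^sub>C g t)"
    using i1 i2 by (intro integral_cong_AE borel_measurable_integrable)
  have "AE t in lborel. vderiv \<phi> t *\<^sub>C f t = vderiv \<phi> t *\<^sub>C g t"
    using ae by eventually_elim (metis test_function_vderiv_outside[OF \<phi>] scaleC_zero_left)
  then show "(LINT t|lborel. vderiv \<phi> t *\<^sub>C f t) = (LINT t|lborel. vderiv \<phi> t *\<^sub>C g t)"
    using i1 i2 by (intro integral_cong_AE borel_measurable_integrable)
qed

lemma weak_derivative_of_primitive:
  fixes u g :: "'h::{complex_inner, banach, second_countable_topology} L2"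
  assumes F: "primitive F f"
    and u: "AE t in lborel. t \<in> I \<longrightarrow> rep_L2 u t = F t" and g: "AE t in lborel. t \<in> I \<longrightarrow> rep_L2 g t = f t"
  shows "weak_derivative I u g"
  unfolding weak_derivative_def
proof
  fix \<phi> assume \<phi>: "\<phi> \<in> test_functions I"
  have F_int: "set_integrable lborel {s..t} F" for s t
    by (intro borel_integrable_atLeastAtMost' primitive_continuous[OF F])
  show "(LINT t|lborel. vderiv \<phi> t *\<^sub>C rep_L2 u t) = - (LINT t|lborel. \<phi> t *\<^sub>C rep_L2 g t)"
    using test_function_by_parts[OF \<phi> F]
      integral_test_cong(2)[OF \<phi> u rep_L2_set_integrable F_int]
      integral_test_cong(1)[OF \<phi> g rep_L2_set_integrable primitiveD(1)[OF F]] by simp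
qed

lemma weak_derivative_unique:
  assumes I: "open I" and g: "has_weak_derivative I u g" and h: "has_weak_derivative I u h"
  shows "g = h"
proof -
  have "AE t in lborel. t \<in> I \<longrightarrow> rep_L2 g t - rep_L2 h t = 0"
  proof (rule fundamental_lemma[OF I])
    show "set_integrable lborel {p..q} (\<lambda>t. rep_L2 g t - rep_L2 h t)" for p q
      by (intro set_integral_diff rep_L2_set_integrable)
    fix \<phi> assume \<phi>: "\<phi> \<in> test_functions I"
    have "(LINT t|lborel. \<phi> t *\<^sub>C rep_L2 g t) = (LINT t|lborel. \<phi> t *\<^sub>C rep_L2 h t)"
      using g h \<phi> unfolding has_weak_derivative_def weak_derivative_def
      by (metis neg_equal_iff_equal)
    then show "(LINT t|lborel. \<phi> t *\<^sub>C (rep_L2 g t - rep_L2 h t)) = 0"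
      using integrable_test_scaleC(1)[OF \<phi> rep_L2_set_integrable[of _ _ g]]
        integrable_test_scaleC(1)[OF \<phi> rep_L2_set_integrable[of _ _ h]]
      by (simp add: bounded_bilinear.diff_right[OF bounded_bilinear_scaleC])
  qed
  moreover have "AE t in lborel. t \<notin> I \<longrightarrow> rep_L2 g t = 0" "AE t in lborel. t \<notin> I \<longrightarrow> rep_L2 h t = 0"
    using g h by (simp_all add: has_weak_derivative_def L2_on_def)
  ultimately have "AE t in lborel. rep_L2 g t = rep_L2 h t"
    by eventually_elim force
  then show ?thesis by (rule L2_eqI)
qed

text \<open>
  If \<open>F0\<close> is an indefinite integral of \<open>g\<close>, then \<open>u - F0\<close> has weak derivative zero and is constant almost
  everywhere by the lemma of du Bois-Reymond.
\<close>

lemma weak_derivative_primitive: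
  fixes u g :: "'h::{complex_inner, banach, second_countable_topology} L2"
  assumes I: "open I" "is_interval I" "I \<noteq> {}" and wd: "weak_derivative I u g"
  obtains F where "primitive F (rep_L2 g)" "AE t in lborel. t \<in> I \<longrightarrow> rep_L2 u t = F t"
proof -
  obtain F0 where F0: "primitive F0 (rep_L2 g)"
    using primitive_exists[OF rep_L2_set_integrable] by metis
  have F0_int: "set_integrable lborel {s..t} F0" for s t
    by (intro borel_integrable_atLeastAtMost' primitive_continuous[OF F0])
  obtain c where c: "AE t in lborel. t \<in> I \<longrightarrow> rep_L2 u t - F0 t = c"
  proof (rule du_Bois_Reymond[OF I])
    show "set_integrable lborel {p..q} (\<lambda>t. rep_L2 u t - F0 t)" for p q
      by (intro set_integral_diff rep_L2_set_integrable F0_int)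
    fix \<phi> assume \<phi>: "\<phi> \<in> test_functions I"
    show "(LINT t|lborel. vderiv \<phi> t *\<^sub>C (rep_L2 u t - F0 t)) = 0"
      using integrable_test_scaleC(2)[OF \<phi> rep_L2_set_integrable[of _ _ u]]
        integrable_test_scaleC(2)[OF \<phi> F0_int] test_function_by_parts[OF \<phi> F0] wd \<phi>
      by (simp add: bounded_bilinear.diff_right[OF bounded_bilinear_scaleC] weak_derivative_def)
  qed
  have "primitive (\<lambda>t. F0 t + c) (rep_L2 g)"
    using F0 by (simp add: primitive_def)
  moreover have "AE t in lborel. t \<in> I \<longrightarrow> rep_L2 u t = F0 t + c"
    using c by eventually_elim (auto simp: algebra_simps)
  ultimately show ?thesis by (rule that)
qed

section \<open>Boundary values and the formula of Green\<close>

lemma has_boundary_value_primitive: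
  assumes "primitive F f" "AE t in lborel. t \<in> I \<longrightarrow> rep_L2 u t = F t"
  shows "has_boundary_value I u c (F c)"
  unfolding has_boundary_value_def using assms primitive_continuous by blast

text \<open>
  The set where two continuous functions differ is open, and a nonempty open set is not null.
\<close>

lemma continuous_AE_eq:
  fixes f g :: "real \<Rightarrow> 'a::metric_space"
  assumes I: "open I" and f: "continuous_on I f" and g: "continuous_on I g"
    and ae: "AE t in lborel. t \<in> I \<longrightarrow> f t = g t" and t: "t \<in> I"
  shows "f t = g t"
proof (rule ccontr)
  assume ne: "f t \<noteq> g t"
  let ?S = "I \<inter> (\<lambda>t. dist (f t) (g t)) -` {0<..}"
  have S: "open ?S"
    by (rule continuous_open_preimage[OF continuous_on_dist[OF f g] I open_greaterThan])
  have "AE t in lborel. t \<notin> ?S" using ae by eventually_elim auto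
  then have "?S \<in> null_sets lborel"
    using S by (subst AE_iff_null_sets) auto
  then have "negligible ?S"
    by (metis negligible_iff_null_sets null_sets_completionI)
  moreover have "t \<in> ?S" using t ne by simp
  ultimately show False using open_not_negligible[OF S] by blast
qed

lemma has_boundary_value_unique:
  assumes I: "open I" and c: "c \<in> closure I"
    and x: "has_boundary_value I u c x" and y: "has_boundary_value I u c y"
  shows "x = y"
proof -
  obtain f where f: "continuous_on (closure I) f" "f c = x" "AE t in lborel. t \<in> I \<longrightarrow> rep_L2 u t = f t"
    using x by (auto simp: has_boundary_value_def)
  obtain g where g: "continuous_on (closure I) g" "g c = y" "AE t in lborel. t \<in> I \<longrightarrow> rep_L2 u t = g t"
    using y by (auto simp: has_boundary_value_def)
  have ae: "AE t in lborel. t \<in> I \<longrightarrow> f t = g t" using f(3) g(3) by eventually_elim auto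
  have "f t - g t = 0" if "t \<in> I" for t
    using continuous_AE_eq[OF I continuous_on_subset[OF f(1) closure_subset]
        continuous_on_subset[OF g(1) closure_subset] ae that] by simp
  then have "f c - g c = 0"
    by (rule continuous_constant_on_closure[OF continuous_on_diff[OF f(1) g(1)] _ c])
  then show ?thesis using f(2) g(2) by simp
qed

lemma has_boundary_value_scaleC:
  assumes "has_boundary_value I u c x" shows "has_boundary_value I (z *\<^sub>C u) c (z *\<^sub>C x)"
proof -
  obtain f where f: "continuous_on (closure I) f" "f c = x" "AE t in lborel. t \<in> I \<longrightarrow> rep_L2 u t = f t"
    using assms by (auto simp: has_boundary_value_def)
  have "continuous_on (closure I) (\<lambda>t. z *\<^sub>C f t)"
    by (rule bounded_linear.continuous_on[OF bounded_linear_scaleC f(1)])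
  moreover have "AE t in lborel. t \<in> I \<longrightarrow> rep_L2 (z *\<^sub>C u) t = z *\<^sub>C f t"
    using f(3) rep_L2_scaleC[of z u] by eventually_elim auto
  ultimately show ?thesis using f(2) unfolding has_boundary_value_def by blast
qed

lemma is_interval_halflines:
  fixes a b :: real shows "is_interval {..<a}" "is_interval {b<..}"
  by (auto simp: is_interval_1)

text \<open>
  The product rule makes \<open>F = \<langle>U, V\<rangle>\<close> an indefinite integral of \<open>f = \<langle>g, V\<rangle> + \<langle>U, k\<rangle>\<close>, where \<open>U\<close> and \<open>V\<close> are the
  continuous representatives of \<open>u\<close> and \<open>v\<close>. Both are integrable over \<open>I\<close>, which is what evaluating the
  integral of \<open>f\<close> over a half-line requires.
\<close>

lemma greens_formula:
  fixes u v g k :: "'h::{complex_inner, banach, second_countable_topology} L2"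
  assumes I: "open I" "is_interval I" "I \<noteq> {}" "c \<in> closure I"
    and u: "has_weak_derivative I u g" "has_boundary_value I u c x"
    and v: "has_weak_derivative I v k" "has_boundary_value I v c y"
  obtains F f where "primitive F f" "integrable lborel (\<lambda>t. indicat_real I t *\<^sub>R F t)"
    "integrable lborel (\<lambda>t. indicat_real I t *\<^sub>R f t)" "F c = inner x y"
    "inner g v + inner u k = (LINT t:I|lborel. f t)"
proof -
  obtain U where U: "primitive U (rep_L2 g)" "AE t in lborel. t \<in> I \<longrightarrow> rep_L2 u t = U t"
    using weak_derivative_primitive[OF I(1-3)] u(1) unfolding has_weak_derivative_def by metis
  obtain V where V: "primitive V (rep_L2 k)" "AE t in lborel. t \<in> I \<longrightarrow> rep_L2 v t = V t"
    using weak_derivative_primitive[OF I(1-3)] v(1) unfolding has_weak_derivative_def by metis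
  have Uc: "U c = x" and Vc: "V c = y"
    using has_boundary_value_unique[OF I(1,4)] has_boundary_value_primitive[OF U]
      has_boundary_value_primitive[OF V] u(2) v(2) by blast+
  define F where "F = (\<lambda>t. inner (U t) (V t))"
  define f where "f = (\<lambda>t. inner (rep_L2 g t) (V t) + inner (U t) (rep_L2 k t))"
  have F: "primitive F f"
    unfolding F_def f_def by (rule primitive_bilinear[OF bounded_bilinear_inner U(1) V(1)])
  have out: "AE t in lborel. t \<notin> I \<longrightarrow> rep_L2 u t = 0" "AE t in lborel. t \<notin> I \<longrightarrow> rep_L2 v t = 0"
    "AE t in lborel. t \<notin> I \<longrightarrow> rep_L2 g t = 0" "AE t in lborel. t \<notin> I \<longrightarrow> rep_L2 k t = 0"
    using u(1) v(1) by (simp_all add: has_weak_derivative_def L2_on_def)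
  have int: "integrable lborel (\<lambda>t. inner (rep_L2 p t) (rep_L2 q t))" for p q :: "'h L2"
    by (rule integrable_inner_square_integrable[OF rep_L2_square_integrable rep_L2_square_integrable])
  have I_sets: "I \<in> sets lborel" using I(1) by simp
  have cont: "continuous_on UNIV U" "continuous_on UNIV V"
    using U(1) V(1) primitive_continuous by blast+
  have measF: "(\<lambda>t. indicat_real I t *\<^sub>R F t) \<in> borel_measurable lborel"
    using I_sets borel_measurable_continuous_onI[OF primitive_continuous[OF F]]
    by (intro borel_measurable_scaleR) auto
  have measf: "(\<lambda>t. indicat_real I t *\<^sub>R f t) \<in> borel_measurable lborel"
    unfolding f_def
    using I_sets rep_L2_square_integrable[of g] rep_L2_square_integrable[of k]
      borel_measurable_continuous_onI[OF cont(1)] borel_measurable_continuous_onI[OF cont(2)]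
    by (intro borel_measurable_scaleR borel_measurable_add borel_measurable_inner)
      (auto simp: square_integrable_def)
  have aeF: "AE t in lborel. inner (rep_L2 u t) (rep_L2 v t) = indicat_real I t *\<^sub>R F t"
    using U(2) V(2) out by eventually_elim (auto simp: F_def indicator_def)
  have aef: "AE t in lborel. inner (rep_L2 g t) (rep_L2 v t) + inner (rep_L2 u t) (rep_L2 k t)
      = indicat_real I t *\<^sub>R f t"
    using U(2) V(2) out by eventually_elim (auto simp: f_def indicator_def)
  have intf: "integrable lborel (\<lambda>t. inner (rep_L2 g t) (rep_L2 v t) + inner (rep_L2 u t) (rep_L2 k t))"
    by (intro Bochner_Integration.integrable_add int)
  show ?thesis
  proof (rule that[OF F])
    show "integrable lborel (\<lambda>t. indicat_real I t *\<^sub>R F t)"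
      using Bochner_Integration.integrable_cong_AE[OF borel_measurable_integrable[OF int] measF aeF] int by blast
    show "integrable lborel (\<lambda>t. indicat_real I t *\<^sub>R f t)"
      using Bochner_Integration.integrable_cong_AE[OF borel_measurable_integrable[OF intf] measf aef] intf by blast
    show "F c = inner x y" by (simp add: F_def Uc Vc)
    show "inner g v + inner u k = (LINT t:I|lborel. f t)"
      unfolding inner_L2_integral set_lebesgue_integral_def
      using integral_cong_AE[OF borel_measurable_integrable[OF intf] measf aef] int by simp
  qed
qed

lemma greens_formula_left:
  fixes u v g k :: "'h::{complex_inner, banach, second_countable_topology} L2"
  assumes "has_weak_derivative {..<a} u g" "has_boundary_value {..<a} u a x"
    and "has_weak_derivative {..<a} v k" "has_boundary_value {..<a} v a y"
  shows "inner g v + inner u k = inner x y"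
proof -
  obtain F f where F: "primitive F f" "set_integrable lborel {..<a} F" "set_integrable lborel {..<a} f"
    "F a = inner x y" "inner g v + inner u k = (LINT t:{..<a}|lborel. f t)"
    by (rule greens_formula[OF open_lessThan is_interval_halflines(1) _ _ assms, folded set_integrable_def])
      auto
  have "set_integrable lborel {..<a} h \<longleftrightarrow> set_integrable lborel {..a} h" for h :: "real \<Rightarrow> real"
    by (rule set_integrable_discrete_difference[where X = "{a}"]) auto
  moreover have "(LINT t:{..<a}|lborel. f t) = (LINT t:{..a}|lborel. f t)"
    by (rule set_integral_discrete_difference[where X = "{a}"]) auto
  ultimately show ?thesis using LINT_left_halfline[OF F(1)] F by simp
qed

lemma greens_formula_right:
  fixes u v g k :: "'h::{complex_inner, banach, second_countable_topology} L2"
  assumes "has_weak_derivative {b<..} u g" "has_boundary_value {b<..} u b x"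
    and "has_weak_derivative {b<..} v k" "has_boundary_value {b<..} v b y"
  shows "inner g v + inner u k = - inner x y"
proof -
  obtain F f where F: "primitive F f" "set_integrable lborel {b<..} F" "set_integrable lborel {b<..} f"
    "F b = inner x y" "inner g v + inner u k = (LINT t:{b<..}|lborel. f t)"
    by (rule greens_formula[OF open_greaterThan is_interval_halflines(2) _ _ assms, folded set_integrable_def])
      auto
  have "set_integrable lborel {b<..} h \<longleftrightarrow> set_integrable lborel {b..} h" for h :: "real \<Rightarrow> real"
    by (rule set_integrable_discrete_difference[where X = "{b}"]) auto
  moreover have "(LINT t:{b<..}|lborel. f t) = (LINT t:{b..}|lborel. f t)"
    by (rule set_integral_discrete_difference[where X = "{b}"]) auto
  ultimately show ?thesis using LINT_right_halfline[OF F(1)] F by simp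
qed

section \<open>Bounded operators acting pointwise\<close>

text \<open>
  The operator that an operator \<open>T\<close> in \<open>H\<close> induces in \<open>L\<^sub>2(H, \<real>)\<close> by acting on values.
\<close>

definition L2_map :: "('h::{complex_inner, second_countable_topology} \<Rightarrow> 'h) \<Rightarrow> 'h L2 \<Rightarrow> 'h L2" where
  "L2_map T u = abs_L2 (\<lambda>t. T (rep_L2 u t))"

lemma square_integrable_bounded_linear:
  assumes T: "bounded_linear T" and f: "square_integrable f"
  shows "square_integrable (\<lambda>t. T (f t))"
  unfolding square_integrable_def
proof
  have meas: "(\<lambda>t. T (f t)) \<in> borel_measurable lborel"
    using f borel_measurable_continuous_onI[OF bounded_linear.continuous_on[OF T continuous_on_id]]
    by (auto simp: square_integrable_def intro: measurable_compose)
  then show "(\<lambda>t. T (f t)) \<in> borel_measurable lborel" .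
  obtain K where K: "\<And>x. norm (T x) \<le> norm x * K" using bounded_linear.bounded[OF T] by blast
  show "integrable lborel (\<lambda>t. (norm (T (f t)))\<^sup>2)"
  proof (rule Bochner_Integration.integrable_bound)
    show "integrable lborel (\<lambda>t. (norm (f t))\<^sup>2 * K\<^sup>2)"
      using f by (intro integrable_mult_left) (simp add: square_integrable_def)
    show "(\<lambda>t. (norm (T (f t)))\<^sup>2) \<in> borel_measurable lborel"
      using meas by simp
    have "(norm (T (f t)))\<^sup>2 \<le> (norm (f t) * K)\<^sup>2" for t
      using K by (intro power_mono) auto
    then show "AE t in lborel. norm ((norm (T (f t)))\<^sup>2) \<le> norm ((norm (f t))\<^sup>2 * K\<^sup>2)"
      by (simp add: power_mult_distrib)
  qed
qed

lemma rep_L2_map: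
  assumes "bounded_linear T" shows "AE t in lborel. rep_L2 (L2_map T u) t = T (rep_L2 u t)"
  unfolding L2_map_def
  by (rule rep_abs_L2[OF square_integrable_bounded_linear[OF assms rep_L2_square_integrable]])

lemma L2_on_map:
  assumes T: "bounded_linear T" and u: "u \<in> L2_on I" shows "L2_map T u \<in> L2_on I"
  using u rep_L2_map[OF T, of u] unfolding L2_on_def mem_Collect_eq
  by eventually_elim (simp add: linear_simps[OF T])

lemma has_weak_derivative_map:
  fixes u g :: "'h::{complex_inner, banach, second_countable_topology} L2"
  assumes T: "bounded_linear T" and I: "open I" "is_interval I" "I \<noteq> {}"
    and u: "has_weak_derivative I u g"
  shows "has_weak_derivative I (L2_map T u) (L2_map T g)"
proof -
  obtain U where U: "primitive U (rep_L2 g)" "AE t in lborel. t \<in> I \<longrightarrow> rep_L2 u t = U t"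
    using weak_derivative_primitive[OF I] u unfolding has_weak_derivative_def by metis
  have "weak_derivative I (L2_map T u) (L2_map T g)"
  proof (rule weak_derivative_of_primitive[OF primitive_bounded_linear[OF T U(1)]])
    show "AE t in lborel. t \<in> I \<longrightarrow> rep_L2 (L2_map T u) t = T (U t)"
      using U(2) rep_L2_map[OF T, of u] by eventually_elim auto
    show "AE t in lborel. t \<in> I \<longrightarrow> rep_L2 (L2_map T g) t = T (rep_L2 g t)"
      using rep_L2_map[OF T, of g] by eventually_elim auto
  qed
  then show ?thesis using u T by (simp add: has_weak_derivative_def L2_on_map)
qed

lemma has_boundary_value_map:
  assumes T: "bounded_linear T" and u: "has_boundary_value I u c x"
  shows "has_boundary_value I (L2_map T u) c (T x)"
proof -
  obtain f where f: "continuous_on (closure I) f" "f c = x" "AE t in lborel. t \<in> I \<longrightarrow> rep_L2 u t = f t"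
    using u by (auto simp: has_boundary_value_def)
  have "continuous_on (closure I) (\<lambda>t. T (f t))" by (rule bounded_linear.continuous_on[OF T f(1)])
  moreover have "AE t in lborel. t \<in> I \<longrightarrow> rep_L2 (L2_map T u) t = T (f t)"
    using f(3) rep_L2_map[OF T, of u] by eventually_elim auto
  ultimately show ?thesis using f(2) unfolding has_boundary_value_def by blast
qed

text \<open>
  A map on all of \<open>H\<close>, in contrast to the graphs used for operators with domains.
\<close>

definition bounded_selfadjoint :: "('h::complex_inner \<Rightarrow> 'h) \<Rightarrow> bool" where
  "bounded_selfadjoint T \<longleftrightarrow> bounded_linear T \<and> (\<forall>c x. T (c *\<^sub>C x) = c *\<^sub>C T x) \<and>
    (\<forall>x y. cinner (T x) y = cinner x (T y))"

lemma bounded_selfadjointD: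
  assumes "bounded_selfadjoint T"
  shows "bounded_linear T" "T (c *\<^sub>C x) = c *\<^sub>C T x" "cinner (T x) y = cinner x (T y)"
    "inner (T x) y = inner x (T y)"
  using assms unfolding bounded_selfadjoint_def by (simp_all flip: Re_cinner)

lemma inner_L2_map:
  assumes T: "bounded_selfadjoint T" shows "inner (L2_map T u) v = inner u (L2_map T v)"
  unfolding inner_L2_integral
proof (rule integral_cong_AE)
  show "AE t in lborel. inner (rep_L2 (L2_map T u) t) (rep_L2 v t) = inner (rep_L2 u t) (rep_L2 (L2_map T v) t)"
    using rep_L2_map[OF bounded_selfadjointD(1)[OF T], of u] rep_L2_map[OF bounded_selfadjointD(1)[OF T], of v]
    by eventually_elim (simp add: bounded_selfadjointD(4)[OF T])
qed (intro borel_measurable_integrable integrable_inner_square_integrable rep_L2_square_integrable)+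

section \<open>Prescribed boundary values\<close>

lemma square_integrable_continuous:
  fixes f :: "real \<Rightarrow> 'h::{complex_inner, banach, second_countable_topology}"
  assumes f: "continuous_on UNIV f" and supp: "\<And>t. t \<notin> {P..Q} \<Longrightarrow> f t = 0"
  shows "square_integrable f"
  unfolding square_integrable_def
proof
  show "f \<in> borel_measurable lborel" using borel_measurable_continuous_onI[OF f] by simp
  show "integrable lborel (\<lambda>t. (norm (f t))\<^sup>2)"
    by (rule integrable_of_set_integrable[OF borel_integrable_atLeastAtMost'[of P Q]])
      (use supp in \<open>auto intro!: continuous_intros continuous_on_subset[OF f]\<close>)
qed

lemma square_integrable_indicator:
  assumes f: "square_integrable f" and I: "I \<in> sets borel"
  shows "square_integrable (\<lambda>t. indicat_real I t *\<^sub>R f t)"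
proof -
  have "integrable lborel (\<lambda>t. indicat_real I t *\<^sub>R (norm (f t))\<^sup>2)"
    using f I by (intro integrable_mult_indicator) (auto simp: square_integrable_def)
  moreover have "indicat_real I t *\<^sub>R (norm (f t))\<^sup>2 = (norm (indicat_real I t *\<^sub>R f t))\<^sup>2" for t
    by (simp add: indicator_def)
  ultimately show ?thesis
    using f I by (auto simp: square_integrable_def intro!: borel_measurable_scaleR)
qed

lemma square_integrable_test:
  fixes x :: "'h::{complex_inner, banach, second_countable_topology}"
  assumes "\<phi> \<in> test_functions I"
  shows "square_integrable (\<lambda>t. \<phi> t *\<^sub>C x)" "square_integrable (\<lambda>t. vderiv \<phi> t *\<^sub>C x)"
proof -
  obtain P Q where PQ: "\<And>t. t \<notin> {P..Q} \<Longrightarrow> \<phi> t = 0" "\<And>t. t \<notin> {P..Q} \<Longrightarrow> vderiv \<phi> t = 0"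
    using test_function_bounded_support[OF assms] by metis
  note sm = test_function_smooth[OF assms]
  show "square_integrable (\<lambda>t. \<phi> t *\<^sub>C x)" "square_integrable (\<lambda>t. vderiv \<phi> t *\<^sub>C x)"
    by (rule square_integrable_continuous[where P = P and Q = Q],
        intro bounded_bilinear.continuous_on[OF bounded_bilinear_scaleC] continuous_on_const
          smooth_continuous smooth_vderiv(1) sm,
        simp add: PQ scaleC_zero_left del: atLeastAtMost_iff)+
qed

lemma primitive_scaleC_const:
  fixes x :: "'h::{complex_inner, banach, second_countable_topology}"
  assumes "smooth \<phi>" shows "primitive (\<lambda>t. \<phi> t *\<^sub>C x) (\<lambda>t. vderiv \<phi> t *\<^sub>C x)"
  by (rule primitive_bounded_linear[OF bounded_bilinear.bounded_linear_left[OF bounded_bilinear_scaleC]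
        primitive_smooth[OF assms]])

lemma cutoff_function:
  obtains \<beta> where "\<beta> \<in> test_functions UNIV" "\<beta> (c::real) = 1"
proof
  define \<beta> where "\<beta> = (\<lambda>t. of_real (1 / bump (c - 1) (c + 1) 0 c) * of_real (bump (c - 1) (c + 1) 0 t) :: complex)"
  show "\<beta> \<in> test_functions UNIV"
  proof (rule test_functionI)
    show "smooth \<beta>" unfolding \<beta>_def by (intro smooth_mult smooth_const smooth_bump)
    show "\<beta> t = 0" if "t \<notin> {c - 1..c + 1}" for t
    proof -
      have "bump (c - 1) (c + 1) 0 t = 0" by (rule bump_outside) (use that in auto)
      then show ?thesis by (simp add: \<beta>_def)
    qed
  qed simp
  show "\<beta> c = 1" using bump_pos[of "c - 1" c "c + 1" 0] by (simp add: \<beta>_def)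
qed

text \<open>
  A smooth cutoff \<open>\<beta>\<close> with \<open>\<beta> c = 1\<close>, multiplied by \<open>x\<close> and restricted to \<open>I\<close>. The last clause records
  this form, on which the inclusion hypotheses of the theorem can be tested.
\<close>

lemma boundary_value_attained:
  fixes x :: "'h::{complex_inner, banach, second_countable_topology}"
  assumes I: "open I"
  obtains u g where "has_weak_derivative I u g" "has_boundary_value I u c x"
    "\<exists>\<beta>. continuous_on UNIV \<beta> \<and> \<beta> c = 1 \<and> (AE t in lborel. t \<in> I \<longrightarrow> rep_L2 u t = \<beta> t *\<^sub>C x)"
proof -
  obtain \<beta> where \<beta>: "\<beta> \<in> test_functions UNIV" "\<beta> c = 1" using cutoff_function by blast
  note sm = test_function_smooth[OF \<beta>(1)]
  define u where "u = abs_L2 (\<lambda>t. indicat_real I t *\<^sub>R (\<beta> t *\<^sub>C x))"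
  define g where "g = abs_L2 (\<lambda>t. indicat_real I t *\<^sub>R (vderiv \<beta> t *\<^sub>C x))"
  have u: "AE t in lborel. rep_L2 u t = indicat_real I t *\<^sub>R (\<beta> t *\<^sub>C x)"
    unfolding u_def by (rule rep_abs_L2[OF
          square_integrable_indicator[OF square_integrable_test(1)[OF \<beta>(1)] borel_open[OF I]]])
  have g: "AE t in lborel. rep_L2 g t = indicat_real I t *\<^sub>R (vderiv \<beta> t *\<^sub>C x)"
    unfolding g_def by (rule rep_abs_L2[OF
          square_integrable_indicator[OF square_integrable_test(2)[OF \<beta>(1)] borel_open[OF I]]])
  have uI: "AE t in lborel. t \<in> I \<longrightarrow> rep_L2 u t = \<beta> t *\<^sub>C x"
    using u by eventually_elim simp
  have gI: "AE t in lborel. t \<in> I \<longrightarrow> rep_L2 g t = vderiv \<beta> t *\<^sub>C x"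
    using g by eventually_elim simp
  note prim = primitive_scaleC_const[OF sm, of x]
  show ?thesis
  proof (rule that)
    have "u \<in> L2_on I" unfolding L2_on_def mem_Collect_eq using u by eventually_elim simp
    moreover have "g \<in> L2_on I" unfolding L2_on_def mem_Collect_eq using g by eventually_elim simp
    ultimately show "has_weak_derivative I u g"
      using weak_derivative_of_primitive[OF prim uI gI] by (simp add: has_weak_derivative_def)
    show "has_boundary_value I u c x"
      using has_boundary_value_primitive[OF prim uI, of c] \<beta>(2) scaleC_of_real[of 1 x] by simp
    show "\<exists>\<beta>. continuous_on UNIV \<beta> \<and> \<beta> c = 1 \<and> (AE t in lborel. t \<in> I \<longrightarrow> rep_L2 u t = \<beta> t *\<^sub>C x)"
      using smooth_continuous[OF sm, of UNIV] \<beta>(2) uI by blast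
  qed
qed

text \<open>
  Apply the inclusion to \<open>\<beta> \<otimes> x\<close> with a cutoff \<open>\<beta>\<close> that equals 1 at some point of \<open>I\<close>. Then \<open>\<beta>(t) x\<close> lies in
  the domain of \<open>S\<close> for almost all \<open>t \<in> I\<close>, hence for some \<open>t\<close> with \<open>\<beta>(t) \<noteq> 0\<close>.
\<close>

lemma preserves_W21_everywhere_defined:
  fixes S :: "('h::{complex_inner, banach, second_countable_topology} \<times> 'h) set"
  assumes pres: "preserves_W21 S I" and I: "open I" "I \<noteq> {}" and S: "complex_subspace S"
  shows "\<exists>y. (x, y) \<in> S"
proof -
  obtain c where c: "c \<in> I" using I(2) by blast
  obtain u g \<beta> where u: "has_weak_derivative I u g" and \<beta>: "continuous_on UNIV \<beta>" "\<beta> c = 1"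
    "AE t in lborel. t \<in> I \<longrightarrow> rep_L2 u t = \<beta> t *\<^sub>C x"
    using boundary_value_attained[OF I(1), where c = c and x = x] by metis
  have "u \<in> W21 I" using u by (auto simp: W21_def has_weak_derivative_def)
  then obtain w where w: "AE t in lborel. t \<in> I \<longrightarrow> (rep_L2 u t, rep_L2 w t) \<in> S"
    using pres by (auto simp: preserves_W21_def)
  let ?O = "I \<inter> \<beta> -` (- {0})"
  have O: "open ?O"
    by (rule continuous_open_preimage[OF continuous_on_subset[OF \<beta>(1)] I(1)]) auto
  have "\<exists>t\<in>?O. (\<beta> t *\<^sub>C x, rep_L2 w t) \<in> S"
  proof (rule ccontr)
    assume neg: "\<not> ?thesis"
    have "AE t in lborel. t \<notin> ?O"
      using w \<beta>(3) by eventually_elim (use neg in auto)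
    then have "?O \<in> null_sets lborel"
      using O by (subst AE_iff_null_sets) auto
    then have "negligible ?O"
      by (metis negligible_iff_null_sets null_sets_completionI)
    moreover have "?O \<noteq> {}" using c \<beta>(2) by auto
    ultimately show False using open_not_negligible[OF O] by blast
  qed
  then obtain t where t: "\<beta> t \<noteq> 0" "(\<beta> t *\<^sub>C x, rep_L2 w t) \<in> S" by auto
  have "inverse (\<beta> t) *\<^sub>C (\<beta> t *\<^sub>C x, rep_L2 w t) \<in> S"
    using S t(2) by (simp add: complex_subspace_def)
  then show ?thesis
    using t(1) scaleC_of_real[of 1 x] by (auto simp: scaleC_prod_def scaleC_scaleC)
qed

section \<open>Pairing with test functions\<close>

lemma test_function_cnj:
  assumes "\<phi> \<in> test_functions I"
  shows "(\<lambda>t. cnj (\<phi> t)) \<in> test_functions I" "vderiv (\<lambda>t. cnj (\<phi> t)) t = cnj (vderiv \<phi> t)"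
proof -
  show "(\<lambda>t. cnj (\<phi> t)) \<in> test_functions I"
    using assms smooth_cnj[of \<phi>] by (simp add: test_functions_def)
  show "vderiv (\<lambda>t. cnj (\<phi> t)) t = cnj (vderiv \<phi> t)"
    using has_vector_derivative_cnj[OF smooth_vderiv(2)[OF test_function_smooth[OF assms], of t]]
    by (simp add: vector_derivative_at)
qed

lemma cinner_scaleC_right: "cinner x (c *\<^sub>C y) = cnj c * cinner x y"
  by (metis cinner_commute cinner_scaleC_left complex_cnj_mult)

lemma cinner_scaleC_swap: "cinner (c *\<^sub>C x) y = cinner x (cnj c *\<^sub>C y)"
  by (simp add: cinner_scaleC_left cinner_scaleC_right)

lemma cinner_test_integral:
  fixes f :: "'h::{complex_inner, banach, second_countable_topology}"
  assumes \<phi>: "\<phi> \<in> test_functions I"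
  shows "(LINT t|lborel. cinner (\<phi> t *\<^sub>C f) (rep_L2 u t)) = cinner f (LINT t|lborel. cnj (\<phi> t) *\<^sub>C rep_L2 u t)"
    "(LINT t|lborel. cinner (vderiv \<phi> t *\<^sub>C f) (rep_L2 u t))
      = cinner f (LINT t|lborel. vderiv (\<lambda>t. cnj (\<phi> t)) t *\<^sub>C rep_L2 u t)"
  unfolding cinner_scaleC_swap test_function_cnj(2)[OF \<phi>, symmetric]
  using integrable_test_scaleC[OF test_function_cnj(1)[OF \<phi>] rep_L2_set_integrable[of _ _ u]]
  by (auto intro!: integral_bounded_linear bounded_bilinear.bounded_linear_right[OF bounded_bilinear_cinner])

section \<open>Hilbert space geometry\<close>

text \<open>
  The projection theorem: by the parallelogram law a minimising sequence for the distance from a point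
  \<open>x\<close> outside \<open>M\<close> is Cauchy, and the difference of \<open>x\<close> and its limit is orthogonal to \<open>M\<close>.
\<close>

lemma closed_subspace_orthogonal_vector:
  fixes M :: "'h::{real_inner, banach} set"
  assumes M: "subspace M" "closed M" "M \<noteq> UNIV"
  obtains z where "z \<noteq> 0" "\<And>m. m \<in> M \<Longrightarrow> inner z m = 0"
proof -
  obtain x where x: "x \<notin> M" using M(3) by blast
  define D where "D = (\<lambda>m. (norm (x - m))\<^sup>2) ` M"
  define q where "q = Inf D"
  have bdd: "bdd_below D" by (rule bdd_belowI[of _ 0]) (auto simp: D_def)
  have ne: "D \<noteq> {}" using subspace_0[OF M(1)] by (auto simp: D_def)
  have q_le: "q \<le> (norm (x - m))\<^sup>2" if "m \<in> M" for m
    unfolding q_def by (rule cInf_lower[OF _ bdd]) (use that in \<open>simp add: D_def\<close>)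
  have "\<exists>m\<in>M. (norm (x - m))\<^sup>2 < q + inverse (Suc n)" for n
  proof -
    have "\<exists>y\<in>D. y < q + inverse (Suc n)"
      unfolding q_def by (rule cInf_lessD[OF ne]) simp
    then show ?thesis by (auto simp: D_def)
  qed
  then obtain m where m: "\<And>n. m n \<in> M" "\<And>n. (norm (x - m n))\<^sup>2 < q + inverse (Suc n)"
    by metis
  have close: "(norm (m n - m k))\<^sup>2 \<le> 2 * inverse (Suc n) + 2 * inverse (Suc k)" for n k
  proof -
    have "(1/2) *\<^sub>R (m n + m k) \<in> M"
      using M(1) m(1) by (intro subspace_scale subspace_add)
    then have "q \<le> (norm (x - (1/2) *\<^sub>R (m n + m k)))\<^sup>2" by (rule q_le)
    moreover have "(norm (m n - m k))\<^sup>2 = 2 * (norm (x - m n))\<^sup>2 + 2 * (norm (x - m k))\<^sup>2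
        - 4 * (norm (x - (1/2) *\<^sub>R (m n + m k)))\<^sup>2"
      unfolding power2_norm_eq_inner
      by (simp add: inner_diff_left inner_diff_right inner_add_left inner_add_right
          inner_commute algebra_simps)
    ultimately show ?thesis using m(2)[of n] m(2)[of k] by linarith
  qed
  have "Cauchy m"
  proof (rule CauchyI)
    fix e :: real assume "e > 0"
    obtain N where N: "inverse (Suc N) < e\<^sup>2 / 4"
      using reals_Archimedean[of "e\<^sup>2 / 4"] \<open>e > 0\<close> by auto
    have "norm (m n - m k) < e" if "n \<ge> N" "k \<ge> N" for n k
    proof -
      have "inverse (real (Suc n)) \<le> inverse (Suc N)" "inverse (real (Suc k)) \<le> inverse (Suc N)"
        using that by simp_all
      then have "(norm (m n - m k))\<^sup>2 < e\<^sup>2"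
        using close[of n k] N by linarith
      then show ?thesis using \<open>e > 0\<close> by (simp add: power_less_imp_less_base)
    qed
    then show "\<exists>N. \<forall>n\<ge>N. \<forall>k\<ge>N. norm (m n - m k) < e" by blast
  qed
  then obtain y where y: "m \<longlonglongrightarrow> y" using Cauchy_convergent_iff convergent_def by blast
  have yM: "y \<in> M" by (rule closed_sequentially[OF M(2) m(1) y])
  have lim_q: "(\<lambda>n. q + inverse (Suc n)) \<longlonglongrightarrow> q + 0"
    by (intro tendsto_intros LIMSEQ_inverse_real_of_nat)
  have lim_m: "(\<lambda>n. (norm (x - m n))\<^sup>2) \<longlonglongrightarrow> (norm (x - y))\<^sup>2"
    by (intro tendsto_intros y)
  have y_le: "(norm (x - y))\<^sup>2 \<le> q + 0"
    using m(2) by (intro LIMSEQ_le[OF lim_m lim_q] exI[of _ 0] allI impI less_imp_le)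
  have "inner (x - y) w = 0" if w: "w \<in> M" for w
  proof (rule ccontr)
    assume nz: "inner (x - y) w \<noteq> 0"
    then have "w \<noteq> 0" by auto
    (* moving from y by r w along M would decrease the distance *)
    define r where "r = inner (x - y) w / inner w w"
    have "y + r *\<^sub>R w \<in> M" using M(1) yM w by (intro subspace_add subspace_scale)
    from q_le[OF this] have "(norm (x - y))\<^sup>2 \<le> (norm (x - (y + r *\<^sub>R w)))\<^sup>2"
      using y_le by linarith
    also have "\<dots> = (norm (x - y))\<^sup>2 - 2 * r * inner (x - y) w + r * r * inner w w"
      unfolding power2_norm_eq_inner
      by (simp add: inner_diff_left inner_diff_right inner_add_left inner_add_right
          inner_commute algebra_simps)
    also have "\<dots> = (norm (x - y))\<^sup>2 - (inner (x - y) w)\<^sup>2 / inner w w"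
      using \<open>w \<noteq> 0\<close> by (simp add: r_def field_simps power2_eq_square)
    finally have "(inner (x - y) w)\<^sup>2 / inner w w \<le> 0" by simp
    moreover have "(inner (x - y) w)\<^sup>2 / inner w w > 0"
      using nz \<open>w \<noteq> 0\<close> by simp
    ultimately show False by linarith
  qed
  then show ?thesis using that[of "x - y"] x yM by auto
qed

text \<open>
  The theorem of Hellinger and Toeplitz. By symmetry \<open>\<parallel>T x\<parallel> \<le> n\<close> is equivalent to the closed conditions
  \<open>\<bar>\<langle>x, T y\<rangle>\<bar> \<le> n \<parallel>y\<parallel>\<close> for all \<open>y\<close>, so the sets where it holds are closed; they cover the space, and by
  Baire's theorem one of them contains a ball.
\<close>

lemma symmetric_imp_bounded_linear:
  fixes T :: "'h::{real_inner, banach} \<Rightarrow> 'h"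
  assumes sym: "\<And>x y. inner (T x) y = inner x (T y)"
  shows "bounded_linear T"
proof -
  have eqI: "u = v" if "\<And>z. inner u z = inner v z" for u v :: 'h
    using that[of "u - v"] by (metis inner_diff_left inner_eq_zero_iff right_minus_eq)
  have add: "T (x + y) = T x + T y" for x y
    by (rule eqI) (simp add: sym inner_add_left)
  have scale: "T (r *\<^sub>R x) = r *\<^sub>R T x" for r x
    by (rule eqI) (simp add: sym)
  interpret T: linear T by (rule linearI) (rule add, rule scale)
  define E where "E = (\<lambda>n::nat. {x. norm (T x) \<le> real n})"
  have E_eq: "E n = (\<Inter>y. {x. \<bar>inner x (T y)\<bar> \<le> real n * norm y})" for n
  proof (intro set_eqI iffI)
    fix x assume x: "x \<in> E n"
    have "\<bar>inner x (T y)\<bar> \<le> real n * norm y" for y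
      using Cauchy_Schwarz_ineq2[of "T x" y] x mult_right_mono[of "norm (T x)" "real n" "norm y"]
      by (simp add: E_def sym)
    then show "x \<in> (\<Inter>y. {x. \<bar>inner x (T y)\<bar> \<le> real n * norm y})" by blast
  next
    fix x assume "x \<in> (\<Inter>y. {x. \<bar>inner x (T y)\<bar> \<le> real n * norm y})"
    then have "\<bar>inner x (T (T x))\<bar> \<le> real n * norm (T x)" by blast
    then have "norm (T x) * norm (T x) \<le> real n * norm (T x)"
      by (simp add: sym[symmetric] power2_norm_eq_inner[symmetric] power2_eq_square)
    then show "x \<in> E n" unfolding E_def by (cases "T x = 0") auto
  qed
  have closed: "closed (E n)" for n
    unfolding E_eq by (intro closed_INT ballI closed_Collect_le continuous_intros)
  have "\<exists>n. interior (E n) \<noteq> {}"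
  proof (rule ccontr)
    assume "\<not> (\<exists>n. interior (E n) \<noteq> {})"
    then have "euclidean interior_of (\<Union>(range E)) = {}"
      using closed by (intro Baire_category_alt disjI1 completely_metrizable_space_euclidean) auto
    moreover have "\<Union>(range E) = UNIV"
    proof (intro set_eqI iffI UNIV_I)
      fix x
      obtain n :: nat where "norm (T x) \<le> n" using real_arch_simple by blast
      then show "x \<in> \<Union>(range E)" by (auto simp: E_def)
    qed
    ultimately show False by simp
  qed
  then obtain n x e where e: "e > 0" "cball x e \<subseteq> E n"
    by (metis all_not_in_conv mem_interior_cball)
  (* the ball is centred at x, and z = (x + z) - x *)
  have small: "norm (T z) \<le> 2 * real n" if "norm z \<le> e" for z
  proof -
    have "x + z \<in> cball x e" "x \<in> cball x e" using that e(1) by (simp_all add: dist_norm)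
    then have "x + z \<in> E n" "x \<in> E n" using e(2) by blast+
    then have "norm (T (x + z)) \<le> n" "norm (T x) \<le> n" by (simp_all add: E_def)
    moreover have "T z = T (x + z) - T x" by (simp add: add)
    ultimately show ?thesis using norm_triangle_ineq4[of "T (x + z)" "T x"] by simp
  qed
  have "norm (T z) \<le> norm z * (2 * real n / e)" for z
  proof (cases "z = 0")
    case False
    have "norm (T ((e / norm z) *\<^sub>R z)) \<le> 2 * real n"
      using False e(1) by (intro small) simp
    then show ?thesis using False e(1) by (simp add: scale field_simps)
  qed (simp add: T.zero)
  then show ?thesis by (rule bounded_linear_intro[OF add scale])
qed

text \<open>
  \<open>G\<close> is its own orthogonal companion for the indefinite form \<open>\<langle>x, x'\<rangle> - \<langle>y, y'\<rangle>\<close>. Being neutral it is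
  isometric, and being closed it therefore has a closed domain. If \<open>z\<close> is orthogonal to the domain then
  \<open>(z, 0)\<close> is orthogonal to \<open>G\<close>, hence belongs to \<open>G\<close>, and the isometry gives \<open>z = 0\<close>.
\<close>

lemma neutral_relation_domain:
  fixes G :: "('h::{real_inner, banach} \<times> 'h) set"
  assumes neutral: "\<And>p q x y. (p, q) \<in> G \<Longrightarrow> (x, y) \<in> G \<Longrightarrow> inner p x = inner q y"
    and maximal: "\<And>x y. (\<And>p q. (p, q) \<in> G \<Longrightarrow> inner p x = inner q y) \<Longrightarrow> (x, y) \<in> G"
  shows "\<exists>y. (x, y) \<in> G"
proof -
  have iso: "norm x = norm y" if "(x, y) \<in> G" for x y
    using neutral[OF that that] by (simp add: norm_eq_sqrt_inner)
  have add: "(x + x', y + y') \<in> G" if "(x, y) \<in> G" "(x', y') \<in> G" for x y x' y'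
    using neutral[OF _ that(1)] neutral[OF _ that(2)] by (intro maximal) (simp add: inner_add_right)
  have scale: "(r *\<^sub>R x, r *\<^sub>R y) \<in> G" if "(x, y) \<in> G" for x y r
    using neutral[OF _ that] by (intro maximal) simp
  have zero: "(0, 0) \<in> G" by (intro maximal) simp
  let ?M = "{x. \<exists>y. (x, y) \<in> G}"
  have sub: "subspace ?M" using add scale zero unfolding subspace_def by blast
  have "closed ?M"
    unfolding closed_sequential_limits
  proof (intro allI impI, elim conjE)
    fix X l assume "\<forall>n. X n \<in> ?M" and X: "X \<longlonglongrightarrow> l"
    then obtain Y where Y: "\<And>n. (X n, Y n) \<in> G" by simp metis
    have "(X n - X k, Y n - Y k) \<in> G" for n k
      using add[OF Y[of n] scale[OF Y[of k], of "-1"]] by simp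
    then have "norm (X n - X k) = norm (Y n - Y k)" for n k by (rule iso)
    then have "Cauchy Y" using LIMSEQ_imp_Cauchy[OF X] by (simp add: Cauchy_iff)
    then obtain y where y: "Y \<longlonglongrightarrow> y" using Cauchy_convergent_iff convergent_def by blast
    have "inner p l = inner q y" if "(p, q) \<in> G" for p q
    proof -
      have "(\<lambda>n. inner p (X n)) \<longlonglongrightarrow> inner p l" by (intro tendsto_intros X)
      moreover have "(\<lambda>n. inner q (Y n)) \<longlonglongrightarrow> inner q y" by (intro tendsto_intros y)
      moreover have "inner p (X n) = inner q (Y n)" for n using neutral[OF that Y] .
      ultimately show ?thesis using LIMSEQ_unique by auto
    qed
    then have "(l, y) \<in> G" by (rule maximal)
    then show "l \<in> ?M" by blast
  qed
  have "?M = UNIV"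
  proof (rule ccontr)
    assume "?M \<noteq> UNIV"
    then obtain z where z: "z \<noteq> 0" "\<And>m. m \<in> ?M \<Longrightarrow> inner z m = 0"
      using closed_subspace_orthogonal_vector[OF sub \<open>closed ?M\<close>] by metis
    have "inner p z = inner q 0" if "(p, q) \<in> G" for p q
      using z(2)[of p] that by (auto simp: inner_commute)
    then have "(z, 0) \<in> G" by (rule maximal)
    then show False using iso z(1) by fastforce
  qed
  then show ?thesis by blast
qed

text \<open>
  The hypotheses are symmetric in the two components, so \<open>G\<close> has full domain and full range; being
  isometric it is the graph of a surjective isometry, which is complex linear because \<open>G\<close> is.
\<close>

lemma neutral_relation_unitary:
  fixes G :: "('h::{complex_inner, banach} \<times> 'h) set"
  assumes neutral: "\<And>p q x y. (p, q) \<in> G \<Longrightarrow> (x, y) \<in> G \<Longrightarrow> inner p x = inner q y"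
    and maximal: "\<And>x y. (\<And>p q. (p, q) \<in> G \<Longrightarrow> inner p x = inner q y) \<Longrightarrow> (x, y) \<in> G"
    and scaleC: "\<And>c x y. (x, y) \<in> G \<Longrightarrow> (c *\<^sub>C x, c *\<^sub>C y) \<in> G"
  obtains W where "unitary_op W" "\<And>x y. (x, y) \<in> G \<longleftrightarrow> y = W x"
proof -
  have dom: "\<exists>y. (x, y) \<in> G" for x
    using neutral maximal by (rule neutral_relation_domain)
  have ran: "\<exists>x. (x, y) \<in> G" for y
  proof -
    have "\<exists>x. (y, x) \<in> G\<inverse>"
    proof (rule neutral_relation_domain)
      show "inner p x = inner q z" if "(p, q) \<in> G\<inverse>" "(x, z) \<in> G\<inverse>" for p q x z
        using neutral[of q p z x] that by simp
      show "(x, z) \<in> G\<inverse>" if orth: "\<And>p q. (p, q) \<in> G\<inverse> \<Longrightarrow> inner p x = inner q z" for x z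
      proof -
        have "(z, x) \<in> G"
          by (rule maximal) (use orth in \<open>simp add: orth[symmetric]\<close>)
        then show ?thesis by simp
      qed
    qed
    then show ?thesis by simp
  qed
  have diff: "(x - x', y - y') \<in> G" if "(x, y) \<in> G" "(x', y') \<in> G" for x y x' y'
    using neutral[OF _ that(1)] neutral[OF _ that(2)] by (intro maximal) (simp add: inner_diff_right)
  have add: "(x + x', y + y') \<in> G" if "(x, y) \<in> G" "(x', y') \<in> G" for x y x' y'
    using neutral[OF _ that(1)] neutral[OF _ that(2)] by (intro maximal) (simp add: inner_add_right)
  have unique: "y = y'" if "(x, y) \<in> G" "(x, y') \<in> G" for x y y'
    using neutral[OF diff[OF that] diff[OF that]] by simp
  define W where "W = (\<lambda>x. THE y. (x, y) \<in> G)"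
  have W: "(x, y) \<in> G \<longleftrightarrow> y = W x" for x y
    using dom[of x] unique unfolding W_def by (metis (mono_tags, lifting) theI)
  have iso: "inner (W x) (W y) = inner x y" for x y
    using neutral[of x "W x" y "W y"] W by simp
  have W_scale: "W (c *\<^sub>C x) = c *\<^sub>C W x" for c x
    using scaleC[of x "W x" c] W by metis
  have "cinner (W x) (W y) = cinner x y" for x y
    by (simp add: cinner_conv_inner iso W_scale[symmetric])
  moreover have "W (x + y) = W x + W y" for x y
    using add[of x "W x" y "W y"] W by metis
  moreover have "surj W" using ran W by (metis surjI)
  ultimately have "unitary_op W" using W_scale by (simp add: unitary_op_def)
  then show ?thesis using that W by blast
qed

section \<open>Minimal and maximal operators of a bounded coefficient\<close>

lemma cinner_zero_left [simp]: "cinner 0 y = 0" and cinner_zero_right [simp]: "cinner y 0 = 0"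
  by (rule bounded_bilinear.zero_left[OF bounded_bilinear_cinner]
      bounded_bilinear.zero_right[OF bounded_bilinear_cinner])+

lemma cinner_abs_L2:
  assumes f: "square_integrable f"
  shows "cinner (abs_L2 f) v = (LINT t|lborel. cinner (f t) (rep_L2 v t))"
  unfolding cinner_L2_integral
proof (rule integral_cong_AE)
  show "AE t in lborel. cinner (rep_L2 (abs_L2 f) t) (rep_L2 v t) = cinner (f t) (rep_L2 v t)"
    using rep_abs_L2[OF f] by eventually_elim simp
qed (intro borel_measurable_integrable integrable_cinner_square_integrable rep_L2_square_integrable f)+

lemma cinner_abs_L2_map:
  assumes T: "bounded_selfadjoint T" and f: "square_integrable f"
  shows "(LINT t|lborel. cinner (T (f t)) (rep_L2 u t)) = cinner (abs_L2 f) (L2_map T u)"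
  unfolding cinner_abs_L2[OF f]
proof (rule integral_cong_AE)
  note bl = bounded_selfadjointD(1)[OF T]
  show "AE t in lborel. cinner (T (f t)) (rep_L2 u t) = cinner (f t) (rep_L2 (L2_map T u) t)"
    using rep_L2_map[OF bl, of u] by eventually_elim (simp add: bounded_selfadjointD(3)[OF T])
qed (intro borel_measurable_integrable integrable_cinner_square_integrable rep_L2_square_integrable
    square_integrable_bounded_linear[OF bounded_selfadjointD(1)[OF T]] f)+

lemma square_integrable_sum:
  assumes "\<And>j. j < (n::nat) \<Longrightarrow> square_integrable (f j)"
  shows "square_integrable (\<lambda>t. \<Sum>j<n. f j t)"
  using assms by (induction n) (auto intro: square_integrable_zero square_integrable_add)

text \<open>
  The defining equations of the adjoint are closed conditions on the graph.
\<close>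

lemma adjoint_op_closure: "adjoint_op X (closure R) = adjoint_op X R"
proof
  show "adjoint_op X (closure R) \<subseteq> adjoint_op X R"
    using closure_subset[of R] by (fastforce simp: adjoint_op_def)
  show "adjoint_op X R \<subseteq> adjoint_op X (closure R)"
  proof
    fix vw assume vw_in: "vw \<in> adjoint_op X R"
    obtain v w where vw_eq: "vw = (v, w)" by (cases vw)
    with vw_in have vw: "vw = (v, w)" "v \<in> X" "w \<in> X" "\<And>u z. (u, z) \<in> R \<Longrightarrow> cinner z v = cinner u w"
      by (auto simp: adjoint_op_def)
    have cont: "continuous_on UNIV (\<lambda>p. cinner (snd p) v)" "continuous_on UNIV (\<lambda>p. cinner (fst p) w)"
      by (intro bounded_bilinear.continuous_on[OF bounded_bilinear_cinner] continuous_intros)+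
    have "closed {p. cinner (snd p) v = cinner (fst p) w}"
      by (rule closed_Collect_eq[OF cont])
    then have "closure R \<subseteq> {p. cinner (snd p) v = cinner (fst p) w}"
      using vw(4) by (intro closure_minimal) auto
    then show "vw \<in> adjoint_op X (closure R)"
      using vw by (auto simp: adjoint_op_def)
  qed
qed

text \<open>
  A selfadjoint operator \<open>A\<close>, given as a graph, whose domain is all of \<open>H\<close>, together with the bounded map
  \<open>T\<close> of which it is the graph.
\<close>

locale everywhere_defined_operator =
  fixes T :: "'h::{complex_inner, banach, second_countable_topology} \<Rightarrow> 'h" and A :: "('h \<times> 'h) set"
  assumes T: "bounded_selfadjoint T" and A: "(x, y) \<in> A \<longleftrightarrow> y = T x"
begin

lemmas blT = bounded_selfadjointD(1)[OF T]

sublocale T: bounded_linear T by (rule blT)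

lemma pre_minimal_single:
  assumes "\<phi> \<in> test_functions I"
  shows "(abs_L2 (\<lambda>t. \<phi> t *\<^sub>C f), abs_L2 (\<lambda>t. s *\<^sub>R (vderiv \<phi> t *\<^sub>C f) + \<phi> t *\<^sub>C T f)) \<in> pre_minimal s I A"
  unfolding pre_minimal_def
  by (intro CollectI exI[of _ 1] exI[of _ "\<lambda>_. \<phi>"] exI[of _ "\<lambda>_. f"] exI[of _ "\<lambda>_. T f"])
    (use assms A in auto)

lemma zero_pre_minimal: "(0, 0) \<in> pre_minimal s I A"
  unfolding pre_minimal_def
  by (intro CollectI exI[of _ 0] exI) (simp add: zero_L2_def[symmetric])

lemma pre_minimal_cases:
  assumes "(p, q) \<in> pre_minimal s I A"
  obtains n :: nat and \<phi> f where "\<And>j. j < n \<Longrightarrow> \<phi> j \<in> test_functions I"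
    "p = abs_L2 (\<lambda>t. \<Sum>j<n. \<phi> j t *\<^sub>C f j)"
    "q = abs_L2 (\<lambda>t. s *\<^sub>R (\<Sum>j<n. vderiv (\<phi> j) t *\<^sub>C f j) + T (\<Sum>j<n. \<phi> j t *\<^sub>C f j))"
proof -
  obtain n :: nat and \<phi> f g where pq: "\<forall>j<n. \<phi> j \<in> test_functions I \<and> (f j, g j) \<in> A"
    "p = abs_L2 (\<lambda>t. \<Sum>j<n. \<phi> j t *\<^sub>C f j)"
    "q = abs_L2 (\<lambda>t. \<Sum>j<n. s *\<^sub>R (vderiv (\<phi> j) t *\<^sub>C f j) + \<phi> j t *\<^sub>C g j)"
    using assms unfolding pre_minimal_def by blast
  have "(\<Sum>j<n. s *\<^sub>R (vderiv (\<phi> j) t *\<^sub>C f j) + \<phi> j t *\<^sub>C g j)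
      = s *\<^sub>R (\<Sum>j<n. vderiv (\<phi> j) t *\<^sub>C f j) + T (\<Sum>j<n. \<phi> j t *\<^sub>C f j)" for t
    using pq(1) by (simp add: sum.distrib scaleR_sum_right T.sum bounded_selfadjointD(2)[OF T] A)
  then show ?thesis using that[of n \<phi> f] pq by simp
qed

text \<open>
  The condition is only used for the elements \<open>\<psi> \<otimes> f\<close> with a single test function \<open>\<psi> = cnj \<circ> \<phi>\<close>; the
  conjugate compensates the conjugate linearity of \<open>cinner\<close> in its second argument. Since \<open>f\<close> is arbitrary,
  the resulting scalar identities combine to the vector identity that defines the weak derivative. The
  two signs \<open>s\<close> cover both formally adjoint expressions at once, as in \<open>pre_minimal\<close>.
\<close>

lemma adjoint_imp_weak_derivative:
  assumes s: "s * s = 1" and adj: "(u, w) \<in> adjoint_op (L2_on I) (pre_minimal s I A)"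
  shows "has_weak_derivative I u (s *\<^sub>R (L2_map T u - w))"
proof -
  have uw: "u \<in> L2_on I" "w \<in> L2_on I"
    and eq: "\<And>p q. (p, q) \<in> pre_minimal s I A \<Longrightarrow> cinner q u = cinner p w"
    using adj by (auto simp: adjoint_op_def)
  have "weak_derivative I u (s *\<^sub>R (L2_map T u - w))"
    unfolding weak_derivative_def
  proof
    fix \<phi> assume \<phi>: "\<phi> \<in> test_functions I"
    define \<psi> where "\<psi> = (\<lambda>t. cnj (\<phi> t))"
    have \<psi>: "\<psi> \<in> test_functions I" unfolding \<psi>_def by (rule test_function_cnj(1)[OF \<phi>])
    have cnj\<psi>: "(\<lambda>t. cnj (\<psi> t)) = \<phi>" by (simp add: \<psi>_def)
    define X where "X = (LINT t|lborel. vderiv \<phi> t *\<^sub>C rep_L2 u t)"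
    define Y where "Y = (LINT t|lborel. \<phi> t *\<^sub>C rep_L2 (L2_map T u) t)"
    define Z where "Z = (LINT t|lborel. \<phi> t *\<^sub>C rep_L2 w t)"
    have "cinner f (s *\<^sub>R X + Y - Z) = 0" for f
    proof -
      let ?p = "\<lambda>t. \<psi> t *\<^sub>C f" and ?p' = "\<lambda>t. vderiv \<psi> t *\<^sub>C f"
      note si = square_integrable_test[OF \<psi>, of f]
      have siT: "square_integrable (\<lambda>t. \<psi> t *\<^sub>C T f)" by (rule square_integrable_test(1)[OF \<psi>])
      have "cinner (abs_L2 (\<lambda>t. s *\<^sub>R ?p' t + \<psi> t *\<^sub>C T f)) u
          = (LINT t|lborel. s *\<^sub>R cinner (?p' t) (rep_L2 u t) + cinner (T (?p t)) (rep_L2 u t))"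
        using si siT
        by (simp add: cinner_abs_L2 square_integrable_add square_integrable_scaleR bounded_selfadjointD(2)[OF T]
            bounded_bilinear.add_left[OF bounded_bilinear_cinner]
            bounded_bilinear.scaleR_left[OF bounded_bilinear_cinner])
      also have "\<dots> = s *\<^sub>R (LINT t|lborel. cinner (?p' t) (rep_L2 u t))
          + (LINT t|lborel. cinner (T (?p t)) (rep_L2 u t))"
        using integrable_cinner_square_integrable[OF si(2) rep_L2_square_integrable[of u]]
          integrable_cinner_square_integrable[OF square_integrable_bounded_linear[OF blT si(1)] rep_L2_square_integrable[of u]]
        by simp
      also have "(LINT t|lborel. cinner (?p' t) (rep_L2 u t)) = cinner f X"
        using cinner_test_integral(2)[OF \<psi>, of f u] unfolding cnj\<psi> X_def .
      also have "(LINT t|lborel. cinner (T (?p t)) (rep_L2 u t)) = cinner f Y"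
        unfolding cinner_abs_L2_map[OF T si(1)] cinner_abs_L2[OF si(1)] Y_def
        using cinner_test_integral(1)[OF \<psi>, of f "L2_map T u"] unfolding \<psi>_def complex_cnj_cnj .
      finally have "cinner (abs_L2 (\<lambda>t. s *\<^sub>R ?p' t + \<psi> t *\<^sub>C T f)) u = s *\<^sub>R cinner f X + cinner f Y" .
      moreover have "cinner (abs_L2 ?p) w = cinner f Z"
        unfolding cinner_abs_L2[OF si(1)] Z_def
        using cinner_test_integral(1)[OF \<psi>, of f w] unfolding \<psi>_def complex_cnj_cnj .
      ultimately show ?thesis
        using eq[OF pre_minimal_single[OF \<psi>, of f s]]
        by (simp add: bounded_bilinear.add_right[OF bounded_bilinear_cinner]
            bounded_bilinear.diff_right[OF bounded_bilinear_cinner]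
            bounded_bilinear.scaleR_right[OF bounded_bilinear_cinner])
    qed
    from this[of "s *\<^sub>R X + Y - Z"] have zero: "s *\<^sub>R X + Y - Z = 0"
      by (metis Re_cinner inner_eq_zero_iff zero_complex.simps(1))
    have "(LINT t|lborel. \<phi> t *\<^sub>C rep_L2 (s *\<^sub>R (L2_map T u - w)) t)
        = (LINT t|lborel. \<phi> t *\<^sub>C (s *\<^sub>R (rep_L2 (L2_map T u) t - rep_L2 w t)))"
    proof (rule integral_test_cong(1)[OF \<phi>])
      show "AE t in lborel. t \<in> I \<longrightarrow> rep_L2 (s *\<^sub>R (L2_map T u - w)) t
          = s *\<^sub>R (rep_L2 (L2_map T u) t - rep_L2 w t)"
        using rep_L2_scaleR[of s "L2_map T u - w"] rep_L2_diff[of "L2_map T u" w] by eventually_elim simp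
    qed (intro set_integrable_scaleR_right set_integral_diff(1) rep_L2_set_integrable)+
    also have "\<dots> = (LINT t|lborel. s *\<^sub>R (\<phi> t *\<^sub>C rep_L2 (L2_map T u) t - \<phi> t *\<^sub>C rep_L2 w t))"
      by (simp only: bounded_bilinear.diff_right[OF bounded_bilinear_scaleC]
          bounded_bilinear.scaleR_right[OF bounded_bilinear_scaleC])
    also have "\<dots> = s *\<^sub>R (Y - Z)"
      using integrable_test_scaleC(1)[OF \<phi> rep_L2_set_integrable[of _ _ w]]
        integrable_test_scaleC(1)[OF \<phi> rep_L2_set_integrable[of _ _ "L2_map T u"]]
      by (simp add: Y_def Z_def)
    also have "Y - Z = - (s *\<^sub>R X)"
    proof -
      have "Y - Z = (s *\<^sub>R X + Y - Z) - s *\<^sub>R X" by simp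
      then show ?thesis unfolding zero by simp
    qed
    also have "s *\<^sub>R - (s *\<^sub>R X) = - (s * s) *\<^sub>R X" by simp
    finally show "(LINT t|lborel. vderiv \<phi> t *\<^sub>C rep_L2 u t)
        = - (LINT t|lborel. \<phi> t *\<^sub>C rep_L2 (s *\<^sub>R (L2_map T u - w)) t)"
      using s by (simp add: X_def)
  qed
  then show ?thesis
    using uw by (auto simp: has_weak_derivative_def intro!: L2_on_scaleR L2_on_diff L2_on_map[OF blT])
qed

lemma weak_derivative_imp_adjoint:
  assumes s: "s * s = 1" and wd: "has_weak_derivative I u (s *\<^sub>R (L2_map T u - w))" and w: "w \<in> L2_on I"
  shows "(u, w) \<in> adjoint_op (L2_on I) (pre_minimal s I A)"
proof -
  define g where "g = s *\<^sub>R (L2_map T u - w)"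
  have g: "s *\<^sub>R g = L2_map T u - w" using s by (simp add: g_def)
  have "cinner q u = cinner p w" if pq: "(p, q) \<in> pre_minimal s I A" for p q
  proof -
    obtain n :: nat and \<phi> f where \<phi>: "\<And>j. j < n \<Longrightarrow> \<phi> j \<in> test_functions I"
      and p: "p = abs_L2 (\<lambda>t. \<Sum>j<n. \<phi> j t *\<^sub>C f j)"
      and q: "q = abs_L2 (\<lambda>t. s *\<^sub>R (\<Sum>j<n. vderiv (\<phi> j) t *\<^sub>C f j) + T (\<Sum>j<n. \<phi> j t *\<^sub>C f j))"
      by (rule pre_minimal_cases[OF pq], rule that)
    let ?P = "\<lambda>t. \<Sum>j<n. \<phi> j t *\<^sub>C f j" and ?P' = "\<lambda>t. \<Sum>j<n. vderiv (\<phi> j) t *\<^sub>C f j"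
    have P: "square_integrable ?P" and P': "square_integrable ?P'"
      by (rule square_integrable_sum, rule square_integrable_test(1)[OF \<phi>], assumption,
          rule square_integrable_sum, rule square_integrable_test(2)[OF \<phi>])
    note ru = rep_L2_square_integrable[of u] and rg = rep_L2_square_integrable[of g]
    have "(LINT t|lborel. cinner (?P' t) (rep_L2 u t)) = (\<Sum>j<n. LINT t|lborel. cinner (vderiv (\<phi> j) t *\<^sub>C f j) (rep_L2 u t))"
      unfolding bounded_bilinear.sum_left[OF bounded_bilinear_cinner]
      by (rule Bochner_Integration.integral_sum)
        (auto intro!: integrable_cinner_square_integrable square_integrable_test(2) \<phi> ru)
    also have "\<dots> = (\<Sum>j<n. - (LINT t|lborel. cinner (\<phi> j t *\<^sub>C f j) (rep_L2 g t)))"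
    proof (rule sum.cong[OF refl])
      fix j assume "j \<in> {..<n}"
      then have \<phi>j: "\<phi> j \<in> test_functions I" using \<phi> by simp
      show "(LINT t|lborel. cinner (vderiv (\<phi> j) t *\<^sub>C f j) (rep_L2 u t))
          = - (LINT t|lborel. cinner (\<phi> j t *\<^sub>C f j) (rep_L2 g t))"
        using wd test_function_cnj(1)[OF \<phi>j]
        by (simp add: cinner_test_integral[OF \<phi>j] has_weak_derivative_def weak_derivative_def g_def
            bounded_bilinear.minus_right[OF bounded_bilinear_cinner])
    qed
    also have "\<dots> = - (LINT t|lborel. cinner (?P t) (rep_L2 g t))"
      unfolding bounded_bilinear.sum_left[OF bounded_bilinear_cinner] sum_negf
      by (subst Bochner_Integration.integral_sum)
        (auto intro!: integrable_cinner_square_integrable square_integrable_test(1) \<phi> rg)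
    also have "\<dots> = - cinner p g" by (simp only: p cinner_abs_L2[OF P])
    finally have P'u: "(LINT t|lborel. cinner (?P' t) (rep_L2 u t)) = - cinner p g" .
    have "cinner q u = (LINT t|lborel. s *\<^sub>R cinner (?P' t) (rep_L2 u t) + cinner (T (?P t)) (rep_L2 u t))"
      unfolding q
      by (subst cinner_abs_L2[OF square_integrable_add[OF square_integrable_scaleR[OF P']
              square_integrable_bounded_linear[OF blT P]]])
        (simp only: bounded_bilinear.add_left[OF bounded_bilinear_cinner]
          bounded_bilinear.scaleR_left[OF bounded_bilinear_cinner])
    also have "\<dots> = s *\<^sub>R (LINT t|lborel. cinner (?P' t) (rep_L2 u t)) + (LINT t|lborel. cinner (T (?P t)) (rep_L2 u t))"
      using integrable_cinner_square_integrable[OF P' ru]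
        integrable_cinner_square_integrable[OF square_integrable_bounded_linear[OF blT P] ru] by simp
    also have "\<dots> = cinner p (L2_map T u) - s *\<^sub>R cinner p g"
      by (simp only: P'u cinner_abs_L2_map[OF T P] p) simp
    also have "\<dots> = cinner p (L2_map T u - s *\<^sub>R g)"
      by (simp only: bounded_bilinear.diff_right[OF bounded_bilinear_cinner]
          bounded_bilinear.scaleR_right[OF bounded_bilinear_cinner])
    finally show ?thesis by (simp add: g)
  qed
  then show ?thesis using wd w by (auto simp: adjoint_op_def has_weak_derivative_def)
qed

lemma maximal_op_iff:
  "(u, w) \<in> maximal_op I A \<longleftrightarrow> has_weak_derivative I u (w - L2_map T u) \<and> w \<in> L2_on I"
proof -
  have eq: "(-1) *\<^sub>R (L2_map T u - w) = w - L2_map T u" by simp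
  have "w \<in> L2_on I" if "(u, w) \<in> maximal_op I A" using that by (simp add: maximal_op_def adjoint_op_def)
  then show ?thesis
    using adjoint_imp_weak_derivative[of "-1" u w I] weak_derivative_imp_adjoint[of "-1" I u w]
    unfolding maximal_op_def minimal_adj_op_def adjoint_op_closure eq by auto
qed

text \<open>
  If \<open>q = s p' + T p\<close>, then the formally adjoint expression maps \<open>p\<close> to \<open>- s p' + T p = 2 T p - q\<close>. Thus the
  two preminimal operators have the same domain.
\<close>

lemma pre_minimal_formal_adjoint:
  assumes s: "s * s = 1" and pq: "(p, q) \<in> pre_minimal s I A"
  shows "(p, 2 *\<^sub>R L2_map T p - q) \<in> pre_minimal (- s) I A"
    "has_weak_derivative I p (s *\<^sub>R (q - L2_map T p))"
proof -
  obtain n :: nat and \<phi> f where \<phi>: "\<And>j. j < n \<Longrightarrow> \<phi> j \<in> test_functions I"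
    and p: "p = abs_L2 (\<lambda>t. \<Sum>j<n. \<phi> j t *\<^sub>C f j)"
    and q: "q = abs_L2 (\<lambda>t. s *\<^sub>R (\<Sum>j<n. vderiv (\<phi> j) t *\<^sub>C f j) + T (\<Sum>j<n. \<phi> j t *\<^sub>C f j))"
    by (rule pre_minimal_cases[OF pq], rule that)
  let ?P = "\<lambda>t. \<Sum>j<n. \<phi> j t *\<^sub>C f j" and ?P' = "\<lambda>t. \<Sum>j<n. vderiv (\<phi> j) t *\<^sub>C f j"
  have P: "square_integrable ?P" and P': "square_integrable ?P'"
    by (rule square_integrable_sum, rule square_integrable_test(1)[OF \<phi>], assumption,
        rule square_integrable_sum, rule square_integrable_test(2)[OF \<phi>])
  have siq: "square_integrable (\<lambda>t. r *\<^sub>R ?P' t + T (?P t))" for r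
    by (intro square_integrable_add square_integrable_scaleR square_integrable_bounded_linear[OF blT] P P')
  have rp: "AE t in lborel. rep_L2 p t = ?P t" unfolding p by (rule rep_abs_L2[OF P])
  have rq: "AE t in lborel. rep_L2 q t = s *\<^sub>R ?P' t + T (?P t)" unfolding q by (rule rep_abs_L2[OF siq])
  have "2 *\<^sub>R L2_map T p - q = abs_L2 (\<lambda>t. (- s) *\<^sub>R ?P' t + T (?P t))"
  proof (rule L2_eqI)
    show "AE t in lborel. rep_L2 (2 *\<^sub>R L2_map T p - q) t = rep_L2 (abs_L2 (\<lambda>t. (- s) *\<^sub>R ?P' t + T (?P t))) t"
      using rp rq rep_L2_diff[of "2 *\<^sub>R L2_map T p" q] rep_L2_scaleR[of 2 "L2_map T p"]
        rep_L2_map[OF blT, of p] rep_abs_L2[OF siq[of "- s"]]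
      by eventually_elim (simp add: scaleR_2)
  qed
  also have "(\<lambda>t. (- s) *\<^sub>R ?P' t + T (?P t)) = (\<lambda>t. \<Sum>j<n. (- s) *\<^sub>R (vderiv (\<phi> j) t *\<^sub>C f j) + \<phi> j t *\<^sub>C T (f j))"
    by (simp only: sum.distrib scaleR_sum_right T.sum bounded_selfadjointD(2)[OF T])
  finally show "(p, 2 *\<^sub>R L2_map T p - q) \<in> pre_minimal (- s) I A"
    unfolding pre_minimal_def
    by (intro CollectI exI[of _ n] exI[of _ \<phi>] exI[of _ f] exI[of _ "\<lambda>j. T (f j)"]) (use p \<phi> A in auto)
  have P_out: "?P t = 0" and P'_out: "?P' t = 0" if "t \<notin> I" for t
    using test_function_outside[OF \<phi> that] test_function_vderiv_outside[OF \<phi> that]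
    by (simp_all add: scaleC_zero_left)
  have rg: "AE t in lborel. rep_L2 (s *\<^sub>R (q - L2_map T p)) t = ?P' t"
    using rp rq rep_L2_scaleR[of s "q - L2_map T p"] rep_L2_diff[of q "L2_map T p"] rep_L2_map[OF blT, of p]
    by eventually_elim (simp add: s)
  have "weak_derivative I p (s *\<^sub>R (q - L2_map T p))"
  proof (rule weak_derivative_of_primitive)
    show "primitive ?P ?P'"
      by (intro primitive_sum primitive_scaleC_const test_function_smooth[OF \<phi>])
    show "AE t in lborel. t \<in> I \<longrightarrow> rep_L2 p t = ?P t" using rp by eventually_elim simp
    show "AE t in lborel. t \<in> I \<longrightarrow> rep_L2 (s *\<^sub>R (q - L2_map T p)) t = ?P' t" using rg by eventually_elim simp
  qed
  moreover have "p \<in> L2_on I"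
    unfolding L2_on_def mem_Collect_eq using rp by eventually_elim (simp add: P_out)
  moreover have "s *\<^sub>R (q - L2_map T p) \<in> L2_on I"
    unfolding L2_on_def mem_Collect_eq using rg by eventually_elim (simp add: P'_out)
  ultimately show "has_weak_derivative I p (s *\<^sub>R (q - L2_map T p))"
    by (simp add: has_weak_derivative_def)
qed

end

lemma everywhere_defined_selfadjoint:
  fixes A :: "('h::{complex_inner, banach, second_countable_topology} \<times> 'h) set"
  assumes sa: "selfadjoint UNIV A" and total: "\<And>x. \<exists>y. (x, y) \<in> A"
  obtains T where "everywhere_defined_operator T A"
proof -
  define T where "T = (\<lambda>x. THE y. (x, y) \<in> A)"
  have sv: "y = z" if "(x, y) \<in> A" "(x, z) \<in> A" for x y z
    using sa that by (auto simp: selfadjoint_def linear_operator_def single_valued_def)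
  have A: "(x, y) \<in> A \<longleftrightarrow> y = T x" for x y
    unfolding T_def using total[of x] sv by (metis (mono_tags, lifting) theI)
  have sym: "cinner (T x) y = cinner x (T y)" for x y
  proof -
    have "(y, T y) \<in> adjoint_op UNIV A" using sa A by (simp add: selfadjoint_def)
    then show ?thesis using A by (auto simp: adjoint_op_def)
  qed
  have "inner (T x) y = inner x (T y)" for x y using sym by (simp flip: Re_cinner)
  then have "bounded_linear T" by (rule symmetric_imp_bounded_linear)
  moreover have "T (c *\<^sub>C x) = c *\<^sub>C T x" for c x
  proof -
    have "c *\<^sub>C (x, T x) \<in> A"
      using sa A by (auto simp: selfadjoint_def linear_operator_def complex_subspace_def)
    then show ?thesis by (simp add: scaleC_prod_def A)
  qed
  ultimately have "everywhere_defined_operator T A"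
    using sym A by unfold_locales (auto simp: bounded_selfadjoint_def)
  then show ?thesis by (rule that)
qed

section \<open>The boundary relation of a normal extension\<close>

lemma cinner_Pair: "cinner (x1, x2) (y1, y2) = cinner x1 y1 + cinner x2 y2"
  by (simp add: cinner_prod_def)

text \<open>
  The imaginary part of the identity is the real part of the identity for the multiple by \<open>- \<i>\<close>.
\<close>

lemma adjoint_op_of_inner:
  assumes R: "complex_subspace R" and X: "v \<in> X" "w \<in> X"
    and eq: "\<And>u z. (u, z) \<in> R \<Longrightarrow> inner z v = inner u w"
  shows "(v, w) \<in> adjoint_op X R"
proof -
  have "cinner z v = cinner u w" if uz: "(u, z) \<in> R" for u z
  proof -
    have "((- \<i>) *\<^sub>C u, (- \<i>) *\<^sub>C z) \<in> R"
      using R uz unfolding complex_subspace_def by (metis fst_conv snd_conv scaleC_prod_def)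
    from eq[OF this] eq[OF uz] show ?thesis by (simp add: cinner_conv_inner)
  qed
  then show ?thesis using X by (auto simp: adjoint_op_def)
qed

lemma boundary_value_exists:
  assumes "open I" "is_interval I" "I \<noteq> {}" "has_weak_derivative I u g"
  obtains x where "has_boundary_value I u c x"
  using weak_derivative_primitive[OF assms(1-3)] assms(4) has_boundary_value_primitive
  unfolding has_weak_derivative_def by metis

text \<open>
  For \<open>w = S x\<close> and \<open>z = S w\<close> symmetry gives \<open>\<langle>z, x\<rangle> = \<parallel>w\<parallel>\<^sup>2\<close>.
\<close>

lemma sqrt_op_kernel:
  fixes S :: "('h::complex_inner \<times> 'h) set"
  assumes S: "selfadjoint UNIV S" and xz: "(x, z) \<in> S O S" and zero: "inner z x = 0"
  shows "x \<in> ker_op S"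
proof -
  obtain w where w: "(x, w) \<in> S" "(w, z) \<in> S" using xz by auto
  have "(x, w) \<in> adjoint_op UNIV S" using S w(1) by (simp add: selfadjoint_def)
  then have "cinner z x = cinner w w" using w(2) by (auto simp: adjoint_op_def)
  then have "inner w w = 0" using zero by (metis Re_cinner)
  then show ?thesis using w(1) by (simp add: ker_op_def)
qed

text \<open>
  The situation of the theorem after the coefficients have been recognised as bounded operators \<open>T1\<close> and
  \<open>T2\<close>.
\<close>

locale normal_extension_on_halflines =
  op1: everywhere_defined_operator T1 A1 + op2: everywhere_defined_operator T2 A2
  for T1 T2 :: "'h::{complex_inner, banach, second_countable_topology} \<Rightarrow> 'h" and A1 A2 +
  fixes a b :: real and N :: "(('h L2 \<times> 'h L2) \<times> ('h L2 \<times> 'h L2)) set"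
  assumes normal: "normal_extension (L2_sum a b) (L_min a b A1 A2) N"
begin

abbreviation "Ia \<equiv> {..<a}"
abbreviation "Ib \<equiv> {b<..}"
abbreviation "X \<equiv> L2_sum a b"

lemma halflines: "open Ia" "is_interval Ia" "Ia \<noteq> {}" "open Ib" "is_interval Ib" "Ib \<noteq> {}"
  "a \<in> closure Ia" "b \<in> closure Ib"
  using is_interval_halflines(1)[of a] is_interval_halflines(2)[of b] by auto

lemma N_facts:
  shows "N \<subseteq> X \<times> X" "complex_subspace N" "Domain N = Domain (adjoint_op X N)" "L_min a b A1 A2 \<subseteq> N"
    "(f, g) \<in> N \<Longrightarrow> (f, h) \<in> adjoint_op X N \<Longrightarrow> norm g = norm h"
  using normal unfolding normal_extension_def normal_op_def formally_normal_def linear_operator_def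
  by blast+

lemma minimal_left:
  assumes "(p, q) \<in> pre_minimal 1 Ia A1" shows "((p, 0), (q, 0)) \<in> N"
proof -
  have "(p, q) \<in> minimal_op Ia A1" "(0, 0) \<in> minimal_op Ib A2"
    using assms op2.zero_pre_minimal[of 1 Ib] closure_subset unfolding minimal_op_def by blast+
  then have "((p, 0), (q, 0)) \<in> L_min a b A1 A2" by (auto simp: L_min_def direct_sum_op_def)
  then show ?thesis using N_facts(4) by blast
qed

lemma minimal_right:
  assumes "(p, q) \<in> pre_minimal 1 Ib A2" shows "((0, p), (0, q)) \<in> N"
proof -
  have "(p, q) \<in> minimal_op Ib A2" "(0, 0) \<in> minimal_op Ia A1"
    using assms op1.zero_pre_minimal[of 1 Ia] closure_subset unfolding minimal_op_def by blast+
  then have "((0, p), (0, q)) \<in> L_min a b A1 A2" by (auto simp: L_min_def direct_sum_op_def)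
  then show ?thesis using N_facts(4) by blast
qed

lemma adjoint_eq:
  assumes "((u1, u2), (h1, h2)) \<in> adjoint_op X N" "((p1, p2), (q1, q2)) \<in> N"
  shows "cinner q1 u1 + cinner q2 u2 = cinner p1 h1 + cinner p2 h2"
  using assms by (fastforce simp: adjoint_op_def cinner_Pair)

text \<open>
  \<open>N\<close> extends \<open>L\<^sub>0\<close>, so its adjoint is contained in the adjoint of \<open>L\<^sub>0\<close>. Hence \<open>N\<^sup>* u = - u' + A u\<close>.
\<close>

lemma adjoint_weak_derivative:
  assumes adj: "((u1, u2), (h1, h2)) \<in> adjoint_op X N"
  shows "has_weak_derivative Ia u1 (L2_map T1 u1 - h1)" "has_weak_derivative Ib u2 (L2_map T2 u2 - h2)"
proof -
  have mem: "u1 \<in> L2_on Ia" "h1 \<in> L2_on Ia" "u2 \<in> L2_on Ib" "h2 \<in> L2_on Ib"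
    using adj by (auto simp: adjoint_op_def L2_sum_def)
  have "(u1, h1) \<in> adjoint_op (L2_on Ia) (pre_minimal 1 Ia A1)"
    using mem adjoint_eq[OF adj minimal_left] by (auto simp: adjoint_op_def)
  from op1.adjoint_imp_weak_derivative[OF _ this]
  show "has_weak_derivative Ia u1 (L2_map T1 u1 - h1)" by simp
  have "(u2, h2) \<in> adjoint_op (L2_on Ib) (pre_minimal 1 Ib A2)"
    using mem adjoint_eq[OF adj minimal_right] by (auto simp: adjoint_op_def)
  from op2.adjoint_imp_weak_derivative[OF _ this]
  show "has_weak_derivative Ib u2 (L2_map T2 u2 - h2)" by simp
qed

lemma zero_weak_derivative: "has_weak_derivative I 0 (0 :: 'h L2)"
proof -
  have "weak_derivative I 0 (0 :: 'h L2)"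
  proof (rule weak_derivative_of_primitive)
    show "primitive (\<lambda>_. 0 :: 'h) (\<lambda>_. 0)"
      by (simp add: primitive_def set_integrable_def set_lebesgue_integral_def)
  qed (use rep_L2_zero[where 'a = 'h] in eventually_elim, simp)+
  then show ?thesis by (simp add: has_weak_derivative_def L2_on_zero)
qed

lemma L2_map_zero:
  assumes "bounded_linear T" shows "L2_map T (0 :: 'h L2) = 0"
proof (rule L2_eqI)
  show "AE t in lborel. rep_L2 (L2_map T 0) t = rep_L2 (0 :: 'h L2) t"
    using rep_L2_map[OF assms, of 0] rep_L2_zero[where 'a = 'h]
    by eventually_elim (simp add: linear_simps[OF assms])
qed

lemma N_adjoint_exists:
  assumes "((p1, p2), q) \<in> N"
  obtains h1 h2 where "((p1, p2), (h1, h2)) \<in> adjoint_op X N"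
  using assms N_facts(3) by (metis Domain.DomainI Domain.cases surj_pair)

text \<open>
  An element \<open>p\<close> of the domain of the preminimal operator belongs to \<open>D(N) = D(N\<^sup>*)\<close>, and the
  value of \<open>N\<^sup>*\<close> at \<open>p\<close> is determined by the weak derivative of \<open>p\<close>. So \<open>N\<^sup>*\<close> extends \<open>L\<^sub>0\<^sup>+\<close>.
\<close>

lemma adjoint_minimal_left:
  assumes pq: "(p, q) \<in> pre_minimal (- 1) Ia A1" shows "((p, 0), (q, 0)) \<in> adjoint_op X N"
proof -
  note fa = op1.pre_minimal_formal_adjoint[OF _ pq, simplified]
  obtain h1 h2 where h: "((p, 0), (h1, h2)) \<in> adjoint_op X N"
    using N_adjoint_exists[OF minimal_left[OF fa(1)]] by metis
  note wd = adjoint_weak_derivative[OF h]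
  have "L2_map T1 p - h1 = L2_map T1 p - q"
    using weak_derivative_unique[OF halflines(1) wd(1) fa(2)] by simp
  moreover have "L2_map T2 0 - h2 = 0"
    by (rule weak_derivative_unique[OF halflines(4) wd(2) zero_weak_derivative])
  ultimately have "h1 = q" "h2 = 0" by (simp_all add: L2_map_zero[OF op2.blT])
  then show ?thesis using h by simp
qed

lemma adjoint_minimal_right:
  assumes pq: "(p, q) \<in> pre_minimal (- 1) Ib A2" shows "((0, p), (0, q)) \<in> adjoint_op X N"
proof -
  note fa = op2.pre_minimal_formal_adjoint[OF _ pq, simplified]
  obtain h1 h2 where h: "((0, p), (h1, h2)) \<in> adjoint_op X N"
    using N_adjoint_exists[OF minimal_right[OF fa(1)]] by metis
  note wd = adjoint_weak_derivative[OF h]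
  have "L2_map T2 p - h2 = L2_map T2 p - q"
    using weak_derivative_unique[OF halflines(4) wd(2) fa(2)] by simp
  moreover have "L2_map T1 0 - h1 = 0"
    by (rule weak_derivative_unique[OF halflines(1) wd(1) zero_weak_derivative])
  ultimately have "h2 = q" "h1 = 0" by (simp_all add: L2_map_zero[OF op1.blT])
  then show ?thesis using h by simp
qed

text \<open>
  \<open>N\<close> is contained in the adjoint of \<open>N\<^sup>*\<close>, and \<open>N\<^sup>*\<close> extends \<open>L\<^sub>0\<^sup>+\<close>.
\<close>

lemma N_maximal:
  assumes uz: "((u1, u2), (z1, z2)) \<in> N"
  shows "(u1, z1) \<in> maximal_op Ia A1" "(u2, z2) \<in> maximal_op Ib A2"
proof -
  have mem: "u1 \<in> L2_on Ia" "z1 \<in> L2_on Ia" "u2 \<in> L2_on Ib" "z2 \<in> L2_on Ib"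
    using uz N_facts(1) by (auto simp: L2_sum_def)
  have "cinner q u1 = cinner p z1" if "(p, q) \<in> pre_minimal (- 1) Ia A1" for p q
    using adjoint_eq[OF adjoint_minimal_left[OF that] uz] cinner_commute[of q u1] cinner_commute[of p z1]
    by simp
  then show "(u1, z1) \<in> maximal_op Ia A1"
    unfolding maximal_op_def minimal_adj_op_def adjoint_op_closure
    using mem by (auto simp: adjoint_op_def)
  have "cinner q u2 = cinner p z2" if "(p, q) \<in> pre_minimal (- 1) Ib A2" for p q
    using adjoint_eq[OF adjoint_minimal_right[OF that] uz] cinner_commute[of q u2] cinner_commute[of p z2]
    by simp
  then show "(u2, z2) \<in> maximal_op Ib A2"
    unfolding maximal_op_def minimal_adj_op_def adjoint_op_closure
    using mem by (auto simp: adjoint_op_def)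
qed

lemma N_weak_derivative:
  assumes uz: "((u1, u2), (z1, z2)) \<in> N"
  shows "has_weak_derivative Ia u1 (z1 - L2_map T1 u1)" "has_weak_derivative Ib u2 (z2 - L2_map T2 u2)"
  using N_maximal[OF uz] by (simp_all add: op1.maximal_op_iff op2.maximal_op_iff)

lemma greens_formula_pair:
  assumes "has_weak_derivative Ia u1 g1" "has_boundary_value Ia u1 a x"
    "has_weak_derivative Ib u2 g2" "has_boundary_value Ib u2 b y"
    "has_weak_derivative Ia v1 k1" "has_boundary_value Ia v1 a x'"
    "has_weak_derivative Ib v2 k2" "has_boundary_value Ib v2 b y'"
  shows "inner g1 v1 + inner g2 v2 + (inner u1 k1 + inner u2 k2) = inner x x' - inner y y'"
  using greens_formula_left[OF assms(1,2,5,6)] greens_formula_right[OF assms(3,4,7,8)] by simp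

text \<open>
  The boundary pairs \<open>(u\<^sub>1(a), u\<^sub>2(b))\<close> of the domain of \<open>N\<close>, the relation \<open>G\<close> of the introduction.
\<close>

definition boundary :: "('h \<times> 'h) set" where
  "boundary = {(x, y). \<exists>u1 u2 z. ((u1, u2), z) \<in> N \<and> has_boundary_value Ia u1 a x \<and> has_boundary_value Ib u2 b y}"

lemma boundary_of_domain:
  assumes "((u1, u2), z) \<in> N"
  obtains x y where "has_boundary_value Ia u1 a x" "has_boundary_value Ib u2 b y" "(x, y) \<in> boundary"
proof -
  obtain z1 z2 where z: "z = (z1, z2)" by (cases z)
  note wd = N_weak_derivative[OF assms[unfolded z]]
  obtain x where x: "has_boundary_value Ia u1 a x" by (rule boundary_value_exists[OF halflines(1-3) wd(1)])
  obtain y where y: "has_boundary_value Ib u2 b y" by (rule boundary_value_exists[OF halflines(4-6) wd(2)])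
  show ?thesis using that[OF x y] x y assms unfolding boundary_def by blast
qed

text \<open>
  For \<open>u\<close> and \<open>v\<close> in the common domain of \<open>N\<close> and \<open>N\<^sup>*\<close>, the boundary terms of Green's formula are
  \<open>\<langle>N u, v\<rangle> - \<langle>u, N\<^sup>* v\<rangle> = 0\<close>, since the contributions of the symmetric coefficient cancel.
\<close>

lemma boundary_neutral:
  assumes xy: "(x, y) \<in> boundary" and xy': "(x', y') \<in> boundary"
  shows "inner x x' = inner y y'"
proof -
  obtain u1 u2 z1 z2 where u: "((u1, u2), (z1, z2)) \<in> N" "has_boundary_value Ia u1 a x" "has_boundary_value Ib u2 b y"
    using xy unfolding boundary_def by auto
  obtain v1 v2 z' where v: "((v1, v2), z') \<in> N" "has_boundary_value Ia v1 a x'" "has_boundary_value Ib v2 b y'"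
    using xy' unfolding boundary_def by auto
  obtain h1 h2 where h: "((v1, v2), (h1, h2)) \<in> adjoint_op X N" by (rule N_adjoint_exists[OF v(1)])
  note wu = N_weak_derivative[OF u(1)] and wv = adjoint_weak_derivative[OF h]
  have "inner z1 v1 + inner z2 v2 = inner u1 h1 + inner u2 h2"
    using arg_cong[OF adjoint_eq[OF h u(1)], of Re] by (simp add: Re_cinner)
  moreover have "inner (z1 - L2_map T1 u1) v1 + inner (z2 - L2_map T2 u2) v2
      + (inner u1 (L2_map T1 v1 - h1) + inner u2 (L2_map T2 v2 - h2)) = inner x x' - inner y y'"
    by (rule greens_formula_pair[OF wu(1) u(2) wu(2) u(3) wv(1) v(2) wv(2) v(3)])
  ultimately show ?thesis
    by (simp add: inner_diff_left inner_diff_right inner_L2_map[OF op1.T] inner_L2_map[OF op2.T])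
qed

text \<open>
  The vanishing boundary terms say that \<open>- v' + A v\<close> serves as the value of \<open>N\<^sup>*\<close> at \<open>v\<close>; normality moves \<open>v\<close>
  from \<open>D(N\<^sup>*)\<close> to \<open>D(N)\<close>.
\<close>

lemma domain_of_boundary_condition:
  assumes v: "has_weak_derivative Ia v1 k1" "has_boundary_value Ia v1 a x'"
    "has_weak_derivative Ib v2 k2" "has_boundary_value Ib v2 b y'"
    and orth: "\<And>x y. (x, y) \<in> boundary \<Longrightarrow> inner x x' = inner y y'"
  shows "(v1, v2) \<in> Domain N"
proof -
  let ?h1 = "L2_map T1 v1 - k1" and ?h2 = "L2_map T2 v2 - k2"
  have "((v1, v2), (?h1, ?h2)) \<in> adjoint_op X N"
  proof (rule adjoint_op_of_inner[OF N_facts(2)])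
    show "(v1, v2) \<in> X" "(?h1, ?h2) \<in> X"
      using v L2_on_map[OF op1.blT] L2_on_map[OF op2.blT]
      by (auto simp: has_weak_derivative_def L2_sum_def intro!: L2_on_diff)
    fix u z assume "(u, z) \<in> N"
    moreover obtain u1 u2 z1 z2 where uz: "u = (u1, u2)" "z = (z1, z2)" by (cases u, cases z)
    ultimately have N: "((u1, u2), (z1, z2)) \<in> N" by simp
    obtain x y where xy: "has_boundary_value Ia u1 a x" "has_boundary_value Ib u2 b y" "(x, y) \<in> boundary"
      by (rule boundary_of_domain[OF N])
    note wu = N_weak_derivative[OF N]
    have "inner (z1 - L2_map T1 u1) v1 + inner (z2 - L2_map T2 u2) v2
        + (inner u1 k1 + inner u2 k2) = inner x x' - inner y y'"
      by (rule greens_formula_pair[OF wu(1) xy(1) wu(2) xy(2) v])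
    then show "inner z (v1, v2) = inner u (?h1, ?h2)"
      using orth[OF xy(3)]
      by (simp add: uz inner_diff_left inner_diff_right inner_L2_map[OF op1.T] inner_L2_map[OF op2.T])
  qed
  then show ?thesis unfolding N_facts(3) by blast
qed

lemma boundary_maximal:
  assumes "\<And>x y. (x, y) \<in> boundary \<Longrightarrow> inner x x' = inner y y'"
  shows "(x', y') \<in> boundary"
proof -
  obtain v1 k1 where v1: "has_weak_derivative Ia v1 k1" "has_boundary_value Ia v1 a x'"
    using boundary_value_attained[OF halflines(1)] by metis
  obtain v2 k2 where v2: "has_weak_derivative Ib v2 k2" "has_boundary_value Ib v2 b y'"
    using boundary_value_attained[OF halflines(4)] by metis
  have "(v1, v2) \<in> Domain N"
    by (rule domain_of_boundary_condition[OF v1 v2 assms])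
  then show ?thesis using v1 v2 unfolding boundary_def by blast
qed

lemma boundary_scaleC:
  assumes "(x, y) \<in> boundary" shows "(c *\<^sub>C x, c *\<^sub>C y) \<in> boundary"
proof -
  obtain u1 u2 z where u: "((u1, u2), z) \<in> N" "has_boundary_value Ia u1 a x" "has_boundary_value Ib u2 b y"
    using assms unfolding boundary_def by auto
  have "c *\<^sub>C ((u1, u2), z) \<in> N" using N_facts(2) u(1) unfolding complex_subspace_def by blast
  then have "((c *\<^sub>C u1, c *\<^sub>C u2), c *\<^sub>C z) \<in> N" by (simp add: scaleC_prod_def)
  then show ?thesis using has_boundary_value_scaleC[OF u(2)] has_boundary_value_scaleC[OF u(3)]
    unfolding boundary_def by blast
qed

text \<open>
  With \<open>z = g + t\<close> and \<open>h = t - g\<close>, where \<open>g = u'\<close> and \<open>t = A u\<close>, equality of the norms of \<open>z = N u\<close> and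
  \<open>h = N\<^sup>* u\<close> means \<open>\<langle>g, t\<rangle> = 0\<close>. Green's formula for \<open>u\<close> and \<open>A u\<close> expresses \<open>2 \<langle>u', A u\<rangle>\<close> by boundary terms.
\<close>

lemma boundary_energy:
  assumes "(x, y) \<in> boundary" shows "inner x (T1 x) = inner y (T2 y)"
proof -
  obtain u1 u2 z1 z2 where u: "((u1, u2), (z1, z2)) \<in> N" "has_boundary_value Ia u1 a x" "has_boundary_value Ib u2 b y"
    using assms unfolding boundary_def by auto
  obtain h1 h2 where h: "((u1, u2), (h1, h2)) \<in> adjoint_op X N" by (rule N_adjoint_exists[OF u(1)])
  note wd = N_weak_derivative[OF u(1)]
  define t1 t2 where "t1 = L2_map T1 u1" and "t2 = L2_map T2 u2"
  define g1 g2 where "g1 = z1 - t1" and "g2 = z2 - t2"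
  have "g1 = t1 - h1" "g2 = t2 - h2"
    using weak_derivative_unique[OF halflines(1) wd(1) adjoint_weak_derivative(1)[OF h]]
      weak_derivative_unique[OF halflines(4) wd(2) adjoint_weak_derivative(2)[OF h]]
    by (simp_all add: g1_def g2_def t1_def t2_def)
  then have zh: "z1 = t1 + g1" "h1 = t1 - g1" "z2 = t2 + g2" "h2 = t2 - g2"
    by (simp_all add: g1_def g2_def algebra_simps)
  have "norm (z1, z2) = norm (h1, h2)" by (rule N_facts(5)[OF u(1) h])
  then have "inner (z1, z2) (z1, z2) = inner (h1, h2) (h1, h2)" by (simp add: norm_eq_sqrt_inner)
  then have energy: "inner g1 t1 + inner g2 t2 = 0"
    by (simp add: zh inner_add_left inner_add_right inner_diff_left inner_diff_right inner_commute)
  have "inner g1 t1 + inner u1 (L2_map T1 g1) = inner x (T1 x)"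
    unfolding g1_def t1_def
    by (rule greens_formula_left[OF wd(1) u(2) has_weak_derivative_map[OF op1.blT halflines(1-3) wd(1)]
          has_boundary_value_map[OF op1.blT u(2)]])
  moreover have "inner g2 t2 + inner u2 (L2_map T2 g2) = - inner y (T2 y)"
    unfolding g2_def t2_def
    by (rule greens_formula_right[OF wd(2) u(3) has_weak_derivative_map[OF op2.blT halflines(4-6) wd(2)]
          has_boundary_value_map[OF op2.blT u(3)]])
  moreover have "inner u1 (L2_map T1 g1) = inner g1 t1"
    unfolding t1_def inner_L2_map[OF op1.T, of u1 g1, symmetric] by (rule inner_commute)
  moreover have "inner u2 (L2_map T2 g2) = inner g2 t2"
    unfolding t2_def inner_L2_map[OF op2.T, of u2 g2, symmetric] by (rule inner_commute)
  ultimately show ?thesis using energy by simp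
qed

lemma boundary_value_surjective:
  obtains u1 u2 z where "((u1, u2), z) \<in> N" "has_boundary_value Ia u1 a x"
  using neutral_relation_domain[of boundary x, OF boundary_neutral boundary_maximal]
  unfolding boundary_def by blast

text \<open>
  The boundary relation is neutral and contains everything orthogonal to it, so it is the graph of a
  unitary \<open>W\<close>, and a function in the maximal domain belongs to \<open>D(N)\<close> as soon as its boundary pair lies on
  this graph.
\<close>

lemma extension_eq_L_W:
  assumes ker: "\<And>x y. (x, y) \<in> boundary \<Longrightarrow> x \<in> ker_op S1 \<and> y \<in> ker_op S2"
  obtains W where "unitary_op W" "N = L_W a b A1 A2 S1 S2 W"
proof -
  obtain W where W: "unitary_op W" "\<And>x y. (x, y) \<in> boundary \<longleftrightarrow> y = W x"
    using neutral_relation_unitary[OF boundary_neutral boundary_maximal boundary_scaleC] by metis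
  have "N \<subseteq> L_W a b A1 A2 S1 S2 W"
  proof
    fix p assume p: "p \<in> N"
    obtain u1 u2 z1 z2 where p_eq: "p = ((u1, u2), (z1, z2))" by (metis surj_pair)
    obtain x y where xy: "has_boundary_value Ia u1 a x" "has_boundary_value Ib u2 b y" "(x, y) \<in> boundary"
      by (rule boundary_of_domain[OF p[unfolded p_eq]])
    have "((u1, u2), (z1, z2)) \<in> L_max a b A1 A2"
      using N_maximal p unfolding p_eq L_max_def direct_sum_op_def by blast
    then show "p \<in> L_W a b A1 A2 S1 S2 W"
      unfolding L_W_def p_eq using xy ker[OF xy(3)] W(2) by blast
  qed
  moreover have "L_W a b A1 A2 S1 S2 W \<subseteq> N"
  proof
    fix p assume "p \<in> L_W a b A1 A2 S1 S2 W"
    then obtain u1 u2 w1 w2 x where p_eq: "p = ((u1, u2), (w1, w2))"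
      and max: "(u1, w1) \<in> maximal_op Ia A1" "(u2, w2) \<in> maximal_op Ib A2"
      and bv: "has_boundary_value Ia u1 a x" "has_boundary_value Ib u2 b (W x)"
      unfolding L_W_def L_max_def direct_sum_op_def by blast
    have wd: "has_weak_derivative Ia u1 (w1 - L2_map T1 u1)" "has_weak_derivative Ib u2 (w2 - L2_map T2 u2)"
      using max by (simp_all add: op1.maximal_op_iff op2.maximal_op_iff)
    have "(x, W x) \<in> boundary" using W(2) by simp
    then have "(u1, u2) \<in> Domain N"
      by (intro domain_of_boundary_condition[OF wd(1) bv(1) wd(2) bv(2)] boundary_neutral)
    then obtain z1 z2 where z: "((u1, u2), (z1, z2)) \<in> N" by auto
    have "z1 - L2_map T1 u1 = w1 - L2_map T1 u1" "z2 - L2_map T2 u2 = w2 - L2_map T2 u2"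
      using weak_derivative_unique[OF halflines(1) N_weak_derivative(1)[OF z] wd(1)]
        weak_derivative_unique[OF halflines(4) N_weak_derivative(2)[OF z] wd(2)] by auto
    then show "p \<in> N" using z p_eq by simp
  qed
  ultimately show ?thesis using that[OF W(1)] by blast
qed

lemma unitary_determined:
  assumes "N = L_W a b A1 A2 S1 S2 W" "N = L_W a b A1 A2 S1 S2 W'"
  shows "W = W'"
proof
  fix x
  obtain u1 u2 z where u: "((u1, u2), z) \<in> N" "has_boundary_value Ia u1 a x"
    by (rule boundary_value_surjective)
  have "has_boundary_value Ib u2 b (V x)" if eq: "N = L_W a b A1 A2 S1 S2 V" for V
  proof -
    obtain x' where x': "has_boundary_value Ia u1 a x'" "has_boundary_value Ib u2 b (V x')"
      using u(1) unfolding eq L_W_def by blast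
    then show ?thesis
      using has_boundary_value_unique[OF halflines(1,7) u(2) x'(1)] by simp
  qed
  then show "W x = W' x"
    using has_boundary_value_unique[OF halflines(4,8)] assms by blast
qed

end

section \<open>The boundary conditions of normal extensions\<close>

theorem theorem2p5:
  fixes A1 A2 S1 S2 :: "('h::{complex_inner, banach, second_countable_topology} \<times> 'h) set"
    and a b :: real
  assumes "a < b"
    and "selfadjoint UNIV A1" and "nonpos_op A1"
    and "selfadjoint UNIV A2" and "nonneg_op A2"
    and "is_sqrt_op UNIV S1 (neg_op A1)" and "is_sqrt_op UNIV S2 A2"
    and "preserves_W21 S1 {..<a}" and "preserves_W21 S2 {b<..}"
  shows "(\<forall>Lt. normal_extension (L2_sum a b) (L_min a b A1 A2) Lt \<longrightarrow>
            (\<exists>W. unitary_op W \<and> Lt = L_W a b A1 A2 S1 S2 W))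
       \<and> (\<forall>Lt Lt' W W'.
            normal_extension (L2_sum a b) (L_min a b A1 A2) Lt \<and>
            normal_extension (L2_sum a b) (L_min a b A1 A2) Lt' \<and>
            unitary_op W \<and> unitary_op W' \<and>
            Lt = L_W a b A1 A2 S1 S2 W \<and> Lt' = L_W a b A1 A2 S1 S2 W' \<longrightarrow>
            (Lt = Lt' \<longleftrightarrow> W = W'))"
proof -
  have S: "selfadjoint UNIV S1" "S1 O S1 = neg_op A1" "selfadjoint UNIV S2" "S2 O S2 = A2"
    using assms(6,7) by (simp_all add: is_sqrt_op_def)
  have sub: "complex_subspace S1" "complex_subspace S2"
    using S by (simp_all add: selfadjoint_def linear_operator_def)
  (* the inclusions make the square roots, and with them the coefficients, everywhere defined *)
  have S1: "\<exists>y. (x, y) \<in> S1" for x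
    by (rule preserves_W21_everywhere_defined[OF assms(8) _ _ sub(1)]) auto
  have S2: "\<exists>y. (x, y) \<in> S2" for x
    by (rule preserves_W21_everywhere_defined[OF assms(9) _ _ sub(2)]) auto
  have "\<exists>y. (x, y) \<in> neg_op A1" for x using S1 unfolding S(2)[symmetric] by (meson relcomp.relcompI)
  then have "\<exists>y. (x, y) \<in> A1" for x unfolding neg_op_def by blast
  then obtain T1 where T1: "everywhere_defined_operator T1 A1"
    using everywhere_defined_selfadjoint[OF assms(2)] by metis
  have "\<exists>y. (x, y) \<in> A2" for x using S2 unfolding S(4)[symmetric] by (meson relcomp.relcompI)
  then obtain T2 where T2: "everywhere_defined_operator T2 A2"
    using everywhere_defined_selfadjoint[OF assms(4)] by metis
  note A1 = everywhere_defined_operator.A[OF T1] and A2 = everywhere_defined_operator.A[OF T2]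
  have neg: "inner x (T1 x) \<le> 0" for x
    using assms(3) A1[of x "T1 x"] unfolding nonpos_op_def Re_cinner by (auto simp: inner_commute)
  have pos: "0 \<le> inner y (T2 y)" for y
    using assms(5) A2[of y "T2 y"] unfolding nonneg_op_def Re_cinner by (auto simp: inner_commute)
  have ext: "normal_extension_on_halflines T1 T2 A1 A2 a b N"
    if "normal_extension (L2_sum a b) (L_min a b A1 A2) N" for N
    using T1 T2 that by (simp add: normal_extension_on_halflines_def normal_extension_on_halflines_axioms_def)
  have exists: "\<exists>W. unitary_op W \<and> N = L_W a b A1 A2 S1 S2 W"
    if "normal_extension (L2_sum a b) (L_min a b A1 A2) N" for N
  proof -
    interpret normal_extension_on_halflines T1 T2 A1 A2 a b N by (rule ext[OF that])
    have "x \<in> ker_op S1 \<and> y \<in> ker_op S2" if "(x, y) \<in> boundary" for x y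
    proof -
      have zero: "inner x (T1 x) = 0" "inner y (T2 y) = 0"
        using boundary_energy[OF that] neg[of x] pos[of y] by linarith+
      have "(x, - T1 x) \<in> S1 O S1" "(y, T2 y) \<in> S2 O S2"
        unfolding S(2,4) using A1 A2 by (auto simp: neg_op_def)
      then show ?thesis
        using sqrt_op_kernel[OF S(1), of x "- T1 x"] sqrt_op_kernel[OF S(3), of y "T2 y"] zero
        by (simp add: inner_commute)
    qed
    from extension_eq_L_W[OF this] show ?thesis by metis
  qed
  have unique: "W = W'" if "normal_extension (L2_sum a b) (L_min a b A1 A2) N"
    "N = L_W a b A1 A2 S1 S2 W" "N = L_W a b A1 A2 S1 S2 W'" for N W W'
    by (rule normal_extension_on_halflines.unitary_determined[OF ext[OF that(1)] that(2,3)])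
  show ?thesis
    using exists unique by blast
qed

end
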